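(* A graph property is nondeterministically testable if and only if it is testable.
   Context: A graph property is a class of finite simple graphs closed under isomorphism. For a graph $G$ and a property $\mathcal{P}$, the edit distance of $G$ from $\mathcal{P}$ is the minimum number of edges that must be added or deleted in $G$ to obtain a graph in $\mathcal{P}$ on the same node set. A property $\mathcal{P}$ is testable if there is another property $\mathcal{T}$ (a test property) such that: (i) if $G\in\mathcal{P}$, then for every $1\le r\le |V(G)|$, an induced subgraph of $G$ on $r$ nodes chosen uniformly at random has property $\mathcal{T}$ with probability at least $2/3$; and (ii) for every $\varepsilon>0$ there is $r_\varepsilon\ge 1$ such that if the edit distance of $G$ from $\mathcal{P}$ is at least $\varepsilon|V(G)|^2$, then for all $r_\varepsilon\le r\le |V(G)|$, a uniformly random induced subgraph on $r$ nodes has property $\mathcal{T}$ with probability at most $1/3$. A $k$-colored digraph is a finite complete digraph (every ordered pair $(u,v)$ of distinct nodes is an edge) whose edges are colored with colors $1,\dots,k$. Properties of $k$-colored digraphs (classes closed under color-preserving isomorphism) and their testability are defined in exactly the same way, where the edit distance of $L$ from a property counts the minimum number of ordered pairs whose color must be changed to obtain a member of the property on the same node set, and induced subgraphs inherit the coloring. Given integers $k\ge m\ge 1$ and a $k$-colored digraph $L$, its shadow $L'$ is the simple graph on $V(L)$ in which distinct $u,v$ are adjacent iff at least one of the ordered pairs $(u,v),(v,u)$ has a color in $\{1,\dots,m\}$. For a property $\mathcal{Q}$ of $k$-colored digraphs, $\mathcal{Q}'=\{L' : L\in\mathcal{Q}\}$. A graph property $\mathcal{P}$ is nondeterministically testable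 if there exist integers $k\ge m\ge 1$ and a testable property $\mathcal{Q}$ of $k$-colored digraphs with $\mathcal{Q}'=\mathcal{P}$. *)

theory Defs
  imports Main "HOL-Library.Extended_Nat"
begin

text \<open>A finite simple graph on nodes drawn from nat: a finite node set together with a
set of 2-element subsets of it.  (Every finite simple graph is isomorphic to one of these.)\<close>

type_synonym graph = "nat set \<times> nat set set"

definition verts :: "graph \<Rightarrow> nat set" where "verts G = fst G"
definition edges :: "graph \<Rightarrow> nat set set" where "edges G = snd G"

definition is_graph :: "graph \<Rightarrow> bool" where
  "is_graph G \<longleftrightarrow> finite (verts G) \<and>
     edges G \<subseteq> {{u, v} | u v. u \<in> verts G \<and> v \<in> verts G \<and> u \<noteq> v}"

definition graph_iso :: "graph \<Rightarrow> graph \<Rightarrow> bool" where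
  "graph_iso G H \<longleftrightarrow> (\<exists>f. bij_betw f (verts G) (verts H) \<and> edges H = (\<lambda>e. f ` e) ` edges G)"

definition graph_property :: "graph set \<Rightarrow> bool" where
  "graph_property P \<longleftrightarrow> (\<forall>G\<in>P. is_graph G) \<and>
     (\<forall>G H. G \<in> P \<and> is_graph H \<and> graph_iso G H \<longrightarrow> H \<in> P)"

definition induced :: "graph \<Rightarrow> nat set \<Rightarrow> graph" where
  "induced G S = (S, {e \<in> edges G. e \<subseteq> S})"

text \<open>Edit distance from a property; the minimum over the empty set is \<open>\<infinity>\<close>.\<close>
definition graph_edit_dist :: "graph set \<Rightarrow> graph \<Rightarrow> enat" where
  "graph_edit_dist P G =
     (INF H \<in> {H \<in> P. verts H = verts G}. enat (card (edges G - edges H \<union> (edges H - edges G))))"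

definition sample_prob :: "('g \<Rightarrow> nat set) \<Rightarrow> ('g \<Rightarrow> nat set \<Rightarrow> 'g) \<Rightarrow> 'g set \<Rightarrow> 'g \<Rightarrow> nat \<Rightarrow> real" where
  "sample_prob V ind T G r =
     real (card {S. S \<subseteq> V G \<and> card S = r \<and> ind G S \<in> T}) / real (card (V G) choose r)"

definition enat_ge_real :: "enat \<Rightarrow> real \<Rightarrow> bool" where
  "enat_ge_real d x \<longleftrightarrow> (\<forall>n. d = enat n \<longrightarrow> real n \<ge> x)"

definition testable :: "graph set \<Rightarrow> bool" where
  "testable P \<longleftrightarrow> (\<exists>T. graph_property T \<and>
     (\<forall>G\<in>P. \<forall>r. 1 \<le> r \<and> r \<le> card (verts G) \<longrightarrow> sample_prob verts induced T G r \<ge> 2/3) \<and>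
     (\<forall>\<epsilon>::real. \<epsilon> > 0 \<longrightarrow> (\<exists>r\<^sub>\<epsilon>::nat. r\<^sub>\<epsilon> \<ge> 1 \<and>
        (\<forall>G. is_graph G \<and> enat_ge_real (graph_edit_dist P G) (\<epsilon> * real (card (verts G))^2) \<longrightarrow>
           (\<forall>r. r\<^sub>\<epsilon> \<le> r \<and> r \<le> card (verts G) \<longrightarrow> sample_prob verts induced T G r \<le> 1/3)))))"

text \<open>A k-colored complete digraph: node set \<open>V\<close> and colouring \<open>c\<close> of ordered pairs of distinct
nodes by colours in \<open>{1..k}\<close>; \<open>c\<close> is 0 on all other pairs (so it is determined by the digraph).\<close>

type_synonym cdigraph = "nat set \<times> (nat \<times> nat \<Rightarrow> nat)"

definition dverts :: "cdigraph \<Rightarrow> nat set" where "dverts L = fst L"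
definition dcol :: "cdigraph \<Rightarrow> nat \<times> nat \<Rightarrow> nat" where "dcol L = snd L"

definition is_cdigraph :: "nat \<Rightarrow> cdigraph \<Rightarrow> bool" where
  "is_cdigraph k L \<longleftrightarrow> finite (dverts L) \<and>
     (\<forall>u v. (u \<in> dverts L \<and> v \<in> dverts L \<and> u \<noteq> v \<longrightarrow> dcol L (u, v) \<in> {1..k}) \<and>
            (\<not> (u \<in> dverts L \<and> v \<in> dverts L \<and> u \<noteq> v) \<longrightarrow> dcol L (u, v) = 0))"

definition cdigraph_iso :: "cdigraph \<Rightarrow> cdigraph \<Rightarrow> bool" where
  "cdigraph_iso L M \<longleftrightarrow> (\<exists>f. bij_betw f (dverts L) (dverts M) \<and>
     (\<forall>u\<in>dverts L. \<forall>v\<in>dverts L. u \<noteq> v \<longrightarrow> dcol M (f u, f v) = dcol L (u, v)))"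

definition cdigraph_property :: "nat \<Rightarrow> cdigraph set \<Rightarrow> bool" where
  "cdigraph_property k Q \<longleftrightarrow> (\<forall>L\<in>Q. is_cdigraph k L) \<and>
     (\<forall>L M. L \<in> Q \<and> is_cdigraph k M \<and> cdigraph_iso L M \<longrightarrow> M \<in> Q)"

definition dinduced :: "cdigraph \<Rightarrow> nat set \<Rightarrow> cdigraph" where
  "dinduced L S = (S, \<lambda>(u, v). if u \<in> S \<and> v \<in> S \<and> u \<noteq> v then dcol L (u, v) else 0)"

definition cdigraph_edit_dist :: "cdigraph set \<Rightarrow> cdigraph \<Rightarrow> enat" where
  "cdigraph_edit_dist Q L =
     (INF M \<in> {M \<in> Q. dverts M = dverts L}.
        enat (card {(u, v). u \<in> dverts L \<and> v \<in> dverts L \<and> u \<noteq> v \<and> dcol L (u, v) \<noteq> dcol M (u, v)}))"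

definition ctestable :: "nat \<Rightarrow> cdigraph set \<Rightarrow> bool" where
  "ctestable k Q \<longleftrightarrow> (\<exists>T. cdigraph_property k T \<and>
     (\<forall>L\<in>Q. \<forall>r. 1 \<le> r \<and> r \<le> card (dverts L) \<longrightarrow> sample_prob dverts dinduced T L r \<ge> 2/3) \<and>
     (\<forall>\<epsilon>::real. \<epsilon> > 0 \<longrightarrow> (\<exists>r\<^sub>\<epsilon>::nat. r\<^sub>\<epsilon> \<ge> 1 \<and>
        (\<forall>L. is_cdigraph k L \<and> enat_ge_real (cdigraph_edit_dist Q L) (\<epsilon> * real (card (dverts L))^2) \<longrightarrow>
           (\<forall>r. r\<^sub>\<epsilon> \<le> r \<and> r \<le> card (dverts L) \<longrightarrow> sample_prob dverts dinduced T L r \<le> 1/3)))))"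

definition shadow :: "nat \<Rightarrow> cdigraph \<Rightarrow> graph" where
  "shadow m L = (dverts L, {{u, v} | u v. u \<in> dverts L \<and> v \<in> dverts L \<and> u \<noteq> v \<and>
                     (dcol L (u, v) \<in> {1..m} \<or> dcol L (v, u) \<in> {1..m})})"

definition nd_testable :: "graph set \<Rightarrow> bool" where
  "nd_testable P \<longleftrightarrow> (\<exists>k m Q. k \<ge> m \<and> m \<ge> 1 \<and> cdigraph_property k Q \<and> ctestable k Q \<and>
     shadow m ` Q = P)"

end

theory Submission
  imports Defs Complex_Main "HOL-Library.FuncSet"
begin

text \<open>
  Only the passage from a test \<open>T\<close> for \<open>Q\<close> to a test for \<open>P\<close> needs work. A sample \<open>F\<close> of \<open>r\<close> nodes is accepted
  if some colouring of \<open>F\<close> with shadow \<open>F\<close> has at least half of its \<open>q\<close>-node subgraphs in \<open>T\<close>, where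
  \<open>q = q(r)\<close> tends to infinity slowly. Graphs in \<open>P\<close> are accepted because the colouring of the whole
  graph restricts to the sample and the density of \<open>T\<close> concentrates.

  Conversely, a good colouring of a random sample \<open>S\<close> has to be carried over to a colouring of \<open>G\<close>.
  Frieze-Kannan regularity, relative to the adjacency of \<open>S\<close> and its complement, replaces the colouring
  by the rule: colour the pair \<open>u, v\<close> at random, according to its adjacency and to the labels of \<open>u\<close> and \<open>v\<close> among
  boundedly many. A second regularity partition of \<open>G\<close>, far more accurate than the number of labels, has a
  step function \<open>U\<close> with \<open>G - U\<close> small in cut norm. The cut norm is controlled by the density of 4-cycles,
  which concentrates, so \<open>G - U\<close> stays small in cut norm on \<open>S\<close>. Hence adjacency can be replaced by \<open>U\<close> on \<open>S\<close>,
  the labels are transported to \<open>G\<close> in the same proportions within each class, and \<open>U\<close> is replaced by adjacency again.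
  The \<open>T\<close>-density of a random colouring is multi-affine in the distributions of the pairs, so some fixed
  colouring of \<open>G\<close> does at least as well as the average.
\<close>

section \<open>Averages over tuples and random subsets\<close>

text \<open>The colouring of an accepted sample is chosen after the sample is drawn, so nothing
  about it can be expected to concentrate. What concentrates are finitely many quantities of
  \<open>G\<close> alone, fixed before sampling: the 4-cycle density of \<open>G - U\<close>, the
  class frequencies of \<open>U\<close>, and the edge density. Everything specific to the colouring
  is handled by regularity inside \<open>S\<close>. This has to be relative to adjacency, since
  otherwise the averaged colours would forget which of them are allowed on edges, and the shadow
  must survive. Replacing adjacency by \<open>U\<close> costs a factor t^2 for t labels; hence the
  accuracy of \<open>U\<close> is chosen after t, and t after q. The constants come in the order q,
  \<eta>, t, \<rho>, K, with the sample size last. It depends on q in an uncontrolled way, so q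
  becomes a function of r by inverting that dependence. The threshold one half lies between the
  values 2/3 and 1/3 of the given test and leaves 1/6 for errors on either side. If m = k, no colour
  represents a non-edge; then the shadow only approximates \<open>G\<close>, with an error n^2 / q
  that becomes negligible as q grows.\<close>

definition avg :: "'b set \<Rightarrow> ('b \<Rightarrow> real) \<Rightarrow> real" where
  "avg X h = (\<Sum>x\<in>X. h x) / real (card X)"

text \<open>Repetitions are allowed so that averages iterate one coordinate at a time, whereas
  \<open>itup\<close> is what a random subset sees. \<open>avg_tup_itup\<close> is the
  bridge.\<close>

definition tup :: "'a set \<Rightarrow> nat \<Rightarrow> 'a list set" where
  "tup V q = {xs. set xs \<subseteq> V \<and> length xs = q}"

definition itup :: "'a set \<Rightarrow> nat \<Rightarrow> 'a list set" where
  "itup V q = {xs \<in> tup V q. distinct xs}"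

definition subs :: "'a set \<Rightarrow> nat \<Rightarrow> 'a set set" where
  "subs V r = {S. S \<subseteq> V \<and> card S = r}"

lemma finite_tup [simp]: "finite V \<Longrightarrow> finite (tup V q)"
  unfolding tup_def by (rule finite_lists_length_eq)

lemma card_tup: "finite V \<Longrightarrow> card (tup V q) = card V ^ q"
  unfolding tup_def by (rule card_lists_length_eq)

lemma finite_itup [simp]: "finite V \<Longrightarrow> finite (itup V q)"
  by (simp add: itup_def)

lemma itup_subset_tup: "itup V q \<subseteq> tup V q"
  by (auto simp: itup_def)

lemma finite_subs [simp]: "finite V \<Longrightarrow> finite (subs V r)"
  by (auto simp: subs_def)

lemma card_subs: "finite V \<Longrightarrow> card (subs V r) = card V choose r"
  by (simp add: subs_def n_subsets)

lemma avg_const: "finite X \<Longrightarrow> X \<noteq> {} \<Longrightarrow> avg X (\<lambda>_. c) = c"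
  by (simp add: avg_def)

lemma avg_cong: "(\<And>x. x \<in> X \<Longrightarrow> f x = g x) \<Longrightarrow> avg X f = avg X g"
  unfolding avg_def by (simp cong: sum.cong)

lemma avg_mono: "(\<And>x. x \<in> X \<Longrightarrow> f x \<le> g x) \<Longrightarrow> avg X f \<le> avg X g"
  unfolding avg_def by (intro divide_right_mono sum_mono) auto

lemma avg_add: "avg X (\<lambda>x. f x + g x) = avg X f + avg X g"
  by (simp add: avg_def sum.distrib add_divide_distrib)

lemma avg_diff: "avg X (\<lambda>x. f x - g x) = avg X f - avg X g"
  by (simp add: avg_def sum_subtractf diff_divide_distrib)

lemma avg_cmult: "avg X (\<lambda>x. c * f x) = c * avg X f"
  by (simp add: avg_def sum_distrib_left)

lemma avg_abs_le: 
  assumes "\<And>x. x \<in> X \<Longrightarrow> \<bar>f x\<bar> \<le> c" "c \<ge> 0"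
  shows "\<bar>avg X f\<bar> \<le> c"
proof -
  have "\<bar>\<Sum>x\<in>X. f x\<bar> \<le> real (card X) * c"
    by (rule order.trans[OF sum_abs sum_bounded_above]) (rule assms(1))
  then have "\<bar>\<Sum>x\<in>X. f x\<bar> / real (card X) \<le> c"
    using assms(2) by (cases "card X = 0") (simp_all add: pos_divide_le_eq mult.commute)
  then show ?thesis by (simp add: avg_def)
qed

lemma avg_nonneg: "(\<And>x. x \<in> X \<Longrightarrow> 0 \<le> f x) \<Longrightarrow> 0 \<le> avg X f"
  unfolding avg_def by (simp add: sum_nonneg)

text \<open>The difference equals the sum of h - avg A h over B - A, divided by
  \<open>card B\<close>, and each summand is at most 2 in modulus.\<close>

lemma avg_subset_diff:
  assumes fin: "finite B" and sub: "A \<subseteq> B" and h: "\<And>x. x \<in> B \<Longrightarrow> \<bar>h x\<bar> \<le> 1"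
  shows "\<bar>avg B h - avg A h\<bar> \<le> 2 * real (card (B - A)) / real (card B)"
proof (cases "B = {}")
  case True
  then show ?thesis using sub by (simp add: avg_def)
next
  case False
  then have B: "real (card B) > 0" using fin by (simp add: card_gt_0_iff)
  have fA: "finite A" using fin sub finite_subset by blast
  have cB: "real (card B) = card A + card (B - A)"
    using fin fA sub by (simp add: card_Diff_subset card_mono)
  have sB: "(\<Sum>x\<in>B. h x) = (\<Sum>x\<in>A. h x) + (\<Sum>x\<in>B - A. h x)"
    using sum.subset_diff[OF sub fin, of h] by simp
  have sA: "(\<Sum>x\<in>A. h x) = card A * avg A h"
    using fA by (cases "A = {}") (auto simp: avg_def)
  have a1: "\<bar>avg A h\<bar> \<le> 1" using h sub by (intro avg_abs_le) auto
  have d1: "\<bar>\<Sum>x\<in>B - A. h x\<bar> \<le> card (B - A)"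
    using order.trans[OF sum_abs sum_bounded_above[of "B-A" "\<lambda>x. \<bar>h x\<bar>" 1]] h by simp
  have eq: "avg B h - avg A h = ((\<Sum>x\<in>B - A. h x) - card (B - A) * avg A h) / card B"
  proof -
    have "avg B h - avg A h = (card A * avg A h + (\<Sum>x\<in>B - A. h x) - card B * avg A h) / card B"
      using B unfolding avg_def[of B] sB sA by (simp add: diff_divide_distrib)
    also have "card A * avg A h + (\<Sum>x\<in>B - A. h x) - card B * avg A h = (\<Sum>x\<in>B - A. h x) - card (B - A) * avg A h"
      unfolding cB by (simp add: distrib_right)
    finally show ?thesis .
  qed
  have "\<bar>card (B - A) * avg A h\<bar> \<le> card (B - A)"
    using a1 by (simp add: abs_mult mult_left_le)
  then have "\<bar>(\<Sum>x\<in>B - A. h x) - card (B - A) * avg A h\<bar> \<le> 2 * card (B - A)"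
    using d1 by linarith
  then have "\<bar>(\<Sum>x\<in>B - A. h x) - card (B - A) * avg A h\<bar> / real (card B) \<le> real (2 * card (B - A)) / real (card B)"
    by (rule divide_right_mono) simp
  then show ?thesis unfolding eq abs_divide by simp
qed

section \<open>Tuples with and without repetition\<close>

lemma tup_0: "tup V 0 = {[]}" by (auto simp: tup_def)

lemma tup_Suc: "tup V (Suc q) = (\<lambda>(x, xs). x # xs) ` (V \<times> tup V q)"
  by (auto simp: tup_def length_Suc_conv image_iff)

lemma sum_tup_Suc: "(\<Sum>xs\<in>tup V (Suc q). h xs) = (\<Sum>x\<in>V. \<Sum>xs\<in>tup V q. h (x # xs))"
proof -
  have "inj_on (\<lambda>(x, xs). x # xs) (V \<times> tup V q)" by (auto simp: inj_on_def)
  then show ?thesis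
    unfolding tup_Suc by (simp add: sum.reindex sum.cartesian_product case_prod_unfold)
qed

lemma avg_tup_Suc: 
  "avg (tup V (Suc q)) h = avg V (\<lambda>x. avg (tup V q) (\<lambda>xs. h (x # xs)))" if "finite V"
  using that unfolding avg_def sum_tup_Suc
  by (simp add: card_tup sum_divide_distrib mult.commute)

lemma sum_tup_add: 
  "(\<Sum>zs\<in>tup V (p + q). h zs) = (\<Sum>xs\<in>tup V p. \<Sum>ys\<in>tup V q. h (xs @ ys))"
  by (induction p arbitrary: h) (simp_all add: tup_0 sum_tup_Suc)

text \<open>A tuple with a repetition has a repetition in its tail or a head equal to one of the q
  tail entries. Multiplying by \<open>card V\<close> avoids the exponent q - 1.\<close>

lemma card_noninj:
  assumes "finite V"
  shows "card (tup V q - itup V q) * card V \<le> q\<^sup>2 * card V ^ q"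
proof (induction q)
  case 0
  have "tup V 0 - itup V 0 = {}" by (auto simp: tup_0 itup_def)
  then have "card (tup V 0 - itup V 0) = 0" by (metis card.empty)
  then show ?case by simp
next
  case (Suc q)
  let ?N = "tup V q - itup V q"
  have sub: "tup V (Suc q) - itup V (Suc q) \<subseteq>
     (\<lambda>(x, xs). x # xs) ` (V \<times> ?N) \<union> (\<lambda>(xs, i). (xs ! i) # xs) ` (tup V q \<times> {..<q})"
  proof
    fix zs assume "zs \<in> tup V (Suc q) - itup V (Suc q)"
    then obtain x xs where *: "zs = x # xs" "x \<in> V" "xs \<in> tup V q" "\<not> distinct (x # xs)"
      by (auto simp: tup_Suc itup_def)
    show "zs \<in> (\<lambda>(x, xs). x # xs) ` (V \<times> ?N) \<union> (\<lambda>(xs, i). (xs ! i) # xs) ` (tup V q \<times> {..<q})"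
    proof (cases "distinct xs")
      case False
      then show ?thesis using * by (auto simp: itup_def)
    next
      case True
      then obtain i where "i < q" "x = xs ! i" using * by (auto simp: in_set_conv_nth tup_def)
      then have "zs = (\<lambda>(xs, i). (xs ! i) # xs) (xs, i)" "(xs, i) \<in> tup V q \<times> {..<q}"
        using * by auto
      then show ?thesis by blast
    qed
  qed
  have "card (tup V (Suc q) - itup V (Suc q)) \<le> card (V \<times> ?N) + card (tup V q \<times> {..<q})"
    using assms by (intro order.trans[OF card_mono[OF _ sub]] order.trans[OF card_Un_le] add_mono card_image_le) auto
  also have "\<dots> = card V * card ?N + card V ^ q * q"
    using assms by (simp add: card_cartesian_product card_tup)
  finally have "card (tup V (Suc q) - itup V (Suc q)) * card V \<le> (card V * card ?N + card V ^ q * q) * card V"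
    by (rule mult_le_mono1)
  also have "\<dots> = (card ?N * card V) * card V + q * card V ^ Suc q"
    by (simp add: algebra_simps)
  also have "\<dots> \<le> q\<^sup>2 * card V ^ q * card V + q * card V ^ Suc q"
    using Suc.IH by (intro add_mono mult_le_mono1) auto
  also have "\<dots> \<le> (Suc q)\<^sup>2 * card V ^ Suc q"
    by (simp add: power2_eq_square algebra_simps)
  finally show ?case .
qed

lemma avg_tup_itup:
  assumes "finite V" "\<And>xs. xs \<in> tup V q \<Longrightarrow> \<bar>h xs\<bar> \<le> 1"
  shows "\<bar>avg (tup V q) h - avg (itup V q) h\<bar> \<le> 2 * real (q\<^sup>2) / real (card V)"
proof (cases "card V = 0")
  case True
  show ?thesis
  proof (cases q)
    case 0
    have "itup V 0 = tup V 0" by (auto simp: tup_0 itup_def)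
    then show ?thesis using 0 by simp
  next
    case (Suc q')
    have "V = {}" using True assms(1) by simp
    then have "tup V q = {}" "itup V q = {}" using Suc by (auto simp: itup_def tup_Suc)
    then show ?thesis by simp
  qed
next
  case False
  have "\<bar>avg (tup V q) h - avg (itup V q) h\<bar> \<le> 2 * real (card (tup V q - itup V q)) / real (card (tup V q))"
    using assms by (intro avg_subset_diff itup_subset_tup) auto
  also have "\<dots> \<le> 2 * real (q\<^sup>2) / real (card V)"
  proof -
    have "real (card (tup V q - itup V q)) * real (card V) \<le> real (q\<^sup>2) * real (card V ^ q)"
      using card_noninj[OF assms(1), of q] by (metis of_nat_le_iff of_nat_mult)
    then show ?thesis using False assms(1) by (simp add: card_tup divide_simps)
  qed
  finally show ?thesis .
qed

text \<open>The number of injective tuples is a falling factorial in \<open>card V\<close>, so all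
  r-subsets carry equally many of them.\<close>

lemma card_itup_cong: 
  assumes "finite V" 
  shows "card (itup V q) = (\<Prod>i<q. card V - i)"
proof (induction q)
  case 0
  have "itup V 0 = {[]}" by (auto simp: itup_def tup_0)
  then show ?case by simp
next
  case (Suc q)
  have eq: "itup V (Suc q) = (\<lambda>(xs, x). x # xs) ` (SIGMA xs:itup V q. V - set xs)"
    by (auto simp: itup_def tup_Suc image_iff)
  have "inj_on (\<lambda>(xs, x). x # xs) (SIGMA xs:itup V q. V - set xs)" by (auto simp: inj_on_def)
  then have "card (itup V (Suc q)) = card (SIGMA xs:itup V q. V - set xs)"
    unfolding eq by (rule card_image)
  also have "\<dots> = (\<Sum>xs\<in>itup V q. card (V - set xs))" using assms by simp
  also have "\<dots> = (\<Sum>xs\<in>itup V q. card V - q)"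
    using assms by (intro sum.cong refl) (auto simp: itup_def tup_def card_Diff_subset distinct_card)
  finally show ?case using Suc.IH by simp
qed

lemma card_itup_pos: "finite V \<Longrightarrow> q \<le> card V \<Longrightarrow> card (itup V q) > 0"
  unfolding card_itup_cong by (intro prod_pos) auto

lemma card_supersets:
  assumes "finite V" "X \<subseteq> V" "card X \<le> r"
  shows "card {S \<in> subs V r. X \<subseteq> S} = (card V - card X) choose (r - card X)"
proof -
  have fX: "finite X" using assms finite_subset by blast
  have "bij_betw (\<lambda>S. S - X) {S \<in> subs V r. X \<subseteq> S} (subs (V - X) (r - card X))"
    using assms fX
    by (intro bij_betw_byWitness[where f' = "\<lambda>S. S \<union> X"])
       (auto simp: subs_def card_Diff_subset intro!: card_Un_disjoint[THEN trans] dest: finite_subset)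
  then have "card {S \<in> subs V r. X \<subseteq> S} = card (subs (V - X) (r - card X))"
    by (rule bij_betw_same_card)
  then show ?thesis using assms fX by (simp add: card_subs card_Diff_subset)
qed

text \<open>Double counting: every injective q-tuple lies in the same number \<open>D\<close> of
  r-subsets, and every r-subset contains the same number \<open>c\<close> of such tuples. Sampling
  is thus exact in expectation, and errors come from repetitions only.\<close>

lemma avg_subs_itup:
  fixes h :: "'a list \<Rightarrow> real"
  assumes fin: "finite V" and qr: "q \<le> r" "r \<le> card V"
  shows "avg (subs V r) (\<lambda>S. avg (itup S q) h) = avg (itup V q) h"
proof -
  define c where "c = real (\<Prod>i<q. r - i)"
  define D where "D = real ((card V - q) choose (r - q))"
  define N where "N = real (card (subs V r))"
  have c: "real (card (itup S q)) = c" if "S \<in> subs V r" for S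
  proof -
    have "finite S" "card S = r" using that fin finite_subset by (auto simp: subs_def)
    then show ?thesis by (simp add: card_itup_cong c_def)
  qed
  have "(\<Prod>i<q. r - i) > 0" using qr by (intro prod_pos) auto
  then have c0: "c > 0" unfolding c_def by linarith
  have N0: "N > 0" using fin qr by (simp add: N_def card_subs)
  have double: "(\<Sum>S\<in>subs V r. \<Sum>xs\<in>itup S q. h xs) = D * (\<Sum>xs\<in>itup V q. h xs)" for h :: "'a list \<Rightarrow> real"
  proof -
    have "(\<Sum>S\<in>subs V r. \<Sum>xs\<in>itup S q. h xs) = (\<Sum>S\<in>subs V r. \<Sum>xs\<in>itup V q. if set xs \<subseteq> S then h xs else 0)"
    proof (rule sum.cong[OF refl])
      fix S assume S: "S \<in> subs V r"
      have "itup S q = {xs \<in> itup V q. set xs \<subseteq> S}" using S by (auto simp: itup_def tup_def subs_def)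
      then show "(\<Sum>xs\<in>itup S q. h xs) = (\<Sum>xs\<in>itup V q. if set xs \<subseteq> S then h xs else 0)"
        using fin by (simp only: sum.inter_filter finite_itup)
    qed
    also have "\<dots> = (\<Sum>xs\<in>itup V q. \<Sum>S\<in>subs V r. if set xs \<subseteq> S then h xs else 0)"
      by (rule sum.swap)
    also have "\<dots> = (\<Sum>xs\<in>itup V q. D * h xs)"
    proof (rule sum.cong[OF refl])
      fix xs assume xs: "xs \<in> itup V q"
      then have q: "card (set xs) = q" "set xs \<subseteq> V" by (auto simp: itup_def tup_def distinct_card)
      have "(\<Sum>S\<in>subs V r. if set xs \<subseteq> S then h xs else 0) = card {S\<in>subs V r. set xs \<subseteq> S} * h xs"
        using fin by (simp add: sum.inter_filter[symmetric])
      then show "(\<Sum>S\<in>subs V r. if set xs \<subseteq> S then h xs else 0) = D * h xs"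
        using card_supersets[OF fin q(2), of r] q qr by (simp add: D_def)
    qed
    finally show ?thesis by (simp add: sum_distrib_left)
  qed
  have main: "avg (subs V r) (\<lambda>S. avg (itup S q) h) = D / (N * c) * (\<Sum>xs\<in>itup V q. h xs)" for h :: "'a list \<Rightarrow> real"
  proof -
    have "avg (subs V r) (\<lambda>S. avg (itup S q) h) = (\<Sum>S\<in>subs V r. (\<Sum>xs\<in>itup S q. h xs) / c) / N"
      unfolding avg_def N_def by (simp add: c)
    also have "\<dots> = (\<Sum>S\<in>subs V r. \<Sum>xs\<in>itup S q. h xs) / c / N" by (simp add: sum_divide_distrib)
    finally show ?thesis unfolding double by simp
  qed
  \<comment> \<open>The normalising factor is found from h = 1, where both averages are known,
    instead of from a binomial identity.\<close>
  have "avg (subs V r) (\<lambda>S. avg (itup S q) (\<lambda>_. 1)) = avg (subs V r) (\<lambda>S. 1)"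
    using c c0 by (intro avg_cong) (simp add: avg_def)
  also have "\<dots> = 1"
  proof -
    have "subs V r \<noteq> {}" using N0 by (auto simp: N_def)
    then show ?thesis using fin by (intro avg_const) auto
  qed
  finally have one: "D / (N * c) * real (card (itup V q)) = 1" unfolding main by (simp only: sum_constant mult_1_right)
  then have nz: "real (card (itup V q)) \<noteq> 0" by (intro notI) simp
  have "D / (N * c) = 1 / card (itup V q)"
    using one unfolding nonzero_eq_divide_eq[OF nz] .
  then show ?thesis unfolding main by (simp add: avg_def)
qed

section \<open>Second moments and concentration of sampled densities\<close>

lemma avg_tup_square:
  assumes "finite V"
  shows "(avg (tup V q) h)\<^sup>2 = avg (tup V (q + q)) (\<lambda>zs. h (take q zs) * h (drop q zs))"
proof -
  have "(\<Sum>zs\<in>tup V (q + q). h (take q zs) * h (drop q zs)) = (\<Sum>xs\<in>tup V q. \<Sum>ys\<in>tup V q. h xs * h ys)"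
    unfolding sum_tup_add by (intro sum.cong refl) (auto simp: tup_def)
  also have "\<dots> = (\<Sum>xs\<in>tup V q. h xs)\<^sup>2" by (simp add: power2_eq_square sum_product)
  finally show ?thesis
    using assms by (simp add: avg_def card_tup power_divide power_add power2_eq_square)
qed

text \<open>Expanding the square leaves two sampled densities, one of length 2q (by
  \<open>avg_tup_square\<close>) and one of length q, so the second moment follows from first
  moments.\<close>

lemma avg_square_deviation:
  assumes fin: "finite V" and r: "q + q \<le> r" "r \<le> card V" and r0: "r > 0"
    and h: "\<And>xs. xs \<in> tup V q \<Longrightarrow> \<bar>h xs\<bar> \<le> 1"
  shows "avg (subs V r) (\<lambda>S. (avg (tup S q) h - avg (tup V q) h)\<^sup>2) \<le> 24 * real (q\<^sup>2) / real r"
proof -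
  define \<nu> where "\<nu> = avg (tup V q) h"
  define hh where "hh = (\<lambda>zs. h (take q zs) * h (drop q zs))"
  have ne: "subs V r \<noteq> {}" using r fin card_subs[of V r] by (metis card.empty binomial_eq_0_iff not_less)
  have \<nu>: "\<bar>\<nu>\<bar> \<le> 1" unfolding \<nu>_def using h by (intro avg_abs_le) auto
  have hh: "\<bar>hh zs\<bar> \<le> 1" if "zs \<in> tup V (q + q)" for zs
  proof -
    have "take q zs \<in> tup V q" "drop q zs \<in> tup V q" using that
      by (auto simp: tup_def dest: in_set_takeD in_set_dropD)
    then show ?thesis using h unfolding hh_def abs_mult by (metis abs_ge_zero mult_le_one)
  qed
  \<comment> \<open>Repetitions are paid for twice, in \<open>S\<close> and in \<open>V\<close>,
    each time with at most 2 p^2 / r.\<close>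
  have samp: "\<bar>avg (subs V r) (\<lambda>S. avg (tup S p) f) - avg (tup V p) f\<bar> \<le> 4 * real (p\<^sup>2) / real r"
    if p: "p \<le> r" and f: "\<And>xs. xs \<in> tup V p \<Longrightarrow> \<bar>f xs\<bar> \<le> 1" for p and f :: "'a list \<Rightarrow> real"
  proof -
    have "\<bar>avg (subs V r) (\<lambda>S. avg (tup S p) f) - avg (itup V p) f\<bar> 
        = \<bar>avg (subs V r) (\<lambda>S. avg (tup S p) f - avg (itup S p) f)\<bar>"
      unfolding avg_diff using avg_subs_itup[OF fin p r(2), of f] by simp
    also have "\<dots> \<le> 2 * real (p\<^sup>2) / real r"
    proof (rule avg_abs_le)
      fix S assume S: "S \<in> subs V r"
      then have "finite S" "card S = r" "tup S p \<subseteq> tup V p" using fin finite_subset by (auto simp: subs_def tup_def)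
      then show "\<bar>avg (tup S p) f - avg (itup S p) f\<bar> \<le> 2 * real (p\<^sup>2) / real r"
        using avg_tup_itup[of S p f] f by blast
    qed simp
    moreover have "\<bar>avg (tup V p) f - avg (itup V p) f\<bar> \<le> 2 * real (p\<^sup>2) / real (card V)"
      using avg_tup_itup[OF fin, of p f] f by blast
    moreover have "2 * real (p\<^sup>2) / real (card V) \<le> 2 * real (p\<^sup>2) / real r"
      using r r0 by (intro divide_left_mono) auto
    ultimately show ?thesis by linarith
  qed
  have "avg (subs V r) (\<lambda>S. (avg (tup S q) h - \<nu>)\<^sup>2) 
     = avg (subs V r) (\<lambda>S. (avg (tup S (q+q)) hh + (- 2 * \<nu>) * avg (tup S q) h) + \<nu>\<^sup>2)"
  proof (rule avg_cong)
    fix S assume "S \<in> subs V r"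
    then have "finite S" using fin finite_subset by (auto simp: subs_def)
    from avg_tup_square[OF this, of q h] show "(avg (tup S q) h - \<nu>)\<^sup>2 = 
      (avg (tup S (q+q)) hh + (- 2 * \<nu>) * avg (tup S q) h) + \<nu>\<^sup>2"
      by (simp add: hh_def power2_diff)
  qed
  also have "\<dots> = avg (subs V r) (\<lambda>S. avg (tup S (q+q)) hh) + (- 2 * \<nu>) * avg (subs V r) (\<lambda>S. avg (tup S q) h) + \<nu>\<^sup>2"
    unfolding avg_add avg_cmult using ne fin by (simp add: avg_const)
  \<comment> \<open>\<open>samp\<close> gives 4 (2q)^2 / r = 16 q^2 / r at length 2q and 4 q^2 / r
    at length q, the latter doubled by the factor -2\<nu>. The copies of \<nu>^2 cancel.\<close>
  also have "\<dots> \<le> (\<nu>\<^sup>2 + 16 * real (q\<^sup>2) / real r) + (- 2 * \<nu>\<^sup>2 + 8 * real (q\<^sup>2) / real r) + \<nu>\<^sup>2"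
  proof (intro add_mono order_refl)
    have "avg (tup V (q+q)) hh = \<nu>\<^sup>2" using avg_tup_square[OF fin, of q h] by (simp add: \<nu>_def hh_def)
    then show "avg (subs V r) (\<lambda>S. avg (tup S (q+q)) hh) \<le> \<nu>\<^sup>2 + 16 * real (q\<^sup>2) / real r"
      using samp[OF r(1), of hh] hh by (simp add: abs_le_iff power2_eq_square algebra_simps)
    define y where "y = avg (subs V r) (\<lambda>S. avg (tup S q) h) - \<nu>"
    have "\<bar>y\<bar> \<le> 4 * real (q\<^sup>2) / real r"
      using samp[of q h] h r(1) by (simp add: \<nu>_def y_def)
    then have "\<bar>\<nu>\<bar> * \<bar>y\<bar> \<le> 1 * (4 * real (q\<^sup>2) / real r)" using \<nu> by (intro mult_mono) auto
    then have "\<bar>\<nu> * y\<bar> \<le> 4 * real (q\<^sup>2) / real r" by (simp add: abs_mult)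
    then have "- 2 * (\<nu> * y) \<le> 2 * (4 * real (q\<^sup>2) / real r)" by linarith
    then show "(- 2 * \<nu>) * avg (subs V r) (\<lambda>S. avg (tup S q) h) \<le> - 2 * \<nu>\<^sup>2 + 8 * real (q\<^sup>2) / real r"
      by (simp add: y_def power2_eq_square algebra_simps)
  qed
  also have "\<dots> = 16 * real (q\<^sup>2) / real r + 8 * real (q\<^sup>2) / real r" by linarith
  also have "\<dots> = 24 * real (q\<^sup>2) / real r" unfolding add_divide_distrib[symmetric] by simp
  finally show ?thesis unfolding \<nu>_def .
qed

text \<open>Chebyshev's inequality for the deviation bounded in
  \<open>avg_square_deviation\<close>.\<close>

lemma sample_concentration:
  assumes fin: "finite V" and r: "q + q \<le> r" "r \<le> card V" and r0: "r > 0" and \<eta>: "\<eta> > 0"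
    and h: "\<And>xs. xs \<in> tup V q \<Longrightarrow> \<bar>h xs\<bar> \<le> 1"
  shows "real (card {S \<in> subs V r. \<bar>avg (tup S q) h - avg (tup V q) h\<bar> \<ge> \<eta>})
     \<le> 24 * real (q\<^sup>2) / (real r * \<eta>\<^sup>2) * real (card V choose r)"
proof -
  let ?Y = "\<lambda>S. avg (tup S q) h - avg (tup V q) h"
  let ?B = "{S \<in> subs V r. \<bar>?Y S\<bar> \<ge> \<eta>}"
  have "real (card ?B) * \<eta>\<^sup>2 \<le> (\<Sum>S\<in>?B. (?Y S)\<^sup>2)"
  proof (rule sum_bounded_below)
    fix S assume "S \<in> ?B"
    then have "\<eta>\<^sup>2 \<le> \<bar>?Y S\<bar>\<^sup>2" using \<eta> by (intro power_mono) auto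
    then show "\<eta>\<^sup>2 \<le> (?Y S)\<^sup>2" by simp
  qed
  also have "\<dots> \<le> (\<Sum>S\<in>subs V r. (?Y S)\<^sup>2)" using fin by (intro sum_mono2) auto
  also have "\<dots> = real (card V choose r) * avg (subs V r) (\<lambda>S. (?Y S)\<^sup>2)"
  proof -
    have "card V choose r > 0" using r(2) by simp
    then show ?thesis unfolding avg_def card_subs[OF fin] by simp
  qed
  also have "\<dots> \<le> real (card V choose r) * (24 * real (q\<^sup>2) / real r)"
    using avg_square_deviation[OF fin r r0 h] by (intro mult_left_mono) auto
  finally have le: "real (card ?B) * \<eta>\<^sup>2 \<le> real (card V choose r) * (24 * real (q\<^sup>2) / real r)" .
  have "\<eta>\<^sup>2 > 0" using \<eta> by simp
  from le[unfolded pos_le_divide_eq[OF this, symmetric]] show ?thesis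
    by (simp only: times_divide_eq_left times_divide_eq_right divide_divide_eq_left mult_ac)
qed

section \<open>Weak regularity relative to a weight\<close>

lemma sum_swap_pairs:
  "(\<Sum>u\<in>A. \<Sum>v\<in>B. \<Sum>i\<in>I. \<Sum>j\<in>J. h u v i j) = (\<Sum>i\<in>I. \<Sum>j\<in>J. \<Sum>u\<in>A. \<Sum>v\<in>B. h u v i j)"
proof -
  have "(\<Sum>x\<in>A \<times> B. \<Sum>y\<in>I \<times> J. h (fst x) (snd x) (fst y) (snd y)) = (\<Sum>y\<in>I \<times> J. \<Sum>x\<in>A \<times> B. h (fst x) (snd x) (fst y) (snd y))"
    by (rule sum.swap)
  then show ?thesis by (simp only: sum.cartesian_product' fst_conv snd_conv)
qed

text \<open>Conditional expectation of \<open>g\<close> on the block (i, j) under the weight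
  \<open>w\<close>. On a block of weight 0 it is 0 by the convention for division, so the block
  averages of functions that sum to 1 add up to 0 there.\<close>

definition blk_avg :: "'a set \<Rightarrow> ('a \<Rightarrow> nat) \<Rightarrow> ('a \<Rightarrow> 'a \<Rightarrow> real) \<Rightarrow> ('a \<Rightarrow> 'a \<Rightarrow> real) \<Rightarrow> nat \<Rightarrow> nat \<Rightarrow> real" where
  "blk_avg V l w g i j =
     (\<Sum>u\<in>V. \<Sum>v\<in>V. if l u = i \<and> l v = j then w u v * g u v else 0) /
     (\<Sum>u\<in>V. \<Sum>v\<in>V. if l u = i \<and> l v = j then w u v else 0)"

lemma blk_avg_nonneg:
  assumes "\<And>u v. u \<in> V \<Longrightarrow> v \<in> V \<Longrightarrow> 0 \<le> w u v" "\<And>u v. u \<in> V \<Longrightarrow> v \<in> V \<Longrightarrow> 0 \<le> g u v"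
  shows "0 \<le> blk_avg V l w g i j"
  unfolding blk_avg_def using assms by (intro divide_nonneg_nonneg sum_nonneg) auto

lemma blk_avg_sum_le_1:
  assumes "\<And>u v. u \<in> V \<Longrightarrow> v \<in> V \<Longrightarrow> 0 \<le> w u v"
    and "\<And>u v. u \<in> V \<Longrightarrow> v \<in> V \<Longrightarrow> (\<Sum>c\<in>I. g c u v) \<le> 1"
  shows "(\<Sum>c\<in>I. blk_avg V l w (g c) i j) \<le> 1"
proof -
  let ?D = "\<Sum>u\<in>V. \<Sum>v\<in>V. if l u = i \<and> l v = j then w u v else 0"
  have D: "?D \<ge> 0" using assms by (intro sum_nonneg) auto
  have "(\<Sum>c\<in>I. \<Sum>u\<in>V. \<Sum>v\<in>V. if l u = i \<and> l v = j then w u v * g c u v else 0)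
      = (\<Sum>u\<in>V. \<Sum>c\<in>I. \<Sum>v\<in>V. if l u = i \<and> l v = j then w u v * g c u v else 0)" by (rule sum.swap)
  also have "\<dots> = (\<Sum>u\<in>V. \<Sum>v\<in>V. \<Sum>c\<in>I. if l u = i \<and> l v = j then w u v * g c u v else 0)"
    by (intro sum.cong refl sum.swap)
  also have "\<dots> = (\<Sum>u\<in>V. \<Sum>v\<in>V. if l u = i \<and> l v = j then w u v * (\<Sum>c\<in>I. g c u v) else 0)"
    by (intro sum.cong refl) (auto simp: sum_distrib_left)
  also have "\<dots> \<le> ?D"
    using assms by (intro sum_mono) (auto simp: mult_left_le)
  finally show ?thesis using D unfolding blk_avg_def sum_divide_distrib[symmetric]
    by (auto simp: divide_le_eq_1)
qed

lemma blk_avg_le_1: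
  assumes "\<And>u v. u \<in> V \<Longrightarrow> v \<in> V \<Longrightarrow> 0 \<le> w u v" "\<And>u v. u \<in> V \<Longrightarrow> v \<in> V \<Longrightarrow> g u v \<le> 1"
  shows "blk_avg V l w g i j \<le> 1"
  using blk_avg_sum_le_1[where V = V and w = w and I = "{()}" and g = "\<lambda>_. g"] assms by simp

lemma blk_avg_swap:
  assumes "\<And>u v. u \<in> V \<Longrightarrow> v \<in> V \<Longrightarrow> w' v u = w u v" "\<And>u v. u \<in> V \<Longrightarrow> v \<in> V \<Longrightarrow> g' v u = g u v"
  shows "blk_avg V l w' g' j i = blk_avg V l w g i j"
proof -
  have *: "(\<Sum>u\<in>V. \<Sum>v\<in>V. if l u = j \<and> l v = i then F' u v else 0) = (\<Sum>u\<in>V. \<Sum>v\<in>V. if l u = i \<and> l v = j then F u v else 0)"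
    if "\<And>u v. u \<in> V \<Longrightarrow> v \<in> V \<Longrightarrow> F' v u = F u v" for F F' :: "'a \<Rightarrow> 'a \<Rightarrow> real"
    by (subst sum.swap, intro sum.cong refl) (auto simp: that)
  show ?thesis unfolding blk_avg_def
    by (intro arg_cong2[where f = "(/)"] *) (use assms in auto)
qed

text \<open>Orthogonality of conditional expectation: on each block the weighted deviations from the
  weighted mean cancel.\<close>

lemma blk_avg_orthogonal:
  fixes V :: "'a set"
  assumes fin: "finite V" and w: "\<And>u v. u \<in> V \<Longrightarrow> v \<in> V \<Longrightarrow> 0 \<le> w u v"
  shows "(\<Sum>u\<in>V. \<Sum>v\<in>V. w u v * (g u v - blk_avg V l w g (l u) (l v)) * R (l u) (l v)) = 0"
proof -
  let ?P = "blk_avg V l w g"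
  let ?in = "\<lambda>i j u v. l u = i \<and> l v = j"
  have block: "(\<Sum>u\<in>V. \<Sum>v\<in>V. if ?in i j u v then w u v * (g u v - ?P i j) else 0) = 0" for i j
  proof -
    let ?N = "\<Sum>u\<in>V. \<Sum>v\<in>V. if ?in i j u v then w u v * g u v else 0"
    let ?D = "\<Sum>u\<in>V. \<Sum>v\<in>V. if ?in i j u v then w u v else 0"
    have "(\<Sum>u\<in>V. \<Sum>v\<in>V. if ?in i j u v then w u v * (g u v - ?P i j) else 0)
        = (\<Sum>u\<in>V. \<Sum>v\<in>V. (if ?in i j u v then w u v * g u v else 0) - ?P i j * (if ?in i j u v then w u v else 0))"
      by (intro sum.cong refl) (auto simp: algebra_simps)
    also have "\<dots> = ?N - ?P i j * ?D" by (simp add: sum_subtractf sum_distrib_left)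
    also have "\<dots> = 0"
    proof (cases "?D = 0")
      \<comment> \<open>With total weight 0 every weight of the block is 0, because weights are
        nonnegative, and so the numerator vanishes too.\<close>
      case True
      have "(if ?in i j u v then w u v else 0) = 0" if "u \<in> V" "v \<in> V" for u v
      proof -
        have "(\<Sum>v\<in>V. if ?in i j u v then w u v else 0) = 0"
          using True that fin w by (subst (asm) sum_nonneg_eq_0_iff) (auto intro!: sum_nonneg)
        then show ?thesis using that fin w by (subst (asm) sum_nonneg_eq_0_iff) auto
      qed
      then have "?N = 0" by (intro sum.neutral ballI) (metis mult_zero_left)
      then show ?thesis using True by simp
    qed (simp add: blk_avg_def)
    finally show ?thesis .
  qed
  let ?I = "l ` V"
  have "(\<Sum>u\<in>V. \<Sum>v\<in>V. w u v * (g u v - ?P (l u) (l v)) * R (l u) (l v))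
     = (\<Sum>u\<in>V. \<Sum>v\<in>V. \<Sum>i\<in>?I. \<Sum>j\<in>?I. R i j * (if ?in i j u v then w u v * (g u v - ?P i j) else 0))"
  proof (intro sum.cong refl)
    fix u v assume uv: "u \<in> V" "v \<in> V"
    have "(\<Sum>i\<in>?I. \<Sum>j\<in>?I. R i j * (if ?in i j u v then w u v * (g u v - ?P i j) else 0))
       = (\<Sum>i\<in>?I. if l u = i then (\<Sum>j\<in>?I. if l v = j then R i j * (w u v * (g u v - ?P i j)) else 0) else 0)"
      by (intro sum.cong refl) (auto intro!: sum.neutral sum.cong)
    also have "\<dots> = R (l u) (l v) * (w u v * (g u v - ?P (l u) (l v)))"
      using uv fin by simp
    finally show "w u v * (g u v - ?P (l u) (l v)) * R (l u) (l v) = 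
      (\<Sum>i\<in>?I. \<Sum>j\<in>?I. R i j * (if ?in i j u v then w u v * (g u v - ?P i j) else 0))" by simp
  qed
  also have "\<dots> = (\<Sum>i\<in>?I. \<Sum>j\<in>?I. \<Sum>u\<in>V. \<Sum>v\<in>V. R i j * (if ?in i j u v then w u v * (g u v - ?P i j) else 0))"
    by (rule sum_swap_pairs)
  also have "\<dots> = (\<Sum>i\<in>?I. \<Sum>j\<in>?I. R i j * (\<Sum>u\<in>V. \<Sum>v\<in>V. (if ?in i j u v then w u v * (g u v - ?P i j) else 0)))"
    by (simp only: sum_distrib_left)
  also have "\<dots> = 0" by (simp only: block mult_zero_right sum.neutral_const)
  finally show ?thesis .
qed

text \<open>The energy of the regularity argument in decreasing form: the squared distance in L^2(w)
  from \<open>g\<close> to its block averages.\<close>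

definition residual :: "'a set \<Rightarrow> ('a \<Rightarrow> nat) \<Rightarrow> ('a \<Rightarrow> 'a \<Rightarrow> real) \<Rightarrow> ('a \<Rightarrow> 'a \<Rightarrow> real) \<Rightarrow> real" where
  "residual V l w g = (\<Sum>u\<in>V. \<Sum>v\<in>V. w u v * (g u v - blk_avg V l w g (l u) (l v))\<^sup>2)"

text \<open>Pythagoras, by \<open>blk_avg_orthogonal\<close>. Any convenient function that is
  constant on blocks can therefore be used to bound the residual.\<close>

lemma residual_le:
  assumes fin: "finite V" and w: "\<And>u v. u \<in> V \<Longrightarrow> v \<in> V \<Longrightarrow> 0 \<le> w u v"
  shows "residual V l w g \<le> (\<Sum>u\<in>V. \<Sum>v\<in>V. w u v * (g u v - R (l u) (l v))\<^sup>2)"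
proof -
  let ?P = "\<lambda>u v. blk_avg V l w g (l u) (l v)"
  let ?R = "\<lambda>u v. R (l u) (l v)"
  have "(\<Sum>u\<in>V. \<Sum>v\<in>V. w u v * (g u v - ?R u v)\<^sup>2) =
     (\<Sum>u\<in>V. \<Sum>v\<in>V. w u v * (g u v - ?P u v)\<^sup>2 + 2 * (w u v * (g u v - ?P u v) * (?P u v - ?R u v)) + w u v * (?P u v - ?R u v)\<^sup>2)"
    by (intro sum.cong refl) (simp add: power2_eq_square algebra_simps)
  also have "\<dots> = residual V l w g + 2 * (\<Sum>u\<in>V. \<Sum>v\<in>V. w u v * (g u v - ?P u v) * (?P u v - ?R u v)) 
      + (\<Sum>u\<in>V. \<Sum>v\<in>V. w u v * (?P u v - ?R u v)\<^sup>2)"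
    by (simp add: residual_def sum.distrib sum_distrib_left)
  also have "(\<Sum>u\<in>V. \<Sum>v\<in>V. w u v * (g u v - ?P u v) * (?P u v - ?R u v)) = 0"
    using blk_avg_orthogonal[where V = V and w = w and g = g and l = l and R = "\<lambda>i j. blk_avg V l w g i j - R i j"] fin w by simp
  finally show ?thesis using w by (simp add: sum_nonneg)
qed

lemma residual_nonneg:
  "(\<And>u v. u \<in> V \<Longrightarrow> v \<in> V \<Longrightarrow> 0 \<le> w u v) \<Longrightarrow> 0 \<le> residual V l w g"
  unfolding residual_def by (intro sum_nonneg) auto

text \<open>Appending the membership bits of \<open>A\<close> and \<open>B\<close> to a label turns one labelling into a refinement.\<close>

lemma residual_refine:
  fixes l :: "'a \<Rightarrow> nat" and A B :: "'a set"
  defines "l' \<equiv> \<lambda>u. 4 * l u + (if u \<in> A then 2 else 0) + (if u \<in> B then 1 else 0)"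
  assumes fin: "finite V" and w: "\<And>u v. u \<in> V \<Longrightarrow> v \<in> V \<Longrightarrow> 0 \<le> w u v \<and> w u v \<le> 1"
    and AB: "A \<subseteq> V" "B \<subseteq> V"
  shows "residual V l' w g \<le> residual V l w g + \<tau>\<^sup>2 * (real (card V))\<^sup>2
     - 2 * \<tau> * (\<Sum>u\<in>A. \<Sum>v\<in>B. w u v * (g u v - blk_avg V l w g (l u) (l v)))"
proof -
  let ?P = "\<lambda>u v. blk_avg V l w g (l u) (l v)"
  let ?q = "\<lambda>u v. if u \<in> A \<and> v \<in> B then \<tau> else 0"
  have dec: "l' u div 4 = l u" "(l' u div 2) mod 2 = (if u \<in> A then 1 else 0)" "l' u mod 2 = (if u \<in> B then 1 else 0)" for u
    unfolding l'_def by (auto, presburger+)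
  \<comment> \<open>Competitor for \<open>residual_le\<close>: the old average plus \<tau> on the
    rectangle A x B. It is a function of the new labels, since they determine the old label and both
    memberships.\<close>
  define R where "R = (\<lambda>i j. blk_avg V l w g (i div 4) (j div 4) + 
     (if (i div 2) mod 2 = 1 \<and> j mod 2 = 1 then \<tau> else 0))"
  have R: "R (l' u) (l' v) = ?P u v + ?q u v" for u v unfolding R_def dec by simp
  have "residual V l' w g \<le> (\<Sum>u\<in>V. \<Sum>v\<in>V. w u v * (g u v - (?P u v + ?q u v))\<^sup>2)"
    using residual_le[where V = V and w = w and g = g and l = l' and R = R] fin w unfolding R by blast
  also have "\<dots> = (\<Sum>u\<in>V. \<Sum>v\<in>V. w u v * (g u v - ?P u v)\<^sup>2 + w u v * (?q u v)\<^sup>2 - 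
       2 * \<tau> * (if u \<in> A \<and> v \<in> B then w u v * (g u v - ?P u v) else 0))"
    by (intro sum.cong refl) (simp add: power2_eq_square algebra_simps)
  also have "\<dots> = residual V l w g + (\<Sum>u\<in>V. \<Sum>v\<in>V. w u v * (?q u v)\<^sup>2) -
       2 * \<tau> * (\<Sum>u\<in>V. \<Sum>v\<in>V. if u \<in> A \<and> v \<in> B then w u v * (g u v - ?P u v) else 0)"
    unfolding residual_def by (simp only: sum_subtractf sum.distrib sum_distrib_left)
  also have "(\<Sum>u\<in>V. \<Sum>v\<in>V. if u \<in> A \<and> v \<in> B then w u v * (g u v - ?P u v) else 0)
     = (\<Sum>u\<in>A. \<Sum>v\<in>B. w u v * (g u v - ?P u v))"
  proof -
    have "(\<Sum>u\<in>A. \<Sum>v\<in>B. w u v * (g u v - ?P u v)) = (\<Sum>u\<in>V. if u \<in> A then (\<Sum>v\<in>V. if v \<in> B then w u v * (g u v - ?P u v) else 0) else 0)"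
      using AB fin by (simp add: sum.inter_restrict[symmetric] Int_absorb1)
    also have "\<dots> = (\<Sum>u\<in>V. \<Sum>v\<in>V. if u \<in> A \<and> v \<in> B then w u v * (g u v - ?P u v) else 0)"
      by (intro sum.cong refl) auto
    finally show ?thesis by simp
  qed
  finally have *: "residual V l' w g \<le> residual V l w g + (\<Sum>u\<in>V. \<Sum>v\<in>V. w u v * (?q u v)\<^sup>2)
     - 2 * \<tau> * (\<Sum>u\<in>A. \<Sum>v\<in>B. w u v * (g u v - ?P u v))" .
  have "(\<Sum>u\<in>V. \<Sum>v\<in>V. w u v * (?q u v)\<^sup>2) \<le> (\<Sum>u\<in>V. \<Sum>v\<in>V. \<tau>\<^sup>2)"
    using w by (intro sum_mono) (auto simp: mult_right_le_one_le mult_left_le_one_le)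
  also have "\<dots> = \<tau>\<^sup>2 * (real (card V))\<^sup>2" by (simp add: power2_eq_square)
  finally show ?thesis using * by linarith
qed

text \<open>Energy decrement: a rectangle that violates the bound for one index refines the
  labelling, which lowers the residual of this index by at least \<eta>^2 n^2 and raises no other.
  One labelling serves all indices, and \<open>t\<close> depends only on \<open>card I\<close> and
  \<eta>.\<close>

lemma weak_regularity:
  fixes \<eta> :: real and I :: "'c set"
  assumes "finite I" "\<eta> > 0"
  shows "\<exists>t>0. \<forall>(V :: 'a set) w g. finite V \<and> V \<noteq> {} \<and> (\<forall>c\<in>I. \<forall>u\<in>V. \<forall>v\<in>V. 0 \<le> w c u v \<and> w c u v \<le> 1 \<and> 0 \<le> g c u v \<and> g c u v \<le> 1) \<longrightarrow>
     (\<exists>l. (\<forall>u\<in>V. l u < t) \<and> (\<forall>c\<in>I. \<forall>A\<subseteq>V. \<forall>B\<subseteq>V. 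
        \<bar>\<Sum>u\<in>A. \<Sum>v\<in>B. w c u v * (g c u v - blk_avg V l (w c) (g c) (l u) (l v))\<bar> \<le> \<eta> * (real (card V))\<^sup>2))"
proof -
  \<comment> \<open>The total residual is at most card I * n^2 at the start and loses \<eta>^2 n^2
    per refinement, so \<open>s\<close> refinements would make it negative. Each refinement
    multiplies the label range by 4.\<close>
  define s where "s = Suc (nat \<lceil>real (card I) / \<eta>\<^sup>2\<rceil>)"
  have s: "real s * \<eta>\<^sup>2 > real (card I)"
  proof -
    have "real (card I) / \<eta>\<^sup>2 < real s" unfolding s_def by linarith
    then show ?thesis using assms(2) by (simp add: divide_less_eq)
  qed
  show ?thesis
  proof (intro exI[of _ "4 ^ s"] conjI allI impI)
    fix V :: "'a set" and w g :: "'c \<Rightarrow> 'a \<Rightarrow> 'a \<Rightarrow> real"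
    assume "finite V \<and> V \<noteq> {} \<and> (\<forall>c\<in>I. \<forall>u\<in>V. \<forall>v\<in>V. 0 \<le> w c u v \<and> w c u v \<le> 1 \<and> 0 \<le> g c u v \<and> g c u v \<le> 1)"
    then have fin: "finite V" and ne: "V \<noteq> {}" and 
      w: "\<And>c u v. c \<in> I \<Longrightarrow> u \<in> V \<Longrightarrow> v \<in> V \<Longrightarrow> 0 \<le> w c u v \<and> w c u v \<le> 1" and
      g: "\<And>c u v. c \<in> I \<Longrightarrow> u \<in> V \<Longrightarrow> v \<in> V \<Longrightarrow> 0 \<le> g c u v \<and> g c u v \<le> 1" by auto
    define n2 where "n2 = (real (card V))\<^sup>2"
    have n2: "n2 > 0" using fin ne by (simp add: n2_def card_gt_0_iff)
    define En where "En = (\<lambda>l. \<Sum>c\<in>I. residual V l (w c) (g c))"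
    define good where "good = (\<lambda>l. \<forall>c\<in>I. \<forall>A\<subseteq>V. \<forall>B\<subseteq>V. 
        \<bar>\<Sum>u\<in>A. \<Sum>v\<in>B. w c u v * (g c u v - blk_avg V l (w c) (g c) (l u) (l v))\<bar> \<le> \<eta> * n2)"
    have step: "(\<exists>l. (\<forall>u\<in>V. l u < 4 ^ s) \<and> good l) \<or> 
      (\<exists>l. (\<forall>u\<in>V. l u < 4 ^ i) \<and> En l \<le> (real (card I) - real i * \<eta>\<^sup>2) * n2)" if "i \<le> s" for i
      using that
    proof (induction i)
      case 0
      have "residual V (\<lambda>_. 0) (w c) (g c) \<le> n2" if c: "c \<in> I" for c
      proof -
        have "residual V (\<lambda>_. 0) (w c) (g c) \<le> (\<Sum>u\<in>V. \<Sum>v\<in>V. w c u v * (g c u v - 0)\<^sup>2)"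
          using residual_le[where V = V and w = "w c" and g = "g c" and l = "\<lambda>_. 0" and R = "\<lambda>_ _. 0"] fin w[OF c] by blast
        also have "\<dots> \<le> (\<Sum>u\<in>V. \<Sum>v\<in>V. 1)"
          using w[OF c] g[OF c] by (intro sum_mono) (simp add: mult_le_one power_le_one)
        finally show ?thesis by (simp add: n2_def power2_eq_square)
      qed
      then have "En (\<lambda>_. 0) \<le> real (card I) * n2" unfolding En_def by (intro sum_bounded_above) auto
      then show ?case by (intro disjI2 exI[of _ "\<lambda>_. 0"]) simp
    next
      case (Suc i)
      show ?case
      proof (cases "\<exists>l. (\<forall>u\<in>V. l u < 4 ^ s) \<and> good l")
        case False
        then obtain l where l: "\<forall>u\<in>V. l u < 4 ^ i" and E: "En l \<le> (real (card I) - real i * \<eta>\<^sup>2) * n2"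
          using Suc by auto
        have "\<forall>u\<in>V. l u < 4 ^ s" using l Suc.prems power_increasing[of i s "4::nat"] by (auto intro: less_le_trans)
        then have "\<not> good l" using False by blast
        then obtain c0 A B where c0: "c0 \<in> I" and AB: "A \<subseteq> V" "B \<subseteq> V" and
          big: "\<bar>\<Sum>u\<in>A. \<Sum>v\<in>B. w c0 u v * (g c0 u v - blk_avg V l (w c0) (g c0) (l u) (l v))\<bar> > \<eta> * n2"
          unfolding good_def by (auto simp: not_le)
        define l' where "l' = (\<lambda>u. 4 * l u + (if u \<in> A then 2 else 0) + (if u \<in> B then 1 else 0))"
        define D where "D = (\<Sum>u\<in>A. \<Sum>v\<in>B. w c0 u v * (g c0 u v - blk_avg V l (w c0) (g c0) (l u) (l v)))"
        have l'4: "l' u < 4 ^ Suc i" if "u \<in> V" for u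
        proof -
          have "l u < 4 ^ i" using l that by blast
          then show ?thesis unfolding l'_def by auto
        qed
        \<comment> \<open>With \<tau> = 0, \<open>residual_refine\<close> says that refining never
          raises a residual.\<close>
        have other: "residual V l' (w c) (g c) \<le> residual V l (w c) (g c)" if "c \<in> I" for c
          using residual_refine[where V = V and w = "w c" and g = "g c" and l = l and A = A and B = B and \<tau> = 0] fin w[OF that] AB
          by (simp add: l'_def)
        \<comment> \<open>\<tau> = D/n2 minimises \<tau>^2 n2 - 2 \<tau> D; the minimum is
          -D^2/n2.\<close>
        have "residual V l' (w c0) (g c0) \<le> residual V l (w c0) (g c0) + (D / n2)\<^sup>2 * n2 - 2 * (D / n2) * D"
          using residual_refine[where V = V and w = "w c0" and g = "g c0" and l = l and A = A and B = B and \<tau> = "D / n2"] fin w[OF c0] AB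
          by (simp add: l'_def D_def n2_def)
        also have "\<dots> = residual V l (w c0) (g c0) - D\<^sup>2 / n2"
          using n2 by (simp add: field_simps power2_eq_square)
        also have "\<dots> \<le> residual V l (w c0) (g c0) - \<eta>\<^sup>2 * n2"
        proof -
          have "(\<eta> * n2)\<^sup>2 \<le> \<bar>D\<bar>\<^sup>2" using big n2 assms(2) unfolding D_def by (intro power_mono) auto
          then have "\<eta>\<^sup>2 * n2 \<le> D\<^sup>2 / n2" using n2 by (simp add: field_simps power2_eq_square)
          then show ?thesis by simp
        qed
        finally have c0': "residual V l' (w c0) (g c0) \<le> residual V l (w c0) (g c0) - \<eta>\<^sup>2 * n2" .
        have "En l' \<le> En l - \<eta>\<^sup>2 * n2"
        proof -
          have "(\<Sum>c\<in>I - {c0}. residual V l' (w c) (g c)) \<le> (\<Sum>c\<in>I - {c0}. residual V l (w c) (g c))"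
            using other by (intro sum_mono) auto
          then show ?thesis using c0' unfolding En_def sum.remove[OF assms(1) c0] by simp
        qed
        then have "En l' \<le> (real (card I) - real (Suc i) * \<eta>\<^sup>2) * n2"
          using E by (simp add: algebra_simps)
        then show ?thesis using l'4 by blast
      qed blast
    qed
    have "En l \<ge> 0" for l unfolding En_def using w by (intro sum_nonneg residual_nonneg) auto
    moreover have "(real (card I) - real s * \<eta>\<^sup>2) * n2 < 0" using s n2 by (simp add: mult_neg_pos)
    ultimately have "\<not> En l \<le> (real (card I) - real s * \<eta>\<^sup>2) * n2" for l by (simp add: not_le order_less_le_trans)
    then have "\<exists>l. (\<forall>u\<in>V. l u < 4 ^ s) \<and> good l" using step[of s] by blast
    then show "\<exists>l. (\<forall>u\<in>V. l u < 4 ^ s) \<and> (\<forall>c\<in>I. \<forall>A\<subseteq>V. \<forall>B\<subseteq>V. 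
        \<bar>\<Sum>u\<in>A. \<Sum>v\<in>B. w c u v * (g c u v - blk_avg V l (w c) (g c) (l u) (l v))\<bar> \<le> \<eta> * (real (card V))\<^sup>2)"
      unfolding good_def n2_def .
  qed simp
qed

section \<open>The cut norm and counting\<close>

text \<open>A bound on the cut norm, normalised by n^2 and tested against [-1,1]-valued functions
  rather than sets. The counting argument substitutes such functions: products of the other factors,
  each in one of the two variables.\<close>

definition cutb :: "'a set \<Rightarrow> ('a \<Rightarrow> 'a \<Rightarrow> real) \<Rightarrow> real \<Rightarrow> bool" where
  "cutb V f \<delta> \<longleftrightarrow> (\<forall>a b. (\<forall>u\<in>V. \<bar>a u\<bar> \<le> 1) \<longrightarrow> (\<forall>v\<in>V. \<bar>b v\<bar> \<le> 1) \<longrightarrow>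
     \<bar>\<Sum>u\<in>V. \<Sum>v\<in>V. f u v * a u * b v\<bar> \<le> \<delta> * (real (card V))\<^sup>2)"

lemma cutbD:
  "cutb V f \<delta> \<Longrightarrow> (\<And>u. u \<in> V \<Longrightarrow> \<bar>a u\<bar> \<le> 1) \<Longrightarrow> (\<And>v. v \<in> V \<Longrightarrow> \<bar>b v\<bar> \<le> 1) \<Longrightarrow>
     \<bar>\<Sum>u\<in>V. \<Sum>v\<in>V. f u v * a u * b v\<bar> \<le> \<delta> * (real (card V))\<^sup>2"
  unfolding cutb_def by blast

lemma cutb_cong:
  assumes "cutb V f \<delta>" "\<And>u v. u \<in> V \<Longrightarrow> v \<in> V \<Longrightarrow> f' u v = f u v"
  shows "cutb V f' \<delta>"
  using assms unfolding cutb_def by (simp cong: sum.cong)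

lemma cutb_uminus: "cutb V f \<delta> \<Longrightarrow> cutb V (\<lambda>u v. - f u v) \<delta>"
  unfolding cutb_def by (simp add: sum_negf)

lemma cutb_mono: "cutb V f \<delta> \<Longrightarrow> \<delta> \<le> \<delta>' \<Longrightarrow> cutb V f \<delta>'"
  unfolding cutb_def by (meson mult_right_mono order_trans zero_le_power2)

lemma sum_le_sum_pos_part:
  fixes a z :: "'a \<Rightarrow> real"
  assumes "finite V" "\<And>u. u \<in> V \<Longrightarrow> 0 \<le> a u \<and> a u \<le> 1"
  shows "(\<Sum>u\<in>V. a u * z u) \<le> (\<Sum>u\<in>{u \<in> V. z u > 0}. z u)"
proof -
  have "(\<Sum>u\<in>V. a u * z u) \<le> (\<Sum>u\<in>V. if z u > 0 then z u else 0)"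
  proof (rule sum_mono)
    fix u assume "u \<in> V"
    then show "a u * z u \<le> (if z u > 0 then z u else 0)"
      using assms(2)[of u] by (auto simp: mult_left_le_one_le mult_nonneg_nonpos)
  qed
  then show ?thesis using assms(1) by (simp add: sum.inter_filter)
qed

text \<open>The form is linear in \<open>a\<close> and in \<open>b\<close> separately, so it is
  rounded up to a rectangle in two stages: keep the rows with positive coefficient, then the
  columns.\<close>

lemma sum_le_of_sets:
  assumes fin: "finite V" and le: "\<And>A B. A \<subseteq> V \<Longrightarrow> B \<subseteq> V \<Longrightarrow> (\<Sum>u\<in>A. \<Sum>v\<in>B. f u v) \<le> (K::real)"
    and a: "\<And>u. u \<in> V \<Longrightarrow> 0 \<le> a u \<and> a u \<le> 1" and b: "\<And>u. u \<in> V \<Longrightarrow> 0 \<le> b u \<and> b u \<le> 1"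
  shows "(\<Sum>u\<in>V. \<Sum>v\<in>V. f u v * a u * b v) \<le> K"
proof -
  define z where "z = (\<lambda>u. \<Sum>v\<in>V. f u v * b v)"
  define A where "A = {u \<in> V. z u > 0}"
  define y where "y = (\<lambda>v. \<Sum>u\<in>A. f u v)"
  define B where "B = {v \<in> V. y v > 0}"
  have "(\<Sum>u\<in>V. \<Sum>v\<in>V. f u v * a u * b v) = (\<Sum>u\<in>V. a u * z u)"
    unfolding z_def by (simp add: sum_distrib_left mult_ac)
  also have "\<dots> \<le> (\<Sum>u\<in>A. z u)" unfolding A_def by (rule sum_le_sum_pos_part[OF fin a])
  also have "\<dots> = (\<Sum>v\<in>V. b v * y v)"
    unfolding z_def y_def by (subst sum.swap) (simp add: sum_distrib_left mult_ac)
  also have "\<dots> \<le> (\<Sum>v\<in>B. y v)" unfolding B_def by (rule sum_le_sum_pos_part[OF fin b])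
  also have "\<dots> = (\<Sum>u\<in>A. \<Sum>v\<in>B. f u v)" unfolding y_def by (rule sum.swap)
  also have "\<dots> \<le> K" by (rule le) (auto simp: A_def B_def)
  finally show ?thesis .
qed

text \<open>Splitting \<open>a\<close> and \<open>b\<close> into positive and negative parts gives
  four forms with [0,1]-valued tests, hence the factor 4.\<close>

lemma cutb_of_sets:
  assumes fin: "finite V" and le: "\<And>A B. A \<subseteq> V \<Longrightarrow> B \<subseteq> V \<Longrightarrow> \<bar>\<Sum>u\<in>A. \<Sum>v\<in>B. f u v\<bar> \<le> \<delta> * (real (card V))\<^sup>2"
  shows "cutb V f (4 * \<delta>)"
  unfolding cutb_def
proof (intro allI impI)
  fix a b :: "'a \<Rightarrow> real" assume a: "\<forall>u\<in>V. \<bar>a u\<bar> \<le> 1" and b: "\<forall>v\<in>V. \<bar>b v\<bar> \<le> 1"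
  let ?K = "\<delta> * (real (card V))\<^sup>2"
  let ?S = "\<lambda>a b. \<Sum>u\<in>V. \<Sum>v\<in>V. f u v * a u * b v"
  have S: "\<bar>?S a b\<bar> \<le> ?K" if a: "\<And>u. u \<in> V \<Longrightarrow> 0 \<le> a u \<and> a u \<le> 1" and b: "\<And>u. u \<in> V \<Longrightarrow> 0 \<le> b u \<and> b u \<le> 1" for a b
  proof -
    have "?S a b \<le> ?K" using le by (intro sum_le_of_sets[OF fin _ a b]) (auto simp: abs_le_iff)
    moreover have "(\<Sum>u\<in>V. \<Sum>v\<in>V. (- f u v) * a u * b v) \<le> ?K"
      using le by (intro sum_le_of_sets[OF fin _ a b]) (auto simp: abs_le_iff sum_negf)
    ultimately show ?thesis by (simp add: sum_negf)
  qed
  define a1 a2 b1 b2 where "a1 = (\<lambda>u. max (a u) 0)" and "a2 = (\<lambda>u. max (- a u) 0)"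
    and "b1 = (\<lambda>u. max (b u) 0)" and "b2 = (\<lambda>u. max (- b u) 0)"
  have "?S a b = (\<Sum>u\<in>V. \<Sum>v\<in>V. f u v * a1 u * b1 v - f u v * a1 u * b2 v - f u v * a2 u * b1 v + f u v * a2 u * b2 v)"
  proof (intro sum.cong refl)
    fix u v
    have *: "a u = a1 u - a2 u" "b v = b1 v - b2 v" by (auto simp: a1_def a2_def b1_def b2_def)
    show "f u v * a u * b v = f u v * a1 u * b1 v - f u v * a1 u * b2 v - f u v * a2 u * b1 v + f u v * a2 u * b2 v"
      unfolding * by (simp add: algebra_simps)
  qed
  also have "\<dots> = ?S a1 b1 - ?S a1 b2 - ?S a2 b1 + ?S a2 b2" by (simp only: sum.distrib sum_subtractf)
  finally have *: "?S a b = ?S a1 b1 - ?S a1 b2 - ?S a2 b1 + ?S a2 b2" .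
  have r: "0 \<le> a1 u \<and> a1 u \<le> 1" "0 \<le> a2 u \<and> a2 u \<le> 1" "0 \<le> b1 u \<and> b1 u \<le> 1" "0 \<le> b2 u \<and> b2 u \<le> 1" if "u \<in> V" for u
    using that a b by (auto simp: a1_def a2_def b1_def b2_def abs_le_iff)
  have "\<bar>?S a1 b1\<bar> \<le> ?K" "\<bar>?S a1 b2\<bar> \<le> ?K" "\<bar>?S a2 b1\<bar> \<le> ?K" "\<bar>?S a2 b2\<bar> \<le> ?K"
    by (rule S; use r in blast)+
  then have "\<bar>?S a b\<bar> \<le> 4 * ?K" unfolding * by linarith
  then show "\<bar>?S a b\<bar> \<le> 4 * \<delta> * (real (card V))\<^sup>2" by simp
qed

text \<open>The factor combines t^2 rectangle indicators with coefficients at most 1 in modulus, and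
  a test function restricted to a label class is still a test function. The price t^2 ties the
  accuracy of \<open>U\<close> to the number of labels of the colouring.\<close>

lemma cutb_mult_step:
  assumes fin: "finite V" and f: "cutb V f \<delta>" and l: "\<And>u. u \<in> V \<Longrightarrow> l u < t" and P: "\<And>i j. \<bar>P i j\<bar> \<le> 1"
  shows "cutb V (\<lambda>u v. f u v * P (l u) (l v)) ((real t)\<^sup>2 * \<delta>)"
  unfolding cutb_def
proof (intro allI impI)
  fix a b :: "'a \<Rightarrow> real" assume a: "\<forall>u\<in>V. \<bar>a u\<bar> \<le> 1" and b: "\<forall>v\<in>V. \<bar>b v\<bar> \<le> 1"
  let ?a = "\<lambda>i u. if l u = i then a u else 0" and ?b = "\<lambda>i u. if l u = i then b u else 0"
  let ?S = "\<lambda>i j. \<Sum>u\<in>V. \<Sum>v\<in>V. f u v * ?a i u * ?b j v"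
  have "(\<Sum>u\<in>V. \<Sum>v\<in>V. f u v * P (l u) (l v) * a u * b v)
      = (\<Sum>u\<in>V. \<Sum>v\<in>V. \<Sum>i<t. \<Sum>j<t. P i j * (f u v * ?a i u * ?b j v))"
  proof (intro sum.cong refl)
    fix u v assume uv: "u \<in> V" "v \<in> V"
    have "(\<lambda>j. P i j * (f u v * x * ?b j v)) = (\<lambda>j. if l v = j then P i j * (f u v * x * b v) else 0)" for i x
      by auto
    then have "(\<Sum>j<t. P i j * (f u v * x * ?b j v)) = P i (l v) * (f u v * x * b v)" for i x
      using l uv by (simp only:) simp
    then have "(\<Sum>i<t. \<Sum>j<t. P i j * (f u v * ?a i u * ?b j v)) = (\<Sum>i<t. P i (l v) * (f u v * ?a i u * b v))"
      by simp
    also have "(\<lambda>i. P i (l v) * (f u v * ?a i u * b v)) = (\<lambda>i. if l u = i then P i (l v) * (f u v * a u * b v) else 0)"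
      by auto
    also have "(\<Sum>i<t. \<dots> i) = P (l u) (l v) * (f u v * a u * b v)" using l uv by simp
    finally show "f u v * P (l u) (l v) * a u * b v = (\<Sum>i<t. \<Sum>j<t. P i j * (f u v * ?a i u * ?b j v))" by simp
  qed
  also have "\<dots> = (\<Sum>i<t. \<Sum>j<t. \<Sum>u\<in>V. \<Sum>v\<in>V. P i j * (f u v * ?a i u * ?b j v))"
    by (rule sum_swap_pairs)
  also have "\<dots> = (\<Sum>i<t. \<Sum>j<t. P i j * ?S i j)" by (simp only: sum_distrib_left)
  finally have eq: "(\<Sum>u\<in>V. \<Sum>v\<in>V. f u v * P (l u) (l v) * a u * b v) = (\<Sum>i<t. \<Sum>j<t. P i j * ?S i j)" .
  have bd: "\<bar>P i j * ?S i j\<bar> \<le> \<delta> * (real (card V))\<^sup>2" for i j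
  proof -
    have S: "\<bar>?S i j\<bar> \<le> \<delta> * (real (card V))\<^sup>2" using a b by (intro cutbD[OF f]) auto
    have "\<bar>P i j\<bar> * \<bar>?S i j\<bar> \<le> 1 * \<bar>?S i j\<bar>" by (intro mult_right_mono P) simp
    then show ?thesis using S unfolding abs_mult by linarith
  qed
  have "\<bar>\<Sum>i<t. \<Sum>j<t. P i j * ?S i j\<bar> \<le> (\<Sum>i<t. \<Sum>j<t. \<bar>P i j * ?S i j\<bar>)"
    by (rule order.trans[OF sum_abs]) (intro sum_mono sum_abs)
  also have "\<dots> \<le> (\<Sum>i<t. \<Sum>j<t. \<delta> * (real (card V))\<^sup>2)" by (intro sum_mono bd)
  also have "\<dots> = (real t)\<^sup>2 * \<delta> * (real (card V))\<^sup>2" by (simp add: power2_eq_square)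
  finally show "\<bar>\<Sum>u\<in>V. \<Sum>v\<in>V. f u v * P (l u) (l v) * a u * b v\<bar> \<le> (real t)\<^sup>2 * \<delta> * (real (card V))\<^sup>2"
    unfolding eq .
qed

section \<open>Counting by resampling coordinates\<close>

lemma sum_tup_resample:
  assumes "i < q"
  shows "(\<Sum>xs\<in>tup V q. \<Sum>u\<in>V. g (xs[i := u])) = real (card V) * (\<Sum>xs\<in>tup V q. g xs)"
proof -
  have "(\<Sum>xs\<in>tup V q. \<Sum>u\<in>V. g (xs[i := u])) = (\<Sum>(xs, u)\<in>tup V q \<times> V. g (xs[i := u]))"
    by (rule sum.cartesian_product)
  \<comment> \<open>Exchanging the entry at \<open>i\<close> with the fresh point is an involution
    on the pairs (xs, u), hence its own inverse.\<close>
  also have "\<dots> = (\<Sum>(xs, u)\<in>tup V q \<times> V. g xs)"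
    using assms
    by (intro sum.reindex_bij_witness[where i = "\<lambda>(xs, u). (xs[i := u], xs ! i)" and j = "\<lambda>(xs, u). (xs[i := u], xs ! i)"])
       (auto simp: tup_def dest: set_update_subset_insert[THEN subsetD])
  also have "\<dots> = (\<Sum>xs\<in>tup V q. \<Sum>u\<in>V. g xs)" by (rule sum.cartesian_product[symmetric])
  finally show ?thesis by (simp add: sum_distrib_left)
qed

definition idx :: "nat \<Rightarrow> (nat \<times> nat) set" where
  "idx q = {(i, j). i < j \<and> j < q}"

lemma finite_idx [simp]: "finite (idx q)"
  by (rule finite_subset[of _ "{..<q} \<times> {..<q}"]) (auto simp: idx_def)

text \<open>Freeze all entries except those at \<open>i\<close> and \<open>j\<close>. As (i, j) is
  not in \<open>E\<close>, each remaining factor involves at most one of the two free entries, so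
  their product splits as a(u) b(v), an admissible test for the cut norm.\<close>

lemma edge_avg_le:
  assumes fin: "finite V" and ne: "V \<noteq> {}" and f: "cutb V f \<delta>" and ij: "(i, j) \<in> idx q" and E: "E \<subseteq> idx q" "(i, j) \<notin> E"
    and Z: "\<And>e u v. e \<in> E \<Longrightarrow> u \<in> V \<Longrightarrow> v \<in> V \<Longrightarrow> 0 \<le> Z e u v \<and> Z e u v \<le> (1::real)"
  shows "\<bar>avg (tup V q) (\<lambda>xs. f (xs ! i) (xs ! j) * (\<Prod>e\<in>E. Z e (xs ! fst e) (xs ! snd e)))\<bar> \<le> \<delta>"
proof -
  let ?F = "\<lambda>xs. f (xs ! i) (xs ! j) * (\<Prod>e\<in>E. Z e (xs ! fst e) (xs ! snd e))"
  have q: "i < j" "j < q" "i < q" using ij by (auto simp: idx_def)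
  have finE: "finite E" using E finite_subset finite_idx by blast
  have n: "real (card V) > 0" using fin ne by (simp add: card_gt_0_iff)
  let ?n = "real (card V)"
  let ?J = "\<lambda>e. j = fst e \<or> j = snd e"
  have "?n * ?n * (\<Sum>xs\<in>tup V q. ?F xs) = (\<Sum>xs\<in>tup V q. \<Sum>u\<in>V. \<Sum>v\<in>V. ?F (xs[i := u, j := v]))"
  proof -
    have "(\<Sum>xs\<in>tup V q. \<Sum>u\<in>V. \<Sum>v\<in>V. ?F (xs[i := u, j := v])) = ?n * (\<Sum>xs\<in>tup V q. \<Sum>v\<in>V. ?F (xs[j := v]))"
      by (rule sum_tup_resample[OF q(3), of "\<lambda>xs. \<Sum>v\<in>V. ?F (xs[j := v])"])
    also have "(\<Sum>xs\<in>tup V q. \<Sum>v\<in>V. ?F (xs[j := v])) = ?n * (\<Sum>xs\<in>tup V q. ?F xs)"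
      by (rule sum_tup_resample[OF q(2)])
    finally show ?thesis by simp
  qed
  also have "\<bar>\<dots>\<bar> \<le> (\<Sum>xs\<in>tup V q. \<delta> * ?n\<^sup>2)"
  proof (rule order.trans[OF sum_abs sum_mono])
    fix xs assume xs: "xs \<in> tup V q"
    have len: "length xs = q" and mem: "\<And>p. p < q \<Longrightarrow> xs ! p \<in> V" using xs by (auto simp: tup_def)
    \<comment> \<open>Factors at position \<open>j\<close> go into \<open>b\<close>; all others,
      including those away from both positions, go into \<open>a\<close>.\<close>
    define a where "a = (\<lambda>u. \<Prod>e\<in>{e\<in>E. \<not> ?J e}. Z e (xs[i := u] ! fst e) (xs[i := u] ! snd e))"
    define b where "b = (\<lambda>v. \<Prod>e\<in>{e\<in>E. ?J e}. Z e (xs[j := v] ! fst e) (xs[j := v] ! snd e))"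
    have rng: "fst e < q" "snd e < q" "fst e < snd e" if "e \<in> E" for e using that E(1) by (auto simp: idx_def)
    have upd: "xs[p := u] ! p' \<in> V" if "p' < q" "u \<in> V" for p p' u
      using that len mem by (cases "p = p'") auto
    have fac: "?F (xs[i := u, j := v]) = f u v * a u * b v" for u v
    proof -
      let ?ys = "xs[i := u, j := v]"
      have "(\<Prod>e\<in>E. Z e (?ys ! fst e) (?ys ! snd e)) = 
        (\<Prod>e\<in>{e\<in>E. \<not> ?J e}. Z e (?ys ! fst e) (?ys ! snd e)) * (\<Prod>e\<in>{e\<in>E. ?J e}. Z e (?ys ! fst e) (?ys ! snd e))"
        using finE by (subst prod.union_disjoint[symmetric]) (auto intro!: prod.cong)
      also have "(\<Prod>e\<in>{e\<in>E. \<not> ?J e}. Z e (?ys ! fst e) (?ys ! snd e)) = a u"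
        unfolding a_def by (intro prod.cong refl) auto
      also have "(\<Prod>e\<in>{e\<in>E. ?J e}. Z e (?ys ! fst e) (?ys ! snd e)) = b v"
        unfolding b_def
      proof (intro prod.cong refl)
        fix e assume e: "e \<in> {e\<in>E. ?J e}"
        \<comment> \<open>A pair of \<open>idx q\<close> touching both positions could only be (i,
          j).\<close>
        then have "fst e \<noteq> i \<and> snd e \<noteq> i" using E(2) q rng[of e] by (metis (mono_tags) less_asym mem_Collect_eq order_less_irrefl prod.collapse)
        moreover have "?ys ! p = xs[j := v] ! p" if "p \<noteq> i" "p < q" for p
          using that len by (cases "p = j") auto
        ultimately show "Z e (?ys ! fst e) (?ys ! snd e) = Z e (xs[j := v] ! fst e) (xs[j := v] ! snd e)"
          using rng[of e] e by simp
      qed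
      finally show ?thesis using q len by simp
    qed
    have "\<bar>\<Sum>u\<in>V. \<Sum>v\<in>V. f u v * a u * b v\<bar> \<le> \<delta> * ?n\<^sup>2"
    proof (rule cutbD[OF f])
      fix u assume u: "u \<in> V"
      have "0 \<le> a u" "a u \<le> 1" unfolding a_def using Z upd[OF _ u] rng by (auto intro!: prod_nonneg prod_le_1)
      then show "\<bar>a u\<bar> \<le> 1" by simp
    next
      fix u assume u: "u \<in> V"
      have "0 \<le> b u" "b u \<le> 1" unfolding b_def using Z upd[OF _ u] rng by (auto intro!: prod_nonneg prod_le_1)
      then show "\<bar>b u\<bar> \<le> 1" by simp
    qed
    then show "\<bar>\<Sum>u\<in>V. \<Sum>v\<in>V. ?F (xs[i := u, j := v])\<bar> \<le> \<delta> * ?n\<^sup>2" by (simp only: fac)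
  qed
  finally have "?n\<^sup>2 * \<bar>\<Sum>xs\<in>tup V q. ?F xs\<bar> \<le> ?n\<^sup>2 * (?n ^ q * \<delta>)"
    using fin by (simp add: abs_mult power2_eq_square card_tup mult_ac)
  then have "\<bar>\<Sum>xs\<in>tup V q. ?F xs\<bar> \<le> ?n ^ q * \<delta>" using n by simp
  then show ?thesis using n fin by (simp add: avg_def card_tup abs_divide pos_divide_le_eq mult.commute)
qed

text \<open>The counting lemma: factors are exchanged one at a time, each exchange being an instance
  of \<open>edge_avg_le\<close>.\<close>

lemma product_counting:
  assumes fin: "finite V" and ne: "V \<noteq> {}" and E: "E \<subseteq> idx q"
    and c: "\<And>e. e \<in> E \<Longrightarrow> cutb V (\<lambda>u v. Z e u v - Z' e u v) \<delta>"
    and Z: "\<And>e u v. e \<in> E \<Longrightarrow> u \<in> V \<Longrightarrow> v \<in> V \<Longrightarrow> 0 \<le> Z e u v \<and> Z e u v \<le> (1::real)"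
    and Z': "\<And>e u v. e \<in> E \<Longrightarrow> u \<in> V \<Longrightarrow> v \<in> V \<Longrightarrow> 0 \<le> Z' e u v \<and> Z' e u v \<le> (1::real)"
  shows "\<bar>avg (tup V q) (\<lambda>xs. \<Prod>e\<in>E. Z e (xs ! fst e) (xs ! snd e)) - avg (tup V q) (\<lambda>xs. \<Prod>e\<in>E. Z' e (xs ! fst e) (xs ! snd e))\<bar> 
      \<le> real (card E) * \<delta>"
proof -
  have finE: "finite E" using E finite_subset finite_idx by blast
  define H where "H = (\<lambda>D. avg (tup V q) (\<lambda>xs. \<Prod>e\<in>E. (if e \<in> D then Z e else Z' e) (xs ! fst e) (xs ! snd e)))"
  have "\<bar>H D - H {}\<bar> \<le> real (card D) * \<delta>" if "finite D" "D \<subseteq> E" for D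
    using that
  proof (induction D rule: finite_induct)
    case empty
    then show ?case by simp
  next
    case (insert d D)
    let ?W = "\<lambda>e. if e \<in> D then Z e else Z' e"
    have d: "d \<in> E" using insert by auto
    have "H (insert d D) - H D = avg (tup V q) (\<lambda>xs. (Z d (xs ! fst d) (xs ! snd d) - Z' d (xs ! fst d) (xs ! snd d)) *
       (\<Prod>e\<in>E - {d}. ?W e (xs ! fst e) (xs ! snd e)))"
      unfolding H_def avg_diff[symmetric] prod.remove[OF finE d]
    proof (intro avg_cong)
      fix xs
      have "(\<Prod>e\<in>E - {d}. (if e \<in> insert d D then Z e else Z' e) (xs ! fst e) (xs ! snd e)) = (\<Prod>e\<in>E - {d}. ?W e (xs ! fst e) (xs ! snd e))"
        by (intro prod.cong) auto
      then show "(if d \<in> insert d D then Z d else Z' d) (xs ! fst d) (xs ! snd d) *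
           (\<Prod>e\<in>E - {d}. (if e \<in> insert d D then Z e else Z' e) (xs ! fst e) (xs ! snd e)) -
         ?W d (xs ! fst d) (xs ! snd d) * (\<Prod>e\<in>E - {d}. ?W e (xs ! fst e) (xs ! snd e)) = 
         (Z d (xs ! fst d) (xs ! snd d) - Z' d (xs ! fst d) (xs ! snd d)) * (\<Prod>e\<in>E - {d}. ?W e (xs ! fst e) (xs ! snd e))"
        using insert.hyps by (simp add: left_diff_distrib)
    qed
    moreover have "\<bar>avg (tup V q) (\<lambda>xs. (Z d (xs ! fst d) (xs ! snd d) - Z' d (xs ! fst d) (xs ! snd d)) *
       (\<Prod>e\<in>E - {d}. ?W e (xs ! fst e) (xs ! snd e)))\<bar> \<le> \<delta>"
    proof (rule edge_avg_le[OF fin ne c[OF d]])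
      show "0 \<le> ?W e u v \<and> ?W e u v \<le> 1" if "e \<in> E - {d}" "u \<in> V" "v \<in> V" for e u v
        using that Z Z' by (cases "e \<in> D") auto
    qed (use d E in auto)
    moreover have "\<bar>H D - H {}\<bar> \<le> real (card D) * \<delta>" using insert by auto
    ultimately show ?case using insert.hyps by (simp add: algebra_simps)
  qed
  from this[of E] finE show ?thesis by (simp add: H_def cong: avg_cong prod.cong)
qed

section \<open>Cut norm and 4-cycle density\<close>

definition c4 :: "('a \<Rightarrow> 'a \<Rightarrow> real) \<Rightarrow> 'a list \<Rightarrow> real" where
  "c4 f xs = f (xs ! 0) (xs ! 2) * f (xs ! 0) (xs ! 3) * f (xs ! 1) (xs ! 2) * f (xs ! 1) (xs ! 3)"

lemma sum_c4:
  "(\<Sum>xs\<in>tup V 4. c4 f xs) = (\<Sum>x\<in>V. \<Sum>x'\<in>V. \<Sum>y\<in>V. \<Sum>y'\<in>V. f x y * f x y' * f x' y * f x' y')"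
proof -
  have "tup V 4 = tup V (Suc (Suc (Suc (Suc 0))))" by (simp add: numeral_eq_Suc)
  then show ?thesis by (simp only: sum_tup_Suc tup_0) (simp add: c4_def numeral_eq_Suc)
qed

text \<open>For fixed x', y' the factors f(x, y') and f(x', y) depend on one free variable each and
  act as tests for the cut norm. The detour through 4-cycles is made because the cut norm is a
  supremum, while this density is a tuple average and so passes to samples.\<close>

lemma c4_le_cutb:
  assumes fin: "finite V" and ne: "V \<noteq> {}" and f: "cutb V f \<delta>" and f1: "\<And>u v. u \<in> V \<Longrightarrow> v \<in> V \<Longrightarrow> \<bar>f u v\<bar> \<le> 1"
  shows "\<bar>avg (tup V 4) (c4 f)\<bar> \<le> \<delta>"
proof -
  let ?n = "real (card V)"
  have n: "?n > 0" using fin ne by (simp add: card_gt_0_iff)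
  have \<delta>: "0 \<le> \<delta> * ?n\<^sup>2" using cutbD[OF f, of "\<lambda>_. 0" "\<lambda>_. 0"] by simp
  have "(\<Sum>xs\<in>tup V 4. c4 f xs) = (\<Sum>x\<in>V. \<Sum>y\<in>V. \<Sum>x'\<in>V. \<Sum>y'\<in>V. f x y * f x y' * f x' y * f x' y')"
    unfolding sum_c4 by (intro sum.cong refl sum.swap)
  also have "\<dots> = (\<Sum>x'\<in>V. \<Sum>y'\<in>V. \<Sum>x\<in>V. \<Sum>y\<in>V. f x y * f x y' * f x' y * f x' y')"
    by (rule sum_swap_pairs)
  also have "\<dots> = (\<Sum>x'\<in>V. \<Sum>y'\<in>V. f x' y' * (\<Sum>x\<in>V. \<Sum>y\<in>V. f x y * f x y' * f x' y))"
    by (simp add: sum_distrib_left mult_ac)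
  also have "\<bar>\<dots>\<bar> \<le> (\<Sum>x'\<in>V. \<Sum>y'\<in>V. \<bar>f x' y' * (\<Sum>x\<in>V. \<Sum>y\<in>V. f x y * f x y' * f x' y)\<bar>)"
    by (rule order.trans[OF sum_abs]) (intro sum_mono sum_abs)
  also have "\<dots> \<le> (\<Sum>x'\<in>V. \<Sum>y'\<in>V. \<delta> * ?n\<^sup>2)"
  proof (intro sum_mono)
    fix x' y' assume "x' \<in> V" "y' \<in> V"
    then have "\<bar>\<Sum>x\<in>V. \<Sum>y\<in>V. f x y * f x y' * f x' y\<bar> \<le> \<delta> * ?n\<^sup>2" "\<bar>f x' y'\<bar> \<le> 1"
      using cutbD[OF f, of "\<lambda>x. f x y'" "\<lambda>y. f x' y"] f1 by auto
    then have "\<bar>f x' y'\<bar> * \<bar>\<Sum>x\<in>V. \<Sum>y\<in>V. f x y * f x y' * f x' y\<bar> \<le> 1 * (\<delta> * ?n\<^sup>2)"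
      by (intro mult_mono) auto
    then show "\<bar>f x' y' * (\<Sum>x\<in>V. \<Sum>y\<in>V. f x y * f x y' * f x' y)\<bar> \<le> \<delta> * ?n\<^sup>2" by (simp add: abs_mult)
  qed
  also have "\<dots> = \<delta> * ?n ^ 4" by (simp add: power2_eq_square numeral_eq_Suc)
  finally have "\<bar>\<Sum>xs\<in>tup V 4. c4 f xs\<bar> / ?n ^ 4 \<le> \<delta>" using n by (subst pos_divide_le_eq) simp_all
  then show ?thesis using fin by (simp add: avg_def card_tup abs_divide)
qed

lemma sum_square_le:
  fixes z :: "'a \<Rightarrow> real"
  assumes "finite X"
  shows "(\<Sum>x\<in>X. z x)\<^sup>2 \<le> real (card X) * (\<Sum>x\<in>X. (z x)\<^sup>2)"
proof -
  have "0 \<le> (\<Sum>x\<in>X. \<Sum>y\<in>X. (z x - z y)\<^sup>2)" by (intro sum_nonneg) auto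
  also have "\<dots> = (\<Sum>x\<in>X. \<Sum>y\<in>X. (z x)\<^sup>2 + (z y)\<^sup>2 - 2 * (z x * z y))"
    by (intro sum.cong refl) (simp add: power2_diff)
  also have "\<dots> = 2 * (real (card X) * (\<Sum>x\<in>X. (z x)\<^sup>2)) - 2 * (\<Sum>x\<in>X. \<Sum>y\<in>X. z x * z y)"
    by (simp add: sum.distrib sum_subtractf sum_distrib_left)
  also have "(\<Sum>x\<in>X. \<Sum>y\<in>X. z x * z y) = (\<Sum>x\<in>X. z x)\<^sup>2"
    by (simp add: power2_eq_square sum_product)
  finally show ?thesis by simp
qed

text \<open>Applying Cauchy-Schwarz once to each of the two variables.\<close>

lemma cutb_of_c4:
  assumes fin: "finite V" and \<rho>: "\<rho> \<ge> 0" and c: "avg (tup V 4) (c4 f) \<le> \<rho> ^ 4"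
  shows "cutb V f \<rho>"
  unfolding cutb_def
proof (intro allI impI)
  fix a b :: "'a \<Rightarrow> real" assume a: "\<forall>u\<in>V. \<bar>a u\<bar> \<le> 1" and b: "\<forall>v\<in>V. \<bar>b v\<bar> \<le> 1"
  let ?n = "real (card V)"
  define T where "T = (\<Sum>u\<in>V. \<Sum>v\<in>V. f u v * a u * b v)"
  define X where "X = (\<Sum>u\<in>V. (\<Sum>v\<in>V. f u v * b v)\<^sup>2)"
  have sq1: "x\<^sup>2 \<le> 1" if "\<bar>x\<bar> \<le> 1" for x :: real using that by (simp add: abs_square_le_1)
  have "T\<^sup>2 \<le> ?n * (\<Sum>u\<in>V. (\<Sum>v\<in>V. f u v * a u * b v)\<^sup>2)" unfolding T_def by (rule sum_square_le[OF fin])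
  also have "\<dots> \<le> ?n * X" unfolding X_def
  proof (intro mult_left_mono sum_mono)
    fix u assume u: "u \<in> V"
    have "(\<Sum>v\<in>V. f u v * a u * b v) = a u * (\<Sum>v\<in>V. f u v * b v)" by (simp add: sum_distrib_left mult_ac)
    then have "(\<Sum>v\<in>V. f u v * a u * b v)\<^sup>2 = (a u)\<^sup>2 * (\<Sum>v\<in>V. f u v * b v)\<^sup>2" by (simp add: power_mult_distrib)
    also have "\<dots> \<le> 1 * (\<Sum>v\<in>V. f u v * b v)\<^sup>2" using a u by (intro mult_right_mono sq1) auto
    finally show "(\<Sum>v\<in>V. f u v * a u * b v)\<^sup>2 \<le> (\<Sum>v\<in>V. f u v * b v)\<^sup>2" by simp
  qed simp
  finally have T: "T\<^sup>2 \<le> ?n * X" .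
  have X0: "X \<ge> 0" unfolding X_def by (intro sum_nonneg) auto
  \<comment> \<open>Codegrees: expanding the square in \<open>X\<close> gives a form in b y * b y'
    with coefficients \<open>g\<close>, and the squares of these coefficients sum to the 4-cycle
    sum.\<close>
  define g where "g = (\<lambda>y y'. \<Sum>x\<in>V. f x y * f x y')"
  have "X = (\<Sum>x\<in>V. \<Sum>y\<in>V. \<Sum>y'\<in>V. (f x y * f x y') * (b y * b y'))"
    unfolding X_def power2_eq_square sum_product by (intro sum.cong refl) (simp add: mult_ac)
  also have "\<dots> = (\<Sum>y\<in>V. \<Sum>x\<in>V. \<Sum>y'\<in>V. (f x y * f x y') * (b y * b y'))" by (rule sum.swap)
  also have "\<dots> = (\<Sum>y\<in>V. \<Sum>y'\<in>V. \<Sum>x\<in>V. (f x y * f x y') * (b y * b y'))" by (intro sum.cong refl sum.swap)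
  also have "\<dots> = (\<Sum>(y, y')\<in>V \<times> V. g y y' * (b y * b y'))"
    unfolding g_def sum_distrib_right by (rule sum.cartesian_product)
  finally have X: "X = (\<Sum>(y, y')\<in>V \<times> V. g y y' * (b y * b y'))" .
  have "X\<^sup>2 \<le> real (card (V \<times> V)) * (\<Sum>(y, y')\<in>V \<times> V. (g y y' * (b y * b y'))\<^sup>2)"
    unfolding X using sum_square_le[of "V \<times> V" "\<lambda>(y, y'). g y y' * (b y * b y')"] fin by (simp add: case_prod_unfold)
  also have "\<dots> \<le> ?n\<^sup>2 * (\<Sum>(y, y')\<in>V \<times> V. (g y y')\<^sup>2)"
  proof -
    have "(g y y' * (b y * b y'))\<^sup>2 \<le> (g y y')\<^sup>2" if "y \<in> V" "y' \<in> V" for y y'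
    proof -
      have "\<bar>b y * b y'\<bar> \<le> 1" using b that by (simp add: abs_mult mult_le_one)
      then show ?thesis using mult_left_mono[OF sq1, of "b y * b y'" "(g y y')\<^sup>2"] by (simp add: power_mult_distrib)
    qed
    then have "(\<Sum>(y, y')\<in>V \<times> V. (g y y' * (b y * b y'))\<^sup>2) \<le> (\<Sum>(y, y')\<in>V \<times> V. (g y y')\<^sup>2)"
      by (intro sum_mono) auto
    then show ?thesis by (simp add: power2_eq_square card_cartesian_product mult_left_mono)
  qed
  also have "(\<Sum>(y, y')\<in>V \<times> V. (g y y')\<^sup>2) = (\<Sum>xs\<in>tup V 4. c4 f xs)"
  proof -
    have "(\<Sum>(y, y')\<in>V \<times> V. (g y y')\<^sup>2) = (\<Sum>y\<in>V. \<Sum>y'\<in>V. \<Sum>x\<in>V. \<Sum>x'\<in>V. f x y * f x y' * f x' y * f x' y')"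
      unfolding sum.cartesian_product[symmetric]
      by (intro sum.cong refl) (simp only: g_def power2_eq_square sum_product mult_ac)
    also have "\<dots> = (\<Sum>x\<in>V. \<Sum>x'\<in>V. \<Sum>y\<in>V. \<Sum>y'\<in>V. f x y * f x y' * f x' y * f x' y')"
      by (rule sum_swap_pairs)
    finally show ?thesis unfolding sum_c4 .
  qed
  also have "(\<Sum>xs\<in>tup V 4. c4 f xs) \<le> ?n ^ 4 * \<rho> ^ 4"
  proof (cases "V = {}")
    case True
    then have "tup V 4 = {}" by (auto simp: tup_def)
    then show ?thesis using True by simp
  next
    case False
    then have "?n > 0" using fin by (simp add: card_gt_0_iff)
    then have "?n ^ 4 > 0" by simp
    then show ?thesis using c[unfolded avg_def] fin unfolding card_tup[OF fin] of_nat_power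
      by (subst (asm) pos_divide_le_eq) (simp_all add: mult.commute)
  qed
  finally have X2: "X\<^sup>2 \<le> ?n\<^sup>2 * (?n ^ 4 * \<rho> ^ 4)" by (simp add: mult_left_mono)
  have "T ^ 4 = (T\<^sup>2)\<^sup>2" by simp
  also have "\<dots> \<le> (?n * X)\<^sup>2" using T by (intro power_mono) auto
  also have "\<dots> \<le> ?n\<^sup>2 * (?n\<^sup>2 * (?n ^ 4 * \<rho> ^ 4))"
    unfolding power_mult_distrib by (intro mult_left_mono X2) auto
  also have "\<dots> = (\<rho> * ?n\<^sup>2) ^ 4" by (simp add: power_mult_distrib power_mult[symmetric] power_add[symmetric] mult_ac)
  finally have "\<bar>T\<bar> ^ 4 \<le> (\<rho> * ?n\<^sup>2) ^ 4" by simp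
  then have "\<bar>T\<bar> \<le> \<rho> * ?n\<^sup>2" using \<rho> by (meson power_mono_iff abs_ge_zero zero_le_mult_iff zero_le_power2 zero_less_numeral)
  then show "\<bar>\<Sum>u\<in>V. \<Sum>v\<in>V. f u v * a u * b v\<bar> \<le> \<rho> * ?n\<^sup>2" by (simp add: T_def)
qed

section \<open>Pattern densities\<close>

lemma avg_sum: "avg X (\<lambda>x. \<Sum>i\<in>I. f i x) = (\<Sum>i\<in>I. avg X (f i))"
  unfolding avg_def sum_divide_distrib[symmetric] by (subst sum.swap) (rule refl)

text \<open>If W(., u, v) is a distribution on colours for each pair, this is the probability that
  independent colours on the pairs of entries form a pattern in \<open>A\<close>. On injective
  tuples it is affine in the distribution of each node pair.\<close>

definition kern :: "nat \<Rightarrow> (nat \<times> nat \<Rightarrow> 'c) set \<Rightarrow> ('c \<Rightarrow> 'a \<Rightarrow> 'a \<Rightarrow> real) \<Rightarrow> 'a list \<Rightarrow> real" where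
  "kern q A W xs = (\<Sum>M\<in>A. \<Prod>e\<in>idx q. W (M e) (xs ! fst e) (xs ! snd e))"

lemma idx_nth: "xs \<in> tup V q \<Longrightarrow> e \<in> idx q \<Longrightarrow> xs ! fst e \<in> V \<and> xs ! snd e \<in> V"
  by (auto simp: tup_def idx_def)

lemma kern_counting:
  assumes fin: "finite V" and ne: "V \<noteq> {}" and A: "A \<subseteq> PiE (idx q) (\<lambda>_. C)"
    and c: "\<And>c. c \<in> C \<Longrightarrow> cutb V (\<lambda>u v. W c u v - W' c u v) \<delta>"
    and W: "\<And>c u v. c \<in> C \<Longrightarrow> u \<in> V \<Longrightarrow> v \<in> V \<Longrightarrow> 0 \<le> W c u v \<and> W c u v \<le> 1"
    and W': "\<And>c u v. c \<in> C \<Longrightarrow> u \<in> V \<Longrightarrow> v \<in> V \<Longrightarrow> 0 \<le> W' c u v \<and> W' c u v \<le> 1"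
  shows "\<bar>avg (tup V q) (kern q A W) - avg (tup V q) (kern q A W')\<bar> \<le> real (card A) * (real (card (idx q)) * \<delta>)"
proof -
  let ?p = "\<lambda>W M xs. \<Prod>e\<in>idx q. W (M e) (xs ! fst e) (xs ! snd e)"
  have "avg (tup V q) (kern q A W) - avg (tup V q) (kern q A W') = (\<Sum>M\<in>A. avg (tup V q) (?p W M) - avg (tup V q) (?p W' M))"
    unfolding kern_def avg_sum by (simp add: sum_subtractf)
  also have "\<bar>\<dots>\<bar> \<le> (\<Sum>M\<in>A. real (card (idx q)) * \<delta>)"
  proof (rule order.trans[OF sum_abs sum_mono])
    fix M assume "M \<in> A"
    then have M: "M e \<in> C" if "e \<in> idx q" for e using A that by auto
    show "\<bar>avg (tup V q) (?p W M) - avg (tup V q) (?p W' M)\<bar> \<le> real (card (idx q)) * \<delta>"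
      by (rule product_counting[OF fin ne order.refl, of q "\<lambda>e. W (M e)" "\<lambda>e. W' (M e)"])
         (use c W W' M in auto)
  qed
  finally show ?thesis by simp
qed

lemma sum_prod_PiE:
  fixes f :: "'e \<Rightarrow> 'c \<Rightarrow> real"
  assumes "finite E" "finite C"
  shows "(\<Sum>M\<in>PiE E (\<lambda>_. C). \<Prod>e\<in>E. f e (M e)) = (\<Prod>e\<in>E. \<Sum>c\<in>C. f e c)"
  using assms by (simp add: prod_sum_PiE)

text \<open>Summed over all patterns, the products factor into a product of total masses, each at
  most 1.\<close>

lemma kern_bounds:
  assumes A: "A \<subseteq> PiE (idx q) (\<lambda>_. C)" and C: "finite C" and xs: "xs \<in> tup V q"
    and W: "\<And>c u v. c \<in> C \<Longrightarrow> u \<in> V \<Longrightarrow> v \<in> V \<Longrightarrow> 0 \<le> W c u v"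
    and W1: "\<And>u v. u \<in> V \<Longrightarrow> v \<in> V \<Longrightarrow> (\<Sum>c\<in>C. W c u v) \<le> 1"
  shows "0 \<le> kern q A W xs \<and> kern q A W xs \<le> 1"
proof
  have pos: "0 \<le> (\<Prod>e\<in>idx q. W (M e) (xs ! fst e) (xs ! snd e))" if "M \<in> PiE (idx q) (\<lambda>_. C)" for M
    using that idx_nth[OF xs] by (intro prod_nonneg ballI W) auto
  then show "0 \<le> kern q A W xs" unfolding kern_def using A by (intro sum_nonneg) auto
  have "kern q A W xs \<le> (\<Sum>M\<in>PiE (idx q) (\<lambda>_. C). \<Prod>e\<in>idx q. W (M e) (xs ! fst e) (xs ! snd e))"
    unfolding kern_def using pos A C by (intro sum_mono2 finite_PiE) auto
  also have "\<dots> = (\<Prod>e\<in>idx q. \<Sum>c\<in>C. W c (xs ! fst e) (xs ! snd e))"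
    by (rule sum_prod_PiE) (use C in auto)
  also have "\<dots> \<le> 1"
    using idx_nth[OF xs] W W1 by (intro prod_le_1) (auto intro: sum_nonneg)
  finally show "kern q A W xs \<le> 1" .
qed

lemma kern_mono:
  assumes A: "A \<subseteq> PiE (idx q) (\<lambda>_. C)" and xs: "xs \<in> itup V q"
    and W: "\<And>c u v. c \<in> C \<Longrightarrow> u \<in> V \<Longrightarrow> v \<in> V \<Longrightarrow> u \<noteq> v \<Longrightarrow> 0 \<le> W c u v \<and> W c u v \<le> W' c u v"
  shows "kern q A W xs \<le> kern q A W' xs"
  unfolding kern_def
proof (intro sum_mono prod_mono)
  fix M e assume M: "M \<in> A" and e: "e \<in> idx q"
  have "xs ! fst e \<noteq> xs ! snd e"
    using xs e by (auto simp: itup_def tup_def idx_def nth_eq_iff_index_eq)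
  then show "0 \<le> W (M e) (xs ! fst e) (xs ! snd e) \<and> W (M e) (xs ! fst e) (xs ! snd e) \<le> W' (M e) (xs ! fst e) (xs ! snd e)"
    using A M e xs idx_nth[of xs V q e] by (intro W) (auto simp: itup_def)
qed

section \<open>Comparing cell structures\<close>

text \<open>As \<Psi> is nonnegative, only cells more frequent in \<open>S\<close> than in
  \<open>V\<close> cost anything. The one-sided discrepancy suits \<open>transfer_labels\<close>,
  which rounds quotas down.\<close>

lemma avg_cells_le:
  assumes S: "finite S" "cS ` S \<subseteq> C" and V: "finite V" "cV ` V \<subseteq> C" and C: "finite C"
    and \<theta>: "(\<Sum>c\<in>C. max 0 (real (card {x\<in>S. cS x = c}) / real (card S) - real (card {x\<in>V. cV x = c}) / real (card V))) \<le> \<theta>"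
    and \<Psi>: "\<And>c. c \<in> C \<Longrightarrow> 0 \<le> \<Psi> c \<and> \<Psi> c \<le> 1"
  shows "avg S (\<lambda>x. \<Psi> (cS x)) \<le> avg V (\<lambda>x. \<Psi> (cV x)) + \<theta>"
proof -
  have *: "avg X (\<lambda>x. \<Psi> (k x)) = (\<Sum>c\<in>C. real (card {x\<in>X. k x = c}) / real (card X) * \<Psi> c)"
    if "finite X" "k ` X \<subseteq> C" for X :: "'z set" and k
  proof -
    have "(\<Sum>x\<in>X. \<Psi> (k x)) = (\<Sum>c\<in>C. \<Sum>x\<in>{x\<in>X. k x = c}. \<Psi> (k x))"
      by (rule sum.group[symmetric, OF that(1) C that(2)])
    also have "\<dots> = (\<Sum>c\<in>C. real (card {x\<in>X. k x = c}) * \<Psi> c)"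
      by (intro sum.cong refl) simp
    finally show ?thesis by (simp add: avg_def sum_divide_distrib)
  qed
  let ?s = "\<lambda>c. real (card {x\<in>S. cS x = c}) / real (card S)" and ?v = "\<lambda>c. real (card {x\<in>V. cV x = c}) / real (card V)"
  have "(\<Sum>c\<in>C. ?s c * \<Psi> c) \<le> (\<Sum>c\<in>C. ?v c * \<Psi> c + max 0 (?s c - ?v c))"
  proof (rule sum_mono)
    fix c assume c: "c \<in> C"
    have "(?s c - ?v c) * \<Psi> c \<le> max 0 (?s c - ?v c) * \<Psi> c" using \<Psi>[OF c] by (intro mult_right_mono) auto
    also have "\<dots> \<le> max 0 (?s c - ?v c)" using \<Psi>[OF c] by (intro mult_right_le_one_le) auto
    finally show "?s c * \<Psi> c \<le> ?v c * \<Psi> c + max 0 (?s c - ?v c)" by (simp add: left_diff_distrib)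
  qed
  then show ?thesis using \<theta> unfolding *[OF S] *[OF V] sum.distrib by linarith
qed

text \<open>One coordinate is exchanged at a time: the tail by induction with the head kept in
  \<open>S\<close>, then the head, for which the average over tails in \<open>V\<close> is a
  [0,1]-valued function of its cell.\<close>

lemma avg_tup_cells_le:
  assumes S: "finite S" "S \<noteq> {}" "cS ` S \<subseteq> C" and V: "finite V" "V \<noteq> {}" "cV ` V \<subseteq> C" and C: "finite C"
    and \<theta>: "(\<Sum>c\<in>C. max 0 (real (card {x\<in>S. cS x = c}) / real (card S) - real (card {x\<in>V. cV x = c}) / real (card V))) \<le> \<theta>"
    and \<Phi>: "\<And>cs. cs \<in> tup C q \<Longrightarrow> 0 \<le> \<Phi> cs \<and> \<Phi> cs \<le> 1"
  shows "avg (tup S q) (\<lambda>xs. \<Phi> (map cS xs)) \<le> avg (tup V q) (\<lambda>xs. \<Phi> (map cV xs)) + real q * \<theta>"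
  using \<Phi>
proof (induction q arbitrary: \<Phi>)
  case 0
  then show ?case by (simp add: tup_0 avg_def)
next
  case (Suc q)
  have bd: "0 \<le> \<Phi> (c # cs) \<and> \<Phi> (c # cs) \<le> 1" if "c \<in> C" "cs \<in> tup C q" for c cs
    using that by (intro Suc.prems) (auto simp: tup_def)
  have mp: "map cV xs \<in> tup C q" if "xs \<in> tup V q" for xs using that V by (auto simp: tup_def)
  have "avg (tup S (Suc q)) (\<lambda>xs. \<Phi> (map cS xs)) = avg S (\<lambda>x. avg (tup S q) (\<lambda>xs. \<Phi> (cS x # map cS xs)))"
    using S by (simp add: avg_tup_Suc)
  also have "\<dots> \<le> avg S (\<lambda>x. avg (tup V q) (\<lambda>xs. \<Phi> (cS x # map cV xs)) + real q * \<theta>)"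
    using S bd by (intro avg_mono Suc.IH) auto
  also have "\<dots> = avg S (\<lambda>x. avg (tup V q) (\<lambda>xs. \<Phi> (cS x # map cV xs))) + real q * \<theta>"
    using S by (simp add: avg_add avg_const)
  also have "avg S (\<lambda>x. avg (tup V q) (\<lambda>xs. \<Phi> (cS x # map cV xs))) 
    \<le> avg V (\<lambda>x. avg (tup V q) (\<lambda>xs. \<Phi> (cV x # map cV xs))) + \<theta>"
  proof (rule avg_cells_le[OF S(1,3) V(1,3) C \<theta>])
    fix c assume c: "c \<in> C"
    show "0 \<le> avg (tup V q) (\<lambda>xs. \<Phi> (c # map cV xs)) \<and> avg (tup V q) (\<lambda>xs. \<Phi> (c # map cV xs)) \<le> 1"
      using bd[OF c mp] avg_nonneg[of "tup V q" "\<lambda>xs. \<Phi> (c # map cV xs)"] 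
        avg_abs_le[of "tup V q" "\<lambda>xs. \<Phi> (c # map cV xs)" 1] by (auto simp: abs_le_iff)
  qed
  finally show ?case using V by (simp add: avg_tup_Suc algebra_simps)
qed

text \<open>Disjoint sets of the required sizes are removed from \<open>B\<close> one after another.
  Only lower bounds are claimed, so leftover points may carry any label.\<close>

lemma ex_labelling:
  fixes m :: "nat \<Rightarrow> nat"
  assumes "finite B" "(\<Sum>i<t. m i) \<le> card B"
  shows "\<exists>lab. \<forall>i<t. m i \<le> card {y \<in> B. lab y = i}"
  using assms
proof (induction t arbitrary: B)
  case 0
  then show ?case by simp
next
  case (Suc t)
  have "m t \<le> card B" using Suc.prems by simp
  then obtain D where D: "D \<subseteq> B" "card D = m t" by (rule obtain_subset_with_card_n)
  have "(\<Sum>i<t. m i) \<le> card (B - D)" "finite (B - D)"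
    using Suc.prems D finite_subset[OF D(1)] by (auto simp: card_Diff_subset)
  then obtain lab where lab: "\<forall>i<t. m i \<le> card {y \<in> B - D. lab y = i}" using Suc.IH by blast
  let ?lab = "\<lambda>y. if y \<in> D then t else lab y"
  have "m i \<le> card {y \<in> B. ?lab y = i}" if "i < Suc t" for i
  proof (cases "i = t")
    case True
    have "card D \<le> card {y \<in> B. ?lab y = t}" using D Suc.prems by (intro card_mono) auto
    then show ?thesis using D True by simp
  next
    case False
    then have "m i \<le> card {y \<in> B - D. lab y = i}" using lab that by auto
    also have "\<dots> \<le> card {y \<in> B. ?lab y = i}" using Suc.prems by (intro card_mono) auto
    finally show ?thesis .
  qed
  then show ?case by (intro exI[of _ ?lab]) simp
qed

lemma ex_labelling_lt:
  fixes m :: "nat \<Rightarrow> nat"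
  assumes "finite B" "(\<Sum>i<t. m i) \<le> card B" "t > 0"
  shows "\<exists>lab. (\<forall>y. lab y < t) \<and> (\<forall>i<t. m i \<le> card {y \<in> B. lab y = i})"
proof -
  obtain lab where lab: "\<forall>i<t. m i \<le> card {y \<in> B. lab y = i}" using ex_labelling[OF assms(1,2)] by blast
  let ?lab = "\<lambda>y. if lab y < t then lab y else 0"
  have "m i \<le> card {y \<in> B. ?lab y = i}" if "i < t" for i
  proof -
    have "card {y \<in> B. lab y = i} \<le> card {y \<in> B. ?lab y = i}" using assms(1) that by (intro card_mono) auto
    then show ?thesis using lab that by fastforce
  qed
  then show ?thesis using assms(3) by (intro exI[of _ ?lab]) auto
qed

text \<open>Within each type the labels are given out on \<open>V\<close> in the proportions they
  have on \<open>S\<close>. Differing type frequencies cost \<kappa> in total, and rounding costs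
  1/card V for each of the K t cells.\<close>

lemma transfer_labels:
  fixes ty :: "'a \<Rightarrow> nat" and l :: "'a \<Rightarrow> nat"
  assumes V: "finite V" "V \<noteq> {}" and S: "finite S" "S \<noteq> {}"
    and l: "\<And>x. x \<in> S \<Longrightarrow> l x < t" and t: "t > 0"
    and \<kappa>: "(\<Sum>a<K. \<bar>real (card {x\<in>S. ty x = a}) / real (card S) - real (card {x\<in>V. ty x = a}) / real (card V)\<bar>) \<le> \<kappa>"
  shows "\<exists>l'. (\<forall>y. l' y < t) \<and> 
    (\<Sum>c\<in>{..<K} \<times> {..<t}. max 0 (real (card {x\<in>S. (ty x, l x) = c}) / real (card S) - real (card {x\<in>V. (ty x, l' x) = c}) / real (card V))) 
      \<le> \<kappa> + real (K * t) / real (card V)"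
proof -
  let ?r = "real (card S)" and ?n = "real (card V)"
  have r: "?r > 0" and n: "?n > 0" using V S by (auto simp: card_gt_0_iff)
  define x where "x = (\<lambda>a i. card {y\<in>S. (ty y, l y) = (a, i)})"
  define s where "s = (\<lambda>a. card {y\<in>S. ty y = a})"
  define N where "N = (\<lambda>a. card {y\<in>V. ty y = a})"
  have sx: "(\<Sum>i<t. x a i) = s a" for a
  proof -
    have "(\<Sum>i<t. \<Sum>y\<in>{y\<in>{y\<in>S. ty y = a}. l y = i}. 1) = (\<Sum>y\<in>{y\<in>S. ty y = a}. (1::nat))"
      using S l by (intro sum.group) auto
    then show ?thesis by (simp add: x_def s_def conj_assoc)
  qed
  \<comment> \<open>Quota of label \<open>i\<close> in type \<open>a\<close>, rounded down so that
    the quotas of one type fit into it. For a type missing in \<open>S\<close> the quotas are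
    0.\<close>
  define m where "m = (\<lambda>a i. (x a i * N a) div s a)"
  have "(\<Sum>i<t. m a i) \<le> N a" for a
  proof (cases "s a = 0")
    case True
    then show ?thesis by (simp add: m_def)
  next
    case False
    have "(\<Sum>i<t. m a i) * s a \<le> (\<Sum>i<t. x a i * N a)"
      unfolding sum_distrib_right by (intro sum_mono) (simp add: m_def)
    also have "\<dots> = N a * s a" by (simp add: sx flip: sum_distrib_right)
    finally show ?thesis using False by simp
  qed
  then have "\<forall>a. \<exists>lab. (\<forall>y. lab y < t) \<and> (\<forall>i<t. m a i \<le> card {y \<in> {y\<in>V. ty y = a}. lab y = i})"
    using V t by (intro allI ex_labelling_lt) (auto simp: N_def)
  from choice[OF this] obtain lab where "\<forall>a. (\<forall>y. lab a y < t) \<and> (\<forall>i<t. m a i \<le> card {y \<in> {y\<in>V. ty y = a}. lab a y = i})"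
    by (elim exE)
  then have lab: "\<And>a y. lab a y < t" "\<And>a i. i < t \<Longrightarrow> m a i \<le> card {y \<in> {y\<in>V. ty y = a}. lab a y = i}"
    by blast+
  define l' where "l' = (\<lambda>y. lab (ty y) y)"
  define z where "z = (\<lambda>a i. card {y\<in>V. (ty y, l' y) = (a, i)})"
  have z: "m a i \<le> z a i" if "i < t" for a i
  proof -
    have "{y \<in> {y\<in>V. ty y = a}. lab a y = i} = {y\<in>V. (ty y, l' y) = (a, i)}" by (auto simp: l'_def)
    then show ?thesis using lab(2)[OF that, of a] by (simp add: z_def)
  qed
  \<comment> \<open>The discrepancy of a type is shared among its labels with weights x a i / s a,
    which add up to at most 1; the last term is the rounding loss.\<close>
  have step: "max 0 (real (x a i) / ?r - real (z a i) / ?n) \<le> real (x a i) / real (s a) * \<bar>real (s a) / ?r - real (N a) / ?n\<bar> + 1 / ?n"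
    if i: "i < t" for a i
  proof (cases "s a = 0")
    case True
    then have "x a i = 0" using sx[of a] i by simp
    then show ?thesis using n by simp
  next
    case False
    have "real (x a i * N a) / real (s a) \<le> real (m a i) + 1"
    proof -
      have "x a i * N a \<le> (m a i + 1) * s a"
        using dividend_less_div_times[of "s a" "x a i * N a"] False by (simp add: m_def)
      then have "real (x a i * N a) \<le> real ((m a i + 1) * s a)" by (rule of_nat_mono)
      moreover have "real (s a) > 0" using False by simp
      ultimately show ?thesis by (subst pos_divide_le_eq) (simp_all add: distrib_right)
    qed
    also have "\<dots> \<le> real (z a i) + 1" using z[OF i, of a] by simp
    finally have "real (x a i * N a) / real (s a) / ?n \<le> (real (z a i) + 1) / ?n"
      by (rule divide_right_mono) simp
    then have le: "real (x a i * N a) / real (s a) / ?n \<le> real (z a i) / ?n + 1 / ?n"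
      unfolding add_divide_distrib .
    have "real (x a i) / ?r - real (x a i * N a) / real (s a) / ?n = real (x a i) / real (s a) * (real (s a) / ?r - real (N a) / ?n)"
      using False by (simp add: right_diff_distrib)
    also have "\<dots> \<le> real (x a i) / real (s a) * \<bar>real (s a) / ?r - real (N a) / ?n\<bar>"
      by (intro mult_left_mono) auto
    finally have "real (x a i) / ?r - real (z a i) / ?n \<le> real (x a i) / real (s a) * \<bar>real (s a) / ?r - real (N a) / ?n\<bar> + 1 / ?n"
      using le by linarith
    then show ?thesis using n by simp
  qed
  have "(\<Sum>c\<in>{..<K} \<times> {..<t}. max 0 (real (card {x\<in>S. (ty x, l x) = c}) / ?r - real (card {x\<in>V. (ty x, l' x) = c}) / ?n))
     = (\<Sum>a<K. \<Sum>i<t. max 0 (real (x a i) / ?r - real (z a i) / ?n))"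
    unfolding x_def z_def by (simp only: sum.cartesian_product case_prod_unfold prod.collapse)
  also have "\<dots> \<le> (\<Sum>a<K. \<Sum>i<t. real (x a i) / real (s a) * \<bar>real (s a) / ?r - real (N a) / ?n\<bar> + 1 / ?n)"
    by (intro sum_mono step) auto
  also have "\<dots> = (\<Sum>a<K. real (\<Sum>i<t. x a i) / real (s a) * \<bar>real (s a) / ?r - real (N a) / ?n\<bar> + real t / ?n)"
    by (simp add: sum.distrib sum_distrib_right sum_divide_distrib)
  also have "\<dots> \<le> (\<Sum>a<K. \<bar>real (s a) / ?r - real (N a) / ?n\<bar> + real t / ?n)"
    unfolding sx by (intro sum_mono add_right_mono) (auto simp: mult_left_le_one_le)
  also have "\<dots> = (\<Sum>a<K. \<bar>real (s a) / ?r - real (N a) / ?n\<bar>) + real (K * t) / ?n"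
    by (simp add: sum.distrib)
  also have "\<dots> \<le> \<kappa> + real (K * t) / ?n" using \<kappa> by (simp add: s_def N_def)
  finally show ?thesis using lab(1) by (intro exI[of _ l']) (auto simp: l'_def)
qed

section \<open>Derandomization\<close>

text \<open>A colour here is the pair of colours of both orientations. The swap condition lets (u,
  v) and (v, u) describe a single random choice for the unordered pair.\<close>

definition valid_dist :: "'a set \<Rightarrow> (nat \<times> nat) set \<Rightarrow> (nat \<times> nat \<Rightarrow> 'a \<Rightarrow> 'a \<Rightarrow> real) \<Rightarrow> bool" where
  "valid_dist V C W \<longleftrightarrow> (\<forall>u\<in>V. \<forall>v\<in>V. u \<noteq> v \<longrightarrow> (\<forall>c\<in>C. 0 \<le> W c u v \<and> W (prod.swap c) v u = W c u v) \<and> (\<Sum>c\<in>C. W c u v) = 1)"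

definition fix_pair :: "'a \<Rightarrow> 'a \<Rightarrow> nat \<times> nat \<Rightarrow> (nat \<times> nat \<Rightarrow> 'a \<Rightarrow> 'a \<Rightarrow> real) \<Rightarrow> nat \<times> nat \<Rightarrow> 'a \<Rightarrow> 'a \<Rightarrow> real" where
  "fix_pair a b d W c u v = (if u = a \<and> v = b then of_bool (c = d) else if u = b \<and> v = a then of_bool (c = prod.swap d) else W c u v)"

lemma fix_pair_other:
  "\<not> ((u = a \<and> v = b) \<or> (u = b \<and> v = a)) \<Longrightarrow> fix_pair a b d W c u v = W c u v"
  unfolding fix_pair_def by presburger

lemma sum_mult_delta:
  fixes f :: "'c \<Rightarrow> real"
  assumes "finite C" "x \<in> C"
  shows "(\<Sum>d\<in>C. f d * of_bool (x = d)) = f x"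
proof -
  have "(\<Sum>d\<in>C. f d * of_bool (x = d)) = (\<Sum>d\<in>C. if x = d then f d else 0)"
    by (rule sum.cong) simp_all
  then show ?thesis using assms by simp
qed

text \<open>Law of total expectation over the colour of the pair a, b. In an injective tuple this
  pair occupies at most one position pair, so a single factor of each product depends on its
  distribution.\<close>

lemma kern_fix_pair:
  assumes C: "finite C" "prod.swap ` C \<subseteq> C" and A: "A \<subseteq> PiE (idx q) (\<lambda>_. C)"
    and W: "valid_dist V C W" and ab: "a \<in> V" "b \<in> V" "a \<noteq> b" and xs: "xs \<in> itup V q"
  shows "kern q A W xs = (\<Sum>d\<in>C. W d a b * kern q A (fix_pair a b d W) xs)"
proof -
  let ?p = "\<lambda>W M. \<Prod>e\<in>idx q. W (M e) (xs ! fst e) (xs ! snd e)"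
  let ?ab = "\<lambda>e. (xs ! fst e = a \<and> xs ! snd e = b) \<or> (xs ! fst e = b \<and> xs ! snd e = a)"
  have dist: "distinct xs" "length xs = q" using xs unfolding itup_def tup_def by blast+
  have one: "(\<Sum>d\<in>C. W d a b) = 1" using W ab by (simp add: valid_dist_def)
  have "?p W M = (\<Sum>d\<in>C. W d a b * ?p (fix_pair a b d W) M)" if M: "M \<in> A" for M
  proof (cases "\<exists>e\<in>idx q. ?ab e")
    case False
    then have "?p (fix_pair a b d W) M = ?p W M" for d
      by (intro prod.cong[OF refl]) (rule fix_pair_other, blast)
    then show ?thesis using one by (simp flip: sum_distrib_right)
  next
    case True
    then obtain e0 where e0: "e0 \<in> idx q" "?ab e0" by (elim bexE)
    have uniq: "\<not> ?ab e" if e: "e \<in> idx q - {e0}" for e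
    proof
      assume "?ab e"
      then have "(xs ! fst e = xs ! fst e0 \<and> xs ! snd e = xs ! snd e0) \<or> (xs ! fst e = xs ! snd e0 \<and> xs ! snd e = xs ! fst e0)"
        using e0(2) by auto
      then have "(fst e = fst e0 \<and> snd e = snd e0) \<or> (fst e = snd e0 \<and> snd e = fst e0)"
        using e e0(1) dist by (auto simp: idx_def nth_eq_iff_index_eq)
      then show False using e e0(1) by (auto simp: idx_def prod_eq_iff)
    qed
    let ?R = "\<Prod>e\<in>idx q - {e0}. W (M e) (xs ! fst e) (xs ! snd e)"
    have rest: "(\<Prod>e\<in>idx q - {e0}. fix_pair a b d W (M e) (xs ! fst e) (xs ! snd e)) = ?R" for d
      by (intro prod.cong[OF refl]) (rule fix_pair_other, rule uniq)
    have Mc: "M e0 \<in> C" "prod.swap (M e0) \<in> C" using M A e0 C by auto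
    have "W (M e0) (xs ! fst e0) (xs ! snd e0) = (\<Sum>d\<in>C. W d a b * fix_pair a b d W (M e0) (xs ! fst e0) (xs ! snd e0))"
    proof (cases "xs ! fst e0 = a \<and> xs ! snd e0 = b")
      case True
      then have fp: "fix_pair a b d W (M e0) (xs ! fst e0) (xs ! snd e0) = of_bool (M e0 = d)" for d
        by (simp add: fix_pair_def)
      show ?thesis unfolding fp sum_mult_delta[OF C(1) Mc(1), of "\<lambda>d. W d a b"] using True by simp
    next
      case False
      \<comment> \<open>The tuple lists the pair in reverse order, so the colour of the pattern is
        compared after swapping.\<close>
      then have ba: "xs ! fst e0 = b" "xs ! snd e0 = a" using e0(2) by blast+
      have "(M e0 = prod.swap d) = (prod.swap (M e0) = d)" for d by (auto simp: prod_eq_iff)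
      then have fp: "fix_pair a b d W (M e0) (xs ! fst e0) (xs ! snd e0) = of_bool (prod.swap (M e0) = d)" for d
        using ba ab by (simp add: fix_pair_def)
      have "W (prod.swap (M e0)) a b = W (M e0) b a"
      proof -
        have "W (prod.swap (M e0)) a b = W (prod.swap (prod.swap (M e0))) b a" 
          using W ab Mc(2) unfolding valid_dist_def by metis
        then show ?thesis by simp
      qed
      then show ?thesis unfolding fp sum_mult_delta[OF C(1) Mc(2), of "\<lambda>d. W d a b"] using ba by simp
    qed
    then show ?thesis
      by (simp add: prod.remove[OF finite_idx e0(1)] rest sum_distrib_right mult.assoc)
  qed
  then have "kern q A W xs = (\<Sum>M\<in>A. \<Sum>d\<in>C. W d a b * ?p (fix_pair a b d W) M)"
    unfolding kern_def by (intro sum.cong) auto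
  also have "\<dots> = (\<Sum>d\<in>C. \<Sum>M\<in>A. W d a b * ?p (fix_pair a b d W) M)" by (rule sum.swap)
  finally show ?thesis unfolding kern_def sum_distrib_left .
qed

text \<open>Some value on the support is at least the mean. Asking for positive weight keeps the
  later choice of colours inside the support, which is what preserves the shadow.\<close>

lemma weighted_avg_witness:
  fixes w t :: "'c \<Rightarrow> real"
  assumes "finite C" "\<And>d. d \<in> C \<Longrightarrow> 0 \<le> w d" "(\<Sum>d\<in>C. w d) = 1" "T = (\<Sum>d\<in>C. w d * t d)"
  shows "\<exists>d\<in>C. w d > 0 \<and> T \<le> t d"
proof (rule ccontr)
  assume "\<not> ?thesis"
  then have lt: "t d < T" if "d \<in> C" "w d > 0" for d using that by force
  obtain d0 where d0: "d0 \<in> C" "w d0 > 0"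
    using assms(2,3) by (metis less_eq_real_def sum.neutral zero_neq_one)
  have "(\<Sum>d\<in>C. w d * t d) < (\<Sum>d\<in>C. w d * T)"
  proof (rule sum_strict_mono_ex1[OF assms(1)])
    show "\<forall>d\<in>C. w d * t d \<le> w d * T"
      using lt assms(2) by (metis less_eq_real_def mult_left_mono mult_zero_left)
    show "\<exists>d\<in>C. w d * t d < w d * T" using d0 lt by (intro bexI[of _ d0]) auto
  qed
  then show False using assms(3,4) by (simp flip: sum_distrib_right)
qed

lemma valid_fix_pair:
  assumes C: "finite C" "prod.swap ` C \<subseteq> C" and W: "valid_dist V C W" and d: "d \<in> C" and ab: "a \<noteq> b"
  shows "valid_dist V C (fix_pair a b d W)"
proof -
  have sd: "prod.swap d \<in> C" using C d by auto
  have sw: "(prod.swap c = prod.swap d) = (c = d)" "(prod.swap c = d) = (c = prod.swap d)" for c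
    by (auto simp: prod_eq_iff)
  have "(\<Sum>c\<in>C. of_bool (c = x)) = (1::real)" if "x \<in> C" for x
  proof -
    have "(\<Sum>c\<in>C. of_bool (c = x)) = (\<Sum>c\<in>C. if c = x then 1 else (0::real))" by (intro sum.cong) auto
    then show ?thesis using that C by simp
  qed
  note delta = this
  show ?thesis unfolding valid_dist_def
  proof (intro ballI impI)
    fix u v assume uv: "u \<in> V" "v \<in> V" "u \<noteq> v"
    consider "u = a" "v = b" | "u = b" "v = a" | "\<not> ((u = a \<and> v = b) \<or> (u = b \<and> v = a))" "\<not> ((v = a \<and> u = b) \<or> (v = b \<and> u = a))" by blast
    then show "(\<forall>c\<in>C. 0 \<le> fix_pair a b d W c u v \<and> fix_pair a b d W (prod.swap c) v u = fix_pair a b d W c u v) \<and>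
      (\<Sum>c\<in>C. fix_pair a b d W c u v) = 1"
    proof cases
      case 1
      then show ?thesis using ab delta[OF d] by (simp add: fix_pair_def sw)
    next
      case 2
      then show ?thesis using ab delta[OF sd] by (simp add: fix_pair_def sw)
    next
      case 3
      then show ?thesis using W uv unfolding fix_pair_other[OF 3(1)] fix_pair_other[OF 3(2)] by (simp add: valid_dist_def)
    qed
  qed
qed

text \<open>Method of conditional expectations: pairs are fixed one at a time to a colour for which
  the density does not drop. Supports only shrink, so the final colours have positive weight under
  the original \<open>W\<close>.\<close>

lemma derandomize:
  assumes V: "finite V" and C: "finite C" "prod.swap ` C \<subseteq> C" and A: "A \<subseteq> PiE (idx q) (\<lambda>_. C)"
    and W: "valid_dist V C W"
  shows "\<exists>col. (\<forall>u\<in>V. \<forall>v\<in>V. u \<noteq> v \<longrightarrow> col u v \<in> C \<and> W (col u v) u v > 0 \<and> col v u = prod.swap (col u v)) \<and>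
     avg (itup V q) (kern q A W) \<le> avg (itup V q) (kern q A (\<lambda>c u v. of_bool (col u v = c)))"
proof -
  let ?t = "\<lambda>W. avg (itup V q) (kern q A W)"
  \<comment> \<open>\<open>X\<close> is the set of ordered pairs already settled; fixing (a, b) also
    settles (b, a), with the swapped colour.\<close>
  have step: "\<exists>W'. valid_dist V C W' \<and> (\<forall>u\<in>V. \<forall>v\<in>V. u \<noteq> v \<longrightarrow> (\<forall>c\<in>C. W' c u v > 0 \<longrightarrow> W c u v > 0)) \<and>
     (\<forall>(u, v)\<in>X. \<exists>c\<in>C. W' c u v = 1) \<and> ?t W \<le> ?t W'"
    if "finite X" "X \<subseteq> {(u, v) \<in> V \<times> V. u \<noteq> v}" for X
    using that
  proof (induction X rule: finite_induct)
    case empty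
    then show ?case using W by auto
  next
    case (insert p X)
    obtain a b where p: "p = (a, b)" by fastforce
    have ab: "a \<in> V" "b \<in> V" "a \<noteq> b" using insert.prems p by auto
    have "X \<subseteq> {(u, v) \<in> V \<times> V. u \<noteq> v}" using insert.prems by blast
    from insert.IH[OF this] obtain W' where W': "valid_dist V C W'"
      and supp0: "\<forall>u\<in>V. \<forall>v\<in>V. u \<noteq> v \<longrightarrow> (\<forall>c\<in>C. W' c u v > 0 \<longrightarrow> W c u v > 0)"
      and det0: "\<forall>(u, v)\<in>X. \<exists>c\<in>C. W' c u v = 1" and le: "?t W \<le> ?t W'"
      by (elim exE conjE)
    have supp: "W c u v > 0" if "u \<in> V" "v \<in> V" "u \<noteq> v" "c \<in> C" "W' c u v > 0" for u v c
      using supp0 that by blast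
    have det: "\<exists>c\<in>C. W' c u v = 1" if "(u, v) \<in> X" for u v using det0 that by blast
    have "?t W' = avg (itup V q) (\<lambda>xs. \<Sum>d\<in>C. W' d a b * kern q A (fix_pair a b d W') xs)"
      by (intro avg_cong kern_fix_pair[OF C A W' ab])
    also have "\<dots> = (\<Sum>d\<in>C. W' d a b * ?t (fix_pair a b d W'))" by (simp add: avg_sum avg_cmult)
    finally have "?t W' = (\<Sum>d\<in>C. W' d a b * ?t (fix_pair a b d W'))" .
    moreover have "0 \<le> W' d a b" if "d \<in> C" for d using W' ab that by (simp add: valid_dist_def)
    moreover have "(\<Sum>d\<in>C. W' d a b) = 1" using W' ab by (simp add: valid_dist_def)
    ultimately obtain d where d: "d \<in> C" "W' d a b > 0" "?t W' \<le> ?t (fix_pair a b d W')"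
      using weighted_avg_witness[OF C(1), of "\<lambda>d. W' d a b" "?t W'" "\<lambda>d. ?t (fix_pair a b d W')"] by blast
    have sd: "prod.swap d \<in> C" using C d by auto
    have "W' (prod.swap d) b a = W' d a b" using W' ab d by (simp add: valid_dist_def)
    then have "W d a b > 0" "W (prod.swap d) b a > 0" using supp ab d sd by auto
    then have "\<forall>u\<in>V. \<forall>v\<in>V. u \<noteq> v \<longrightarrow> (\<forall>c\<in>C. fix_pair a b d W' c u v > 0 \<longrightarrow> W c u v > 0)"
      using supp by (auto simp: fix_pair_def split: if_splits)
    moreover have "\<exists>c\<in>C. fix_pair a b d W' c u v = 1" if "(u, v) \<in> insert p X" for u v
    proof (cases "(u, v) = (a, b) \<or> (u, v) = (b, a)")
      case True
      then show ?thesis using ab d sd by (auto simp: fix_pair_def)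
    next
      case False
      then have "(u, v) \<in> X" using that p by blast
      moreover have "fix_pair a b d W' c u v = W' c u v" for c using False by (intro fix_pair_other) blast
      ultimately show ?thesis using det by simp
    qed
    ultimately show ?case using valid_fix_pair[OF C W' d(1) ab(3)] le d(3) by (intro exI[of _ "fix_pair a b d W'"]) auto
  qed
  have "finite {(u, v) \<in> V \<times> V. u \<noteq> v}" using V by (auto intro: finite_subset[of _ "V \<times> V"])
  from step[OF this order.refl] obtain W' where W': "valid_dist V C W'"
    and supp0: "\<forall>u\<in>V. \<forall>v\<in>V. u \<noteq> v \<longrightarrow> (\<forall>c\<in>C. W' c u v > 0 \<longrightarrow> W c u v > 0)"
    and det0: "\<forall>(u, v)\<in>{(u, v) \<in> V \<times> V. u \<noteq> v}. \<exists>c\<in>C. W' c u v = 1" and le: "?t W \<le> ?t W'"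
    by (elim exE conjE)
  have supp: "W c u v > 0" if "u \<in> V" "v \<in> V" "u \<noteq> v" "c \<in> C" "W' c u v > 0" for u v c
    using supp0 that by blast
  have det: "\<exists>c\<in>C. W' c u v = 1" if "u \<in> V" "v \<in> V" "u \<noteq> v" for u v using det0 that by blast
  define col where "col = (\<lambda>u v. SOME c. c \<in> C \<and> W' c u v = 1)"
  have col: "col u v \<in> C" "W' (col u v) u v = 1" if "u \<in> V" "v \<in> V" "u \<noteq> v" for u v
    using someI_ex[of "\<lambda>c. c \<in> C \<and> W' c u v = 1"] det[OF that] unfolding col_def by auto
  \<comment> \<open>One colour has weight 1 and the nonnegative weights sum to 1, so the others are
    0.\<close>
  have W'eq: "W' c u v = of_bool (col u v = c)" if uv: "u \<in> V" "v \<in> V" "u \<noteq> v" and c: "c \<in> C" for c u v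
  proof (cases "col u v = c")
    case False
    have "(\<Sum>c\<in>C. W' c u v) = W' (col u v) u v + (\<Sum>c\<in>C - {col u v}. W' c u v)"
      by (rule sum.remove[OF C(1) col(1)[OF uv]])
    then have "(\<Sum>c\<in>C - {col u v}. W' c u v) = 0" using W' uv col(2)[OF uv] by (simp add: valid_dist_def)
    then have "W' c u v = 0" using False c C W' uv
      by (subst (asm) sum_nonneg_eq_0_iff) (auto simp: valid_dist_def)
    then show ?thesis using False by simp
  qed (use col(2)[OF uv] in auto)
  have "kern q A W' xs = kern q A (\<lambda>c u v. of_bool (col u v = c)) xs" if xs: "xs \<in> itup V q" for xs
    unfolding kern_def
  proof (intro sum.cong prod.cong refl)
    fix M e assume M: "M \<in> A" and e: "e \<in> idx q"
    have "xs ! fst e \<noteq> xs ! snd e" using xs e by (auto simp: itup_def tup_def idx_def nth_eq_iff_index_eq)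
    moreover have "M e \<in> C" using M e A by auto
    ultimately show "W' (M e) (xs ! fst e) (xs ! snd e) = of_bool (col (xs ! fst e) (xs ! snd e) = M e)"
      using idx_nth[of xs V q e] xs e by (intro W'eq) (auto simp: itup_def)
  qed
  then have "?t W' = ?t (\<lambda>c u v. of_bool (col u v = c))" by (intro avg_cong)
  with le have le': "?t W \<le> ?t (\<lambda>c u v. of_bool (col u v = c))" by simp
  have "col v u = prod.swap (col u v)" if uv: "u \<in> V" "v \<in> V" "u \<noteq> v" for u v
  proof -
    have "W' (prod.swap (col u v)) v u = 1" using W' uv col[OF uv] by (simp add: valid_dist_def)
    moreover have "prod.swap (col u v) \<in> C" using C col[OF uv] by auto
    ultimately show ?thesis using W'eq[of v u "prod.swap (col u v)"] uv by (auto split: if_splits simp: of_bool_def)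
  qed
  moreover have "W (col u v) u v > 0" if uv: "u \<in> V" "v \<in> V" "u \<noteq> v" for u v
    using supp[OF uv col(1)[OF uv]] col(2)[OF uv] by simp
  ultimately have "\<forall>u\<in>V. \<forall>v\<in>V. u \<noteq> v \<longrightarrow> col u v \<in> C \<and> W (col u v) u v > 0 \<and> col v u = prod.swap (col u v)"
    using col(1) by blast
  then show ?thesis using le' by blast
qed

section \<open>Carrying a colouring from a sample to the graph\<close>

text \<open>Colours on pairs of distinct nodes are at least 1, so comparison with \<open>m\<close>
  means membership in {1..m}: such a colour pair makes an edge of the shadow.\<close>

definition ed :: "nat \<Rightarrow> nat \<times> nat \<Rightarrow> bool" where
  "ed m c \<longleftrightarrow> fst c \<le> m \<or> snd c \<le> m"

text \<open>The degree to which the adjacency given by \<open>g\<close> agrees with the colour pair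
  \<open>c\<close>. It is both the weight in the regularity lemma and the factor that later forbids
  colours with the wrong shadow.\<close>

definition wt :: "nat \<Rightarrow> ('a \<Rightarrow> 'a \<Rightarrow> real) \<Rightarrow> nat \<times> nat \<Rightarrow> 'a \<Rightarrow> 'a \<Rightarrow> real" where
  "wt m g c u v = (if ed m c then g u v else 1 - g u v)"

lemma ed_swap [simp]: "ed m (prod.swap c) = ed m c"
  by (auto simp: ed_def)

lemma sum_ed_le_1:
  fixes P :: "nat \<times> nat \<Rightarrow> real"
  assumes "finite C" "0 \<le> x" "x \<le> 1"
    and "(\<Sum>c\<in>{c\<in>C. ed m c}. P c) \<le> 1" "(\<Sum>c\<in>{c\<in>C. \<not> ed m c}. P c) \<le> 1"
  shows "(\<Sum>c\<in>C. (if ed m c then x else 1 - x) * P c) \<le> 1"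
proof -
  have "(\<Sum>c\<in>C. (if ed m c then x else 1 - x) * P c) 
      = (\<Sum>c\<in>C. x * (if ed m c then P c else 0) + (1 - x) * (if \<not> ed m c then P c else 0))"
    by (intro sum.cong) simp_all
  also have "\<dots> = x * (\<Sum>c\<in>{c\<in>C. ed m c}. P c) + (1 - x) * (\<Sum>c\<in>{c\<in>C. \<not> ed m c}. P c)"
    unfolding sum.distrib sum_distrib_left[symmetric] sum.inter_filter[OF assms(1)] ..
  also have "\<dots> \<le> x * 1 + (1 - x) * 1"
    using assms by (intro add_mono mult_left_mono) simp_all
  finally show ?thesis by simp
qed

lemma kern_map:
  assumes "length xs = q"
  shows "kern q A W (map f xs) = kern q A (\<lambda>c u v. W c (f u) (f v)) xs"
  unfolding kern_def using assms by (intro sum.cong prod.cong refl) (auto simp: idx_def)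

text \<open>Collects what is known once a good sample is fixed: \<open>l\<close> and
  \<open>reg\<close> come from regularising its colouring, \<open>ty\<close> and \<open>Ub\<close>
  from regularising the graph, and \<open>cutS\<close> and \<open>types\<close> are the two
  properties that sampling supplies.\<close>

locale recolouring =
  fixes V S :: "'a set" and g :: "'a \<Rightarrow> 'a \<Rightarrow> real" and clr :: "'a \<Rightarrow> 'a \<Rightarrow> nat \<times> nat"
    and k m q t K :: nat and A :: "(nat \<times> nat \<Rightarrow> nat \<times> nat) set" and ty l :: "'a \<Rightarrow> nat"
    and Ub :: "nat \<Rightarrow> nat \<Rightarrow> real" and \<eta> \<rho> \<kappa> :: real
  assumes V: "finite V" and SV: "S \<subseteq> V" and S_ne: "S \<noteq> {}"
    and mk: "1 \<le> m" "m \<le> k" and A: "A \<subseteq> PiE (idx q) (\<lambda>_. {1..k} \<times> {1..k})"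
    and g01: "\<And>u v. u \<in> V \<Longrightarrow> v \<in> V \<Longrightarrow> g u v = 0 \<or> g u v = 1"
    and g_sym: "\<And>u v. u \<in> V \<Longrightarrow> v \<in> V \<Longrightarrow> g v u = g u v"
    and clr: "\<And>u v. u \<in> S \<Longrightarrow> v \<in> S \<Longrightarrow> u \<noteq> v \<Longrightarrow> clr v u = prod.swap (clr u v) \<and> (ed m (clr u v) \<longleftrightarrow> g u v = 1)"
    and l: "\<And>u. u \<in> S \<Longrightarrow> l u < t" and t: "t > 0" and ty: "\<And>u. u \<in> V \<Longrightarrow> ty u < K"
    and reg: "\<And>c X Y. c \<in> {1..k} \<times> {1..k} \<Longrightarrow> X \<subseteq> S \<Longrightarrow> Y \<subseteq> S \<Longrightarrow>
       \<bar>\<Sum>u\<in>X. \<Sum>v\<in>Y. wt m g c u v * (of_bool (u \<noteq> v \<and> clr u v = c) -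
          blk_avg S l (wt m g c) (\<lambda>u v. of_bool (u \<noteq> v \<and> clr u v = c)) (l u) (l v))\<bar> \<le> \<eta> * (real (card S))\<^sup>2"
    and Ub: "\<And>i j. 0 \<le> Ub i j \<and> Ub i j \<le> 1"
    and cutS: "cutb S (\<lambda>u v. g u v - Ub (ty u) (ty v)) \<rho>"
    and cutV: "cutb V (\<lambda>u v. g u v - Ub (ty u) (ty v)) \<rho>"
    and types: "(\<Sum>a<K. \<bar>real (card {x\<in>S. ty x = a}) / real (card S) - real (card {x\<in>V. ty x = a}) / real (card V)\<bar>) \<le> \<kappa>"
begin

definition "C = {1..k} \<times> {1..k}"

definition X :: "nat \<times> nat \<Rightarrow> 'a \<Rightarrow> 'a \<Rightarrow> real" where
  "X c u v = of_bool (u \<noteq> v \<and> clr u v = c)"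

text \<open>Conditional frequency of \<open>c\<close> among the pairs of \<open>S\<close> with
  labels i, j whose adjacency fits \<open>c\<close>.\<close>

definition P :: "nat \<times> nat \<Rightarrow> nat \<Rightarrow> nat \<Rightarrow> real" where
  "P c = blk_avg S l (wt m g c) (X c)"

definition U :: "'a \<Rightarrow> 'a \<Rightarrow> real" where
  "U u v = Ub (ty u) (ty v)"

lemma finS: "finite S" and V_ne: "V \<noteq> {}" and finC: "finite C"
  using V SV S_ne finite_subset by (auto simp: C_def)

lemma AC: "A \<subseteq> PiE (idx q) (\<lambda>_. C)"
  using A by (simp add: C_def)

lemma swapC: "prod.swap ` C \<subseteq> C"
  by (auto simp: C_def)

lemma wt_g: "u \<in> V \<Longrightarrow> v \<in> V \<Longrightarrow> 0 \<le> wt m g c u v \<and> wt m g c u v \<le> 1"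
  using g01[of u v] by (auto simp: wt_def)

lemma wt_gS: "u \<in> S \<Longrightarrow> v \<in> S \<Longrightarrow> 0 \<le> wt m g c u v \<and> wt m g c u v \<le> 1"
  using wt_g SV by blast

lemma wt_U: "0 \<le> wt m U c u v \<and> wt m U c u v \<le> 1"
  using Ub[of "ty u" "ty v"] by (auto simp: wt_def U_def)

lemma X01: "0 \<le> X c u v \<and> X c u v \<le> 1"
  by (simp add: X_def)

lemma X_sum: "finite I \<Longrightarrow> (\<Sum>c\<in>I. X c u v) \<le> 1"
proof -
  assume I: "finite I"
  have "(\<Sum>c\<in>I. X c u v) \<le> (\<Sum>c\<in>I. if clr u v = c then 1 else 0)"
    by (intro sum_mono) (simp add: X_def)
  also have "\<dots> \<le> 1" using I by simp
  finally show ?thesis .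
qed

text \<open>The colouring of \<open>S\<close> has the right shadow, so the weight is 1 wherever
  \<open>X\<close> is 1. This turns X - wt * P into wt * (X - P), the form that \<open>reg\<close>
  bounds.\<close>

lemma X_wt: "u \<in> S \<Longrightarrow> v \<in> S \<Longrightarrow> X c u v = wt m g c u v * X c u v"
proof (cases "u \<noteq> v \<and> clr u v = c")
  case True
  assume "u \<in> S" "v \<in> S"
  then have "ed m c \<longleftrightarrow> g u v = 1" "g u v = 0 \<or> g u v = 1" using clr[of u v] True g01[of u v] SV by auto
  then show ?thesis by (auto simp: wt_def)
qed (simp add: X_def)

lemma P0: "0 \<le> P c i j"
  unfolding P_def using wt_gS X01 by (intro blk_avg_nonneg) auto

lemma P1: "P c i j \<le> 1"
  unfolding P_def using wt_gS X01 by (intro blk_avg_le_1) auto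

lemma P_abs: "\<bar>P c i j\<bar> \<le> 1"
  using P0[of c i j] P1[of c i j] by simp

lemma P_swap: "P (prod.swap c) j i = P c i j"
  unfolding P_def
proof (rule blk_avg_swap)
  fix u v assume uv: "u \<in> S" "v \<in> S"
  then show "wt m g (prod.swap c) v u = wt m g c u v" using g_sym[of u v] SV by (auto simp: wt_def)
  show "X (prod.swap c) v u = X c u v"
  proof (cases "u = v")
    case False
    have "clr v u = prod.swap (clr u v)" using clr uv False by blast
    then have "(clr v u = prod.swap c) = (clr u v = c)" by (auto simp: prod_eq_iff)
    then show ?thesis using False by (simp add: X_def)
  qed (simp add: X_def)
qed

text \<open>There are two separate sums because edge colours are averaged under the weight
  \<open>g\<close> and the others under 1 - g; each family is a conditional distribution, possibly
  of smaller mass.\<close>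

lemma P_sum:
  "(\<Sum>c\<in>{c\<in>C. ed m c}. P c i j) \<le> 1" "(\<Sum>c\<in>{c\<in>C. \<not> ed m c}. P c i j) \<le> 1"
proof -
  have "(\<Sum>c\<in>{c\<in>C. ed m c}. P c i j) = (\<Sum>c\<in>{c\<in>C. ed m c}. blk_avg S l g (X c) i j)"
    unfolding P_def by (intro sum.cong refl arg_cong[where f = "\<lambda>w. blk_avg S l w _ i j"]) (auto simp: wt_def fun_eq_iff)
  also have "\<dots> \<le> 1"
    using g01 SV X_sum finC by (intro blk_avg_sum_le_1) (force, simp)
  finally show "(\<Sum>c\<in>{c\<in>C. ed m c}. P c i j) \<le> 1" .
  have "(\<Sum>c\<in>{c\<in>C. \<not> ed m c}. P c i j) = (\<Sum>c\<in>{c\<in>C. \<not> ed m c}. blk_avg S l (\<lambda>u v. 1 - g u v) (X c) i j)"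
    unfolding P_def by (intro sum.cong refl arg_cong[where f = "\<lambda>w. blk_avg S l w _ i j"]) (auto simp: wt_def fun_eq_iff)
  also have "\<dots> \<le> 1"
    using g01 SV X_sum finC by (intro blk_avg_sum_le_1) (force, simp)
  finally show "(\<Sum>c\<in>{c\<in>C. \<not> ed m c}. P c i j) \<le> 1" .
qed

lemma wtP_sum:
  "0 \<le> h u v \<Longrightarrow> h u v \<le> 1 \<Longrightarrow> (\<Sum>c\<in>C. wt m h c u v * P c i j) \<le> 1"
  unfolding wt_def by (intro sum_ed_le_1 finC P_sum)

lemma wtP01:
  assumes "0 \<le> wt m h c u v \<and> wt m h c u v \<le> 1"
  shows "0 \<le> wt m h c u v * P c i j \<and> wt m h c u v * P c i j \<le> 1"
  using assms P0[of c i j] P1[of c i j] by (simp add: mult_le_one)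

abbreviation "N \<equiv> real (card A) * real (card (idx q))"

text \<open>First replacement: the actual colours of \<open>S\<close> by their label-dependent
  frequencies. Regularity controls rectangles, and passing to the cut norm turns \<eta> into
  4\<eta>.\<close>

lemma sample_to_weights:
  "avg (tup S q) (kern q A X) \<le> avg (tup S q) (kern q A (\<lambda>c u v. wt m g c u v * P c (l u) (l v))) + N * (4 * \<eta>)"
proof -
  have "cutb S (\<lambda>u v. X c u v - wt m g c u v * P c (l u) (l v)) (4 * \<eta>)" if c: "c \<in> C" for c
  proof (rule cutb_cong[OF cutb_of_sets[OF finS]])
    fix Y Z assume YZ: "Y \<subseteq> S" "Z \<subseteq> S"
    show "\<bar>\<Sum>u\<in>Y. \<Sum>v\<in>Z. wt m g c u v * (X c u v - P c (l u) (l v))\<bar> \<le> \<eta> * (real (card S))\<^sup>2"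
      using reg[OF _ YZ, of c] c unfolding X_def[abs_def] P_def C_def .
  next
    fix u v assume "u \<in> S" "v \<in> S"
    then show "X c u v - wt m g c u v * P c (l u) (l v) = wt m g c u v * (X c u v - P c (l u) (l v))"
      using X_wt[of u v c] by (simp add: right_diff_distrib)
  qed
  then have "\<bar>avg (tup S q) (kern q A X) - avg (tup S q) (kern q A (\<lambda>c u v. wt m g c u v * P c (l u) (l v)))\<bar>
     \<le> real (card A) * (real (card (idx q)) * (4 * \<eta>))"
    using X01 wtP01[OF wt_gS] by (intro kern_counting[OF finS S_ne AC]) auto
  then show ?thesis by (simp add: abs_le_iff mult.assoc)
qed

text \<open>Exchanges adjacency with the step function. It serves on \<open>S\<close> with the
  labels \<open>l\<close> and, in the opposite direction, on \<open>V\<close> with the transported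
  labels.\<close>

lemma weights_step:
  assumes Z: "finite Z" "Z \<noteq> {}" "Z \<subseteq> V" and cut: "cutb Z (\<lambda>u v. g u v - Ub (ty u) (ty v)) \<rho>" and lab: "\<And>u. u \<in> Z \<Longrightarrow> lab u < t"
  shows "\<bar>avg (tup Z q) (kern q A (\<lambda>c u v. wt m g c u v * P c (lab u) (lab v))) -
     avg (tup Z q) (kern q A (\<lambda>c u v. wt m U c u v * P c (lab u) (lab v)))\<bar> \<le> N * ((real t)\<^sup>2 * \<rho>)"
proof -
  have "cutb Z (\<lambda>u v. wt m g c u v * P c (lab u) (lab v) - wt m U c u v * P c (lab u) (lab v)) ((real t)\<^sup>2 * \<rho>)" for c
  proof -
    have base: "cutb Z (\<lambda>u v. (g u v - Ub (ty u) (ty v)) * P c (lab u) (lab v)) ((real t)\<^sup>2 * \<rho>)"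
      by (intro cutb_mult_step Z cut lab P_abs)
    show ?thesis
    proof (cases "ed m c")
      case True
      then show ?thesis by (intro cutb_cong[OF base]) (simp add: wt_def U_def left_diff_distrib)
    next
      case False
      \<comment> \<open>For non-edge colours the difference is (1 - g) - (1 - U) = -(g - U).\<close>
      then show ?thesis by (intro cutb_cong[OF cutb_uminus[OF base]]) (simp add: wt_def U_def left_diff_distrib)
    qed
  qed
  note cut' = this
  have ZV: "u \<in> V" if "u \<in> Z" for u using that Z by blast
  have "\<bar>avg (tup Z q) (kern q A (\<lambda>c u v. wt m g c u v * P c (lab u) (lab v))) -
     avg (tup Z q) (kern q A (\<lambda>c u v. wt m U c u v * P c (lab u) (lab v)))\<bar> \<le> real (card A) * (real (card (idx q)) * ((real t)\<^sup>2 * \<rho>))"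
    by (rule kern_counting[OF Z(1,2) AC cut' wtP01[OF wt_g[OF ZV ZV]] wtP01[OF wt_U]])
  then show ?thesis by (simp add: mult.assoc)
qed

text \<open>With the step function in place of adjacency, the kernel sees an entry only through its
  cell, that is, its type and label. Sample and graph are then compared by cell frequencies.\<close>

lemma cells_step:
  "\<exists>l'. (\<forall>y. l' y < t) \<and> avg (tup S q) (kern q A (\<lambda>c u v. wt m U c u v * P c (l u) (l v)))
     \<le> avg (tup V q) (kern q A (\<lambda>c u v. wt m U c u v * P c (l' u) (l' v))) + real q * (\<kappa> + real (K * t) / real (card V))"
proof -
  obtain l' where l': "\<forall>y. l' y < t" and
    cells: "(\<Sum>c\<in>{..<K} \<times> {..<t}. max 0 (real (card {x\<in>S. (ty x, l x) = c}) / real (card S) - real (card {x\<in>V. (ty x, l' x) = c}) / real (card V))) 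
      \<le> \<kappa> + real (K * t) / real (card V)"
    using transfer_labels[where l = l, OF V V_ne finS S_ne l t types] by blast
  define W where "W = (\<lambda>c (x :: nat \<times> nat) y. (if ed m c then Ub (fst x) (fst y) else 1 - Ub (fst x) (fst y)) * P c (snd x) (snd y))"
  have W: "wt m U c u v * P c (lab u) (lab v) = W c (ty u, lab u) (ty v, lab v)" for c u v lab
    by (simp add: W_def wt_def U_def)
  have kernW: "avg (tup Z q) (kern q A (\<lambda>c u v. wt m U c u v * P c (lab u) (lab v))) 
     = avg (tup Z q) (\<lambda>xs. kern q A W (map (\<lambda>x. (ty x, lab x)) xs))" for Z lab
    by (intro avg_cong) (simp add: W kern_map tup_def)
  have "avg (tup S q) (\<lambda>xs. kern q A W (map (\<lambda>x. (ty x, l x)) xs)) 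
    \<le> avg (tup V q) (\<lambda>xs. kern q A W (map (\<lambda>x. (ty x, l' x)) xs)) + real q * (\<kappa> + real (K * t) / real (card V))"
  proof (rule avg_tup_cells_le[OF finS S_ne _ V V_ne _ _ cells])
    show "(\<lambda>x. (ty x, l x)) ` S \<subseteq> {..<K} \<times> {..<t}" using ty l SV by auto
    show "(\<lambda>x. (ty x, l' x)) ` V \<subseteq> {..<K} \<times> {..<t}" using ty l' by auto
    fix cs assume cs: "cs \<in> tup ({..<K} \<times> {..<t}) q"
    show "0 \<le> kern q A W cs \<and> kern q A W cs \<le> 1"
    proof (rule kern_bounds[OF AC finC cs])
      show "0 \<le> W c u v" for c u v using Ub[of "fst u" "fst v"] P0[of c "snd u" "snd v"] by (simp add: W_def)
      show "(\<Sum>c\<in>C. W c u v) \<le> 1" for u v unfolding W_def using Ub by (intro sum_ed_le_1 finC P_sum) auto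
    qed
  qed simp
  then show ?thesis using l' unfolding kernW by blast
qed

text \<open>The weights describe a random colouring of \<open>V\<close> with the adjacency built in,
  since \<open>wt\<close> vanishes on colours of the wrong kind. The proviso m < k appears because
  for m = k every colour pair makes an edge.\<close>

lemma colouring_step:
  "\<exists>col. (\<forall>u\<in>V. \<forall>v\<in>V. u \<noteq> v \<longrightarrow> col u v \<in> C \<and> col v u = prod.swap (col u v) \<and>
       (g u v = 1 \<longrightarrow> ed m (col u v)) \<and> (g u v = 0 \<and> m < k \<longrightarrow> \<not> ed m (col u v))) \<and>
     avg (itup V q) (kern q A (\<lambda>c u v. wt m g c u v * P c (l' u) (l' v))) \<le> avg (itup V q) (kern q A (\<lambda>c u v. of_bool (col u v = c)))"
proof -
  define W where "W = (\<lambda>c u v. wt m g c u v * P c (l' u) (l' v))"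
  \<comment> \<open>The weights of a pair may add up to less than 1, as a block average over an empty block is 0; the missing mass goes to \<open>df\<close>.\<close>
  define df where "df = (\<lambda>u v. if g u v = 0 \<and> m < k then (k, k) else (1, 1 :: nat))"
  define W' where "W' = (\<lambda>c u v. W c u v + (1 - (\<Sum>c\<in>C. W c u v)) * of_bool (df u v = c))"
  have g_le: "0 \<le> g u v \<and> g u v \<le> 1" if "u \<in> V" "v \<in> V" for u v using g01[OF that] by auto
  have W0: "0 \<le> W c u v" if "u \<in> V" "v \<in> V" for c u v unfolding W_def using wtP01[OF wt_g[OF that]] by blast
  have W1: "(\<Sum>c\<in>C. W c u v) \<le> 1" if "u \<in> V" "v \<in> V" for u v 
    unfolding W_def using g_le[OF that] by (intro wtP_sum) auto
  have df: "df u v \<in> C" for u v using mk by (auto simp: df_def C_def)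
  have Wsw: "W (prod.swap c) v u = W c u v" if "u \<in> V" "v \<in> V" for c u v
    unfolding W_def P_swap using g_sym[OF that] by (simp add: wt_def)
  have Wsum_sw: "(\<Sum>c\<in>C. W c v u) = (\<Sum>c\<in>C. W c u v)" if "u \<in> V" "v \<in> V" for u v
    by (rule sum.reindex_bij_witness[where i = prod.swap and j = prod.swap]) (use swapC Wsw that in auto)
  have dfsw: "(df v u = prod.swap c) = (df u v = c)" if "u \<in> V" "v \<in> V" for u v c
    using g_sym[OF that] by (auto simp: df_def prod_eq_iff)
  have valid: "valid_dist V C W'"
    unfolding valid_dist_def
  proof (intro ballI impI conjI)
    fix u v c assume uv: "u \<in> V" "v \<in> V"
    show "0 \<le> W' c u v" using W0[OF uv, of c] W1[OF uv] by (simp add: W'_def)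
    show "W' (prod.swap c) v u = W' c u v" unfolding W'_def Wsw[OF uv] Wsum_sw[OF uv] dfsw[OF uv] ..
  next
    fix u v assume uv: "u \<in> V" "v \<in> V"
    have "(\<Sum>c\<in>C. W' c u v) = (\<Sum>c\<in>C. W c u v) + (1 - (\<Sum>c\<in>C. W c u v))"
      unfolding W'_def sum.distrib by (subst sum_mult_delta[OF finC df]) (rule refl)
    then show "(\<Sum>c\<in>C. W' c u v) = 1" by simp
  qed
  from derandomize[OF V finC swapC AC this]
  obtain col where col: "\<forall>u\<in>V. \<forall>v\<in>V. u \<noteq> v \<longrightarrow> col u v \<in> C \<and> W' (col u v) u v > 0 \<and> col v u = prod.swap (col u v)"
    and le: "avg (itup V q) (kern q A W') \<le> avg (itup V q) (kern q A (\<lambda>c u v. of_bool (col u v = c)))"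
    by blast
  have "kern q A W xs \<le> kern q A W' xs" if "xs \<in> itup V q" for xs
  proof (rule kern_mono[OF AC that])
    fix c u v assume uv: "u \<in> V" "v \<in> V"
    show "0 \<le> W c u v \<and> W c u v \<le> W' c u v" using W0[OF uv] W1[OF uv] by (simp add: W'_def)
  qed
  then have "avg (itup V q) (kern q A W) \<le> avg (itup V q) (kern q A W')" by (intro avg_mono)
  then have le': "avg (itup V q) (kern q A W) \<le> avg (itup V q) (kern q A (\<lambda>c u v. of_bool (col u v = c)))"
    using le by linarith
  have "(g u v = 1 \<longrightarrow> ed m (col u v)) \<and> (g u v = 0 \<and> m < k \<longrightarrow> \<not> ed m (col u v))"
    if uv: "u \<in> V" "v \<in> V" "u \<noteq> v" for u v
  proof -
    have pos: "W' (col u v) u v > 0" using col uv by blast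
    \<comment> \<open>The chosen colour has positive weight, either from \<open>df\<close>, which
      fits the adjacency as far as m < k permits, or from \<open>W\<close>, whose factor
      \<open>wt\<close> is then nonzero.\<close>
    show ?thesis
    proof (cases "df u v = col u v")
      case True
      then show ?thesis using mk unfolding True[symmetric] by (auto simp: df_def ed_def)
    next
      case False
      then have "W (col u v) u v > 0" using pos by (simp add: W'_def)
      then have "wt m g (col u v) u v \<noteq> 0" by (auto simp: W_def)
      then show ?thesis by (auto simp: wt_def split: if_splits)
    qed
  qed
  then have "\<forall>u\<in>V. \<forall>v\<in>V. u \<noteq> v \<longrightarrow> col u v \<in> C \<and> col v u = prod.swap (col u v) \<and>
       (g u v = 1 \<longrightarrow> ed m (col u v)) \<and> (g u v = 0 \<and> m < k \<longrightarrow> \<not> ed m (col u v))"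
    using col by blast
  then show ?thesis using le' unfolding W_def by blast
qed

text \<open>The error terms in order: regularity of the colouring; adjacency against step function,
  on \<open>S\<close> and on \<open>V\<close>; cell frequencies with rounding; repetitions in tuples
  of \<open>V\<close>.\<close>

lemma recolour:
  "\<exists>col. (\<forall>u\<in>V. \<forall>v\<in>V. u \<noteq> v \<longrightarrow> col u v \<in> {1..k} \<times> {1..k} \<and> col v u = prod.swap (col u v) \<and>
       (g u v = 1 \<longrightarrow> ed m (col u v)) \<and> (g u v = 0 \<and> m < k \<longrightarrow> \<not> ed m (col u v))) \<and>
     avg (tup S q) (kern q A (\<lambda>c u v. of_bool (u \<noteq> v \<and> clr u v = c))) 
       \<le> avg (itup V q) (kern q A (\<lambda>c u v. of_bool (col u v = c))) + 
          N * (4 * \<eta>) + 2 * (N * ((real t)\<^sup>2 * \<rho>)) + real q * (\<kappa> + real (K * t) / real (card V)) + 2 * real (q\<^sup>2) / real (card V)"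
proof -
  let ?w = "\<lambda>h l. kern q A (\<lambda>c u v. wt m h c u v * P c (l u) (l v))"
  have 1: "avg (tup S q) (kern q A X) \<le> avg (tup S q) (?w g l) + N * (4 * \<eta>)" by (rule sample_to_weights)
  have 2: "avg (tup S q) (?w g l) \<le> avg (tup S q) (?w U l) + N * ((real t)\<^sup>2 * \<rho>)"
    using weights_step[OF finS S_ne SV cutS, of l] l by (simp add: abs_le_iff)
  obtain l' where l': "\<forall>y. l' y < t" and 3: "avg (tup S q) (?w U l) \<le> avg (tup V q) (?w U l') + real q * (\<kappa> + real (K * t) / real (card V))"
    using cells_step by blast
  have 4: "avg (tup V q) (?w U l') \<le> avg (tup V q) (?w g l') + N * ((real t)\<^sup>2 * \<rho>)"
    using weights_step[OF V V_ne order.refl cutV, of l'] l' by (simp add: abs_le_iff)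
  have 5: "avg (tup V q) (?w g l') \<le> avg (itup V q) (?w g l') + 2 * real (q\<^sup>2) / real (card V)"
  proof -
    have "\<bar>?w g l' xs\<bar> \<le> 1" if "xs \<in> tup V q" for xs
    proof -
      have "0 \<le> ?w g l' xs \<and> ?w g l' xs \<le> 1"
      proof (rule kern_bounds[OF AC finC that])
        fix u v assume uv: "u \<in> V" "v \<in> V"
        show "0 \<le> wt m g c u v * P c (l' u) (l' v)" for c using wtP01[OF wt_g[OF uv]] by blast
        show "(\<Sum>c\<in>C. wt m g c u v * P c (l' u) (l' v)) \<le> 1" using g01[OF uv] by (intro wtP_sum) auto
      qed
      then show ?thesis by simp
    qed
    then show ?thesis using avg_tup_itup[OF V, of q "?w g l'"] by (simp add: abs_le_iff)
  qed
  from colouring_step[of l'] obtain col where col: "\<forall>u\<in>V. \<forall>v\<in>V. u \<noteq> v \<longrightarrow> col u v \<in> C \<and> col v u = prod.swap (col u v) \<and>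
       (g u v = 1 \<longrightarrow> ed m (col u v)) \<and> (g u v = 0 \<and> m < k \<longrightarrow> \<not> ed m (col u v))"
    and 6: "avg (itup V q) (?w g l') \<le> avg (itup V q) (kern q A (\<lambda>c u v. of_bool (col u v = c)))" by blast
  have "avg (tup S q) (kern q A X) \<le> avg (itup V q) (kern q A (\<lambda>c u v. of_bool (col u v = c))) + 
          N * (4 * \<eta>) + 2 * (N * ((real t)\<^sup>2 * \<rho>)) + real q * (\<kappa> + real (K * t) / real (card V)) + 2 * real (q\<^sup>2) / real (card V)"
    using 1 2 3 4 5 6 by linarith
  then show ?thesis using col unfolding X_def[abs_def] C_def by blast
qed

end

section \<open>Coloured digraphs as patterns\<close>

definition clr :: "cdigraph \<Rightarrow> nat \<Rightarrow> nat \<Rightarrow> nat \<times> nat" where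
  "clr L u v = (dcol L (u, v), dcol L (v, u))"

definition dig :: "nat \<Rightarrow> (nat \<times> nat \<Rightarrow> nat \<times> nat) \<Rightarrow> cdigraph" where
  "dig q M = ({..<q}, \<lambda>(i, j). if i < j \<and> j < q then fst (M (i, j)) else if j < i \<and> i < q then snd (M (j, i)) else 0)"

text \<open>Labelled patterns: with each one all its reorderings occur if \<open>T\<close> is closed
  under isomorphism, so a tuple may be read in its own order.\<close>

definition pats :: "nat \<Rightarrow> nat \<Rightarrow> cdigraph set \<Rightarrow> (nat \<times> nat \<Rightarrow> nat \<times> nat) set" where
  "pats q k T = {M \<in> PiE (idx q) (\<lambda>_. {1..k} \<times> {1..k}). dig q M \<in> T}"

lemma clr_swap: "clr L v u = prod.swap (clr L u v)"
  by (simp add: clr_def)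

lemma dverts_dinduced [simp]: "dverts (dinduced L S) = S"
  by (simp add: dverts_def dinduced_def)

lemma dcol_dinduced: "dcol (dinduced L S) (u, v) = (if u \<in> S \<and> v \<in> S \<and> u \<noteq> v then dcol L (u, v) else 0)"
  by (simp add: dcol_def dinduced_def)

lemma dcol_range: "is_cdigraph k L \<Longrightarrow> u \<in> dverts L \<Longrightarrow> v \<in> dverts L \<Longrightarrow> u \<noteq> v \<Longrightarrow> dcol L (u, v) \<in> {1..k}"
  unfolding is_cdigraph_def by blast

lemma is_cdigraph_dinduced:
  assumes "is_cdigraph k L" "S \<subseteq> dverts L"
  shows "is_cdigraph k (dinduced L S)"
  unfolding is_cdigraph_def dverts_dinduced
proof (intro conjI allI impI)
  show "finite S" using assms finite_subset unfolding is_cdigraph_def by blast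
next
  fix u v assume "u \<in> S \<and> v \<in> S \<and> u \<noteq> v"
  then show "dcol (dinduced L S) (u, v) \<in> {1..k}"
    using dcol_range[OF assms(1), of u v] assms(2) unfolding dcol_dinduced by auto
next
  fix u v assume "\<not> (u \<in> S \<and> v \<in> S \<and> u \<noteq> v)"
  then show "dcol (dinduced L S) (u, v) = 0" unfolding dcol_dinduced by argo
qed

lemma dinduced_dinduced: "S' \<subseteq> S \<Longrightarrow> dinduced (dinduced L S) S' = dinduced L S'"
  unfolding dinduced_def by (auto simp: dcol_def fun_eq_iff)

lemma cdigraph_iso_sym:
  assumes "cdigraph_iso L M"
  shows "cdigraph_iso M L"
proof -
  obtain f where f: "bij_betw f (dverts L) (dverts M)"
    and c: "\<And>u v. u \<in> dverts L \<Longrightarrow> v \<in> dverts L \<Longrightarrow> u \<noteq> v \<Longrightarrow> dcol M (f u, f v) = dcol L (u, v)"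
    using assms unfolding cdigraph_iso_def by blast
  let ?g = "inv_into (dverts L) f"
  have g: "bij_betw ?g (dverts M) (dverts L)" using f by (rule bij_betw_inv_into)
  have "dcol L (?g u, ?g v) = dcol M (u, v)" if uv: "u \<in> dverts M" "v \<in> dverts M" "u \<noteq> v" for u v
  proof -
    have "?g u \<in> dverts L" "?g v \<in> dverts L" using g uv by (auto simp: bij_betw_def)
    moreover have "f (?g u) = u" "f (?g v) = v" using f uv by (auto simp: bij_betw_inv_into_right)
    moreover from this have "?g u \<noteq> ?g v" using uv(3) by metis
    ultimately show ?thesis using c[of "?g u" "?g v"] by simp
  qed
  then show ?thesis using g unfolding cdigraph_iso_def by blast
qed

lemma property_iso_iff:
  assumes "cdigraph_property k T" "is_cdigraph k L" "is_cdigraph k M" "cdigraph_iso L M"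
  shows "L \<in> T \<longleftrightarrow> M \<in> T"
  using assms cdigraph_iso_sym[OF assms(4)] unfolding cdigraph_property_def by blast

lemma sum_of_bool_delta:
  assumes "finite A"
  shows "(\<Sum>M\<in>A. of_bool (M0 = M)) = (of_bool (M0 \<in> A) :: real)"
proof -
  have "(\<Sum>M\<in>A. of_bool (M0 = M)) = (\<Sum>M\<in>A. if M0 = M then 1 else (0::real))" by (rule sum.cong) simp_all
  then show ?thesis using assms by simp
qed

lemma prod_of_bool: "finite E \<Longrightarrow> (\<Prod>e\<in>E. of_bool (Q e)) = (of_bool (\<forall>e\<in>E. Q e) :: real)"
  by (induction E rule: finite_induct) simp_all

text \<open>An injective tuple induces exactly one pattern \<open>M0\<close>, so the sum over
  patterns is its membership indicator. Reading positions as nodes is an isomorphism from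
  \<open>dig q M0\<close> onto the induced digraph.\<close>

lemma kern_pats:
  assumes T: "cdigraph_property k T" and L: "is_cdigraph k L" and xs: "xs \<in> itup (dverts L) q"
  shows "kern q (pats q k T) (\<lambda>c u v. of_bool (u \<noteq> v \<and> clr L u v = c)) xs = of_bool (dinduced L (set xs) \<in> T)"
proof -
  have dist: "distinct xs" and len: "length xs = q" and sub: "set xs \<subseteq> dverts L"
    using xs by (auto simp: itup_def tup_def)
  define M0 where "M0 = restrict (\<lambda>e. clr L (xs ! fst e) (xs ! snd e)) (idx q)"
  have neq: "xs ! i \<noteq> xs ! j" if "i < q" "j < q" "i \<noteq> j" for i j
    using that dist len by (simp add: nth_eq_iff_index_eq)
  have mem: "xs ! i \<in> dverts L" if "i < q" for i using that len sub by auto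
  have rng: "clr L (xs ! i) (xs ! j) \<in> {1..k} \<times> {1..k}" if "i < q" "j < q" "i \<noteq> j" for i j
    using dcol_range[OF L mem[OF that(1)] mem[OF that(2)] neq[OF that]]
      dcol_range[OF L mem[OF that(2)] mem[OF that(1)] neq[OF that, symmetric]] by (simp add: clr_def)
  have M0: "M0 \<in> PiE (idx q) (\<lambda>_. {1..k} \<times> {1..k})"
  proof (rule PiE_I)
    fix e assume e: "e \<in> idx q"
    then have "fst e < q" "snd e < q" "fst e \<noteq> snd e" by (auto simp: idx_def)
    then show "M0 e \<in> {1..k} \<times> {1..k}" using rng e by (simp add: M0_def)
  next
    fix e assume "e \<notin> idx q"
    then show "M0 e = undefined" by (simp add: M0_def)
  qed
  have fin: "finite (pats q k T)"
    by (rule finite_subset[of _ "PiE (idx q) (\<lambda>_. {1..k} \<times> {1..k})"]) (auto simp: pats_def intro: finite_PiE)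
  have factor: "(\<Prod>e\<in>idx q. of_bool (xs ! fst e \<noteq> xs ! snd e \<and> clr L (xs ! fst e) (xs ! snd e) = M e)) = (of_bool (M0 = M) :: real)"
    if M: "M \<in> pats q k T" for M
  proof -
    have ext: "M \<in> PiE (idx q) (\<lambda>_. {1..k} \<times> {1..k})" using M by (simp add: pats_def)
    have "(\<forall>e\<in>idx q. xs ! fst e \<noteq> xs ! snd e \<and> clr L (xs ! fst e) (xs ! snd e) = M e) \<longleftrightarrow> (\<forall>e\<in>idx q. M0 e = M e)"
    proof (intro ball_cong refl)
      fix e assume e: "e \<in> idx q"
      then have "xs ! fst e \<noteq> xs ! snd e" by (intro neq) (auto simp: idx_def)
      then show "(xs ! fst e \<noteq> xs ! snd e \<and> clr L (xs ! fst e) (xs ! snd e) = M e) = (M0 e = M e)"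
        using e by (simp add: M0_def)
    qed
    also have "\<dots> \<longleftrightarrow> M0 = M" using PiE_ext[OF M0 ext] by blast
    finally show ?thesis by (simp only: prod_of_bool[OF finite_idx])
  qed
  have "kern q (pats q k T) (\<lambda>c u v. of_bool (u \<noteq> v \<and> clr L u v = c)) xs = (\<Sum>M\<in>pats q k T. of_bool (M0 = M))"
    unfolding kern_def by (intro sum.cong refl factor)
  also have "\<dots> = of_bool (M0 \<in> pats q k T)" by (rule sum_of_bool_delta[OF fin])
  also have "M0 \<in> pats q k T \<longleftrightarrow> dig q M0 \<in> T" using M0 by (simp add: pats_def)
  also have "dig q M0 \<in> T \<longleftrightarrow> dinduced L (set xs) \<in> T"
  proof (rule property_iso_iff[OF T _ is_cdigraph_dinduced[OF L sub]])
    have col: "dcol (dig q M0) (i, j) = dcol L (xs ! i, xs ! j)" if "i < q" "j < q" "i \<noteq> j" for i j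
      using that by (cases "i < j") (auto simp: dig_def dcol_def M0_def idx_def clr_def)
    have col0: "dcol (dig q M0) (i, j) = 0" if "\<not> (i < q \<and> j < q \<and> i \<noteq> j)" for i j
      using that by (auto simp: dig_def dcol_def)
    have dv: "dverts (dig q M0) = {..<q}" by (simp add: dig_def dverts_def)
    show "is_cdigraph k (dig q M0)"
      unfolding is_cdigraph_def dv
    proof (intro conjI allI impI)
      fix i j assume "i \<in> {..<q} \<and> j \<in> {..<q} \<and> i \<noteq> j"
      then show "dcol (dig q M0) (i, j) \<in> {1..k}" using col rng[of i j] by (simp add: clr_def)
    next
      fix i j assume "\<not> (i \<in> {..<q} \<and> j \<in> {..<q} \<and> i \<noteq> j)"
      then show "dcol (dig q M0) (i, j) = 0" using col0 by simp
    qed simp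
    show "cdigraph_iso (dig q M0) (dinduced L (set xs))"
      unfolding cdigraph_iso_def dv dverts_dinduced
    proof (intro exI[of _ "(!) xs"] conjI ballI impI)
      show "bij_betw ((!) xs) {..<q} (set xs)" using dist len by (intro bij_betw_nth) auto
      fix i j assume "i \<in> {..<q}" "j \<in> {..<q}" "i \<noteq> j"
      then show "dcol (dinduced L (set xs)) (xs ! i, xs ! j) = dcol (dig q M0) (i, j)"
        using neq len col by (simp add: dcol_dinduced)
    qed
  qed
  finally show ?thesis .
qed

text \<open>The entries of a random injective q-tuple form a uniform q-subset: this is
  \<open>avg_subs_itup\<close> with r = q, where each inner average is constant.\<close>

lemma sample_prob_avg:
  assumes L: "finite (dverts L)" and q: "q \<le> card (dverts L)"
  shows "sample_prob dverts dinduced T L q = avg (itup (dverts L) q) (\<lambda>xs. of_bool (dinduced L (set xs) \<in> T))"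
proof -
  let ?V = "dverts L"
  have "avg (itup ?V q) (\<lambda>xs. of_bool (dinduced L (set xs) \<in> T)) = avg (subs ?V q) (\<lambda>S. avg (itup S q) (\<lambda>xs. of_bool (dinduced L (set xs) \<in> T)))"
    using avg_subs_itup[OF L order.refl q] by simp
  also have "\<dots> = avg (subs ?V q) (\<lambda>S. of_bool (dinduced L S \<in> T))"
  proof (rule avg_cong)
    fix S assume S: "S \<in> subs ?V q"
    then have fin: "finite S" and card: "card S = q" using L finite_subset by (auto simp: subs_def)
    have "set xs = S" if "xs \<in> itup S q" for xs
      using that fin card by (intro card_subset_eq) (auto simp: itup_def tup_def distinct_card)
    then have "avg (itup S q) (\<lambda>xs. of_bool (dinduced L (set xs) \<in> T)) = avg (itup S q) (\<lambda>xs. of_bool (dinduced L S \<in> T))"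
      by (intro avg_cong) simp
    also have "\<dots> = of_bool (dinduced L S \<in> T)"
      using card_itup_pos[OF fin, of q] card fin by (intro avg_const) auto
    finally show "avg (itup S q) (\<lambda>xs. of_bool (dinduced L (set xs) \<in> T)) = of_bool (dinduced L S \<in> T)" .
  qed
  also have "\<dots> = sample_prob dverts dinduced T L q"
  proof -
    have "(\<Sum>S\<in>subs ?V q. of_bool (dinduced L S \<in> T)) = real (card {S \<in> subs ?V q. dinduced L S \<in> T})"
      using L by (simp add: sum_of_bool_eq Int_def)
    moreover have "{S \<in> subs ?V q. dinduced L S \<in> T} = {S. S \<subseteq> ?V \<and> card S = q \<and> dinduced L S \<in> T}"
      by (auto simp: subs_def)
    ultimately show ?thesis using L by (simp add: sample_prob_def avg_def card_subs)
  qed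
  finally show ?thesis by simp
qed

text \<open>The order of quantifiers matters: the threshold depends on q, \<eta> and \<beta>, but
  not on the graph or on \<open>h\<close>.\<close>

lemma concentration_eventually:
  assumes "\<eta> > 0" "\<beta> > 0"
  shows "\<exists>R. \<forall>(V :: 'a set) r h. finite V \<and> R \<le> r \<and> r \<le> card V \<and> (\<forall>xs\<in>tup V q. \<bar>h xs\<bar> \<le> 1) \<longrightarrow>
     real (card {S \<in> subs V r. \<bar>avg (tup S q) h - avg (tup V q) h\<bar> \<ge> \<eta>}) \<le> \<beta> * real (card V choose r)"
proof (intro exI[of _ "2 * q + 1 + nat \<lceil>24 * real (q\<^sup>2) / (\<beta> * \<eta>\<^sup>2)\<rceil>"] allI impI, elim conjE)
  fix V :: "'a set" and r and h :: "'a list \<Rightarrow> real"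
  assume V: "finite V" and R: "2 * q + 1 + nat \<lceil>24 * real (q\<^sup>2) / (\<beta> * \<eta>\<^sup>2)\<rceil> \<le> r" and r: "r \<le> card V" and h: "\<forall>xs\<in>tup V q. \<bar>h xs\<bar> \<le> 1"
  have r0: "real r > 0" using R by simp
  have "24 * real (q\<^sup>2) / (\<beta> * \<eta>\<^sup>2) \<le> real (nat \<lceil>24 * real (q\<^sup>2) / (\<beta> * \<eta>\<^sup>2)\<rceil>)" by (rule real_nat_ceiling_ge)
  also have "\<dots> \<le> real r" using R by linarith
  finally have "24 * real (q\<^sup>2) \<le> real r * (\<beta> * \<eta>\<^sup>2)" using assms by (simp add: pos_divide_le_eq)
  also have "\<dots> = \<beta> * (real r * \<eta>\<^sup>2)" by simp
  finally have le: "24 * real (q\<^sup>2) / (real r * \<eta>\<^sup>2) \<le> \<beta>" using assms r0 by (simp only: pos_divide_le_eq mult_pos_pos zero_less_power)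
  have "real (card {S \<in> subs V r. \<bar>avg (tup S q) h - avg (tup V q) h\<bar> \<ge> \<eta>}) \<le> 24 * real (q\<^sup>2) / (real r * \<eta>\<^sup>2) * real (card V choose r)"
    using R r assms(1) h by (intro sample_concentration V) auto
  also have "\<dots> \<le> \<beta> * real (card V choose r)" using le by (intro mult_right_mono) auto
  finally show "real (card {S \<in> subs V r. \<bar>avg (tup S q) h - avg (tup V q) h\<bar> \<ge> \<eta>}) \<le> \<beta> * real (card V choose r)" .
qed

text \<open>At most a third of the samples deviate by 1/12. Repetitions cost 1/24 on the whole graph
  and 1/24 on the sample, and 2/3 - 1/24 - 1/12 - 1/24 = 1/2. The summand 48 q^2 ensures that 2 q^2
  / r is at most 1/24.\<close>

lemma completeness:
  assumes q: "q \<ge> 1"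
  shows "\<exists>R. \<forall>L r. finite (dverts L) \<and> R \<le> r \<and> r \<le> card (dverts L) \<and> sample_prob dverts dinduced T L q \<ge> 2/3 \<longrightarrow>
     real (card {S \<in> subs (dverts L) r. sample_prob dverts dinduced T (dinduced L S) q \<ge> 1/2}) \<ge> 2/3 * real (card (dverts L) choose r)"
proof -
  have "(1/12 :: real) > 0" "(1/3 :: real) > 0" by simp_all
  from concentration_eventually[OF this, of q, where 'a = nat]
  obtain R0 where "\<forall>(V :: nat set) r h. finite V \<and> R0 \<le> r \<and> r \<le> card V \<and> (\<forall>xs\<in>tup V q. \<bar>h xs\<bar> \<le> 1) \<longrightarrow>
     real (card {S \<in> subs V r. \<bar>avg (tup S q) h - avg (tup V q) h\<bar> \<ge> 1/12}) \<le> 1/3 * real (card V choose r)"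
    by (elim exE)
  then have R0: "real (card {S \<in> subs V r. \<bar>avg (tup S q) h - avg (tup V q) h\<bar> \<ge> 1/12}) \<le> 1/3 * real (card V choose r)"
    if "finite V" "R0 \<le> r" "r \<le> card V" "\<And>xs. \<bar>h xs\<bar> \<le> 1" for V :: "nat set" and r h
    using that by blast
  show ?thesis
  proof (intro exI[of _ "R0 + 48 * q\<^sup>2 + q"] allI impI, elim conjE)
    fix L r assume fin: "finite (dverts L)" and R: "R0 + 48 * q\<^sup>2 + q \<le> r" and r: "r \<le> card (dverts L)"
      and acc: "sample_prob dverts dinduced T L q \<ge> 2/3"
    let ?V = "dverts L"
    define h where "h = (\<lambda>xs. of_bool (dinduced L (set xs) \<in> T) :: real)"
    have r0: "real r > 0" using R q by simp
    have err: "2 * real (q\<^sup>2) / real n \<le> 1/24" if "r \<le> n" for n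
    proof -
      have "48 * q\<^sup>2 \<le> n" using R that by simp
      then have "real (48 * q\<^sup>2) \<le> real n" by (rule of_nat_mono)
      moreover have "real n > 0" using r0 that by simp
      ultimately show ?thesis by (simp add: pos_divide_le_eq)
    qed
    have h1: "\<bar>h xs\<bar> \<le> 1" for xs by (simp add: h_def)
    have "avg (itup ?V q) h \<ge> 2/3" using acc sample_prob_avg[OF fin, of q T] R r by (simp add: h_def)
    moreover have "\<bar>avg (tup ?V q) h - avg (itup ?V q) h\<bar> \<le> 1/24"
      using avg_tup_itup[where h = h and q = q, OF fin h1] err[OF r] by linarith
    ultimately have \<nu>: "avg (tup ?V q) h \<ge> 2/3 - 1/24" by linarith
    let ?bad = "{S \<in> subs ?V r. \<bar>avg (tup S q) h - avg (tup ?V q) h\<bar> \<ge> 1/12}"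
    let ?good = "{S \<in> subs ?V r. sample_prob dverts dinduced T (dinduced L S) q \<ge> 1/2}"
    have sub: "subs ?V r \<subseteq> ?bad \<union> ?good"
    proof
      fix S assume S: "S \<in> subs ?V r"
      then have finS: "finite S" and cS: "card S = r" using fin finite_subset by (auto simp: subs_def)
      have "sample_prob dverts dinduced T (dinduced L S) q \<ge> 1/2" if "\<not> \<bar>avg (tup S q) h - avg (tup ?V q) h\<bar> \<ge> 1/12"
      proof -
        have "sample_prob dverts dinduced T (dinduced L S) q = avg (itup S q) (\<lambda>xs. of_bool (dinduced (dinduced L S) (set xs) \<in> T))"
          using sample_prob_avg[of "dinduced L S" q T] finS cS R by simp
        also have "\<dots> = avg (itup S q) h"
          by (intro avg_cong) (simp add: h_def itup_def tup_def dinduced_dinduced)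
        finally have "sample_prob dverts dinduced T (dinduced L S) q = avg (itup S q) h" .
        moreover have "\<bar>avg (tup S q) h - avg (itup S q) h\<bar> \<le> 1/24"
          using avg_tup_itup[where h = h and q = q, OF finS h1] err[of r] cS by simp
        ultimately show ?thesis using that \<nu> by linarith
      qed
      then show "S \<in> ?bad \<union> ?good" using S by blast
    qed
    have "real (card ?V choose r) = real (card (subs ?V r))" using fin by (simp add: card_subs)
    also have "\<dots> \<le> real (card (?bad \<union> ?good))"
      using fin by (intro of_nat_mono card_mono sub) auto
    also have "\<dots> \<le> real (card ?bad) + real (card ?good)"
      using card_Un_le[of ?bad ?good] by linarith
    finally have "real (card ?V choose r) \<le> real (card ?bad) + real (card ?good)" .
    moreover have "real (card ?bad) \<le> 1/3 * real (card ?V choose r)"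
      using R by (intro R0 fin r h1) auto
    ultimately show "real (card ?good) \<ge> 2/3 * real (card ?V choose r)" by linarith
  qed
qed

section \<open>Shadows, acceptance of a sample, and typical samples\<close>

definition adj :: "graph \<Rightarrow> nat \<Rightarrow> nat \<Rightarrow> real" where
  "adj G u v = of_bool ({u, v} \<in> edges G)"

lemma adj_swap: "adj G v u = adj G u v"
  by (simp add: adj_def insert_commute)

lemma adj_01: "adj G u v = 0 \<or> adj G u v = 1"
  by (simp add: adj_def)

lemma verts_shadow [simp]: "verts (shadow m L) = dverts L"
  by (simp add: shadow_def verts_def)

lemma verts_induced [simp]: "verts (induced G S) = S"
  by (simp add: induced_def verts_def)

lemma shadow_edge_iff:
  assumes L: "is_cdigraph k L" and u: "u \<in> dverts L" and v: "v \<in> dverts L" and uv: "u \<noteq> v"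
  shows "{u, v} \<in> edges (shadow m L) \<longleftrightarrow> ed m (clr L u v)"
proof -
  have "{u, v} \<in> edges (shadow m L) \<longleftrightarrow> dcol L (u, v) \<in> {1..m} \<or> dcol L (v, u) \<in> {1..m}"
    using u v uv unfolding shadow_def edges_def by (auto simp: doubleton_eq_iff)
  also have "\<dots> \<longleftrightarrow> ed m (clr L u v)"
    using dcol_range[OF L u v uv] dcol_range[OF L v u uv[symmetric]] by (auto simp: ed_def clr_def)
  finally show ?thesis .
qed

lemma is_graph_shadow:
  assumes "is_cdigraph k L"
  shows "is_graph (shadow m L)"
proof -
  have "finite (dverts L)" using assms by (simp add: is_cdigraph_def)
  then show ?thesis unfolding is_graph_def verts_shadow
    unfolding shadow_def edges_def by auto
qed

lemma graph_edgeD: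
  assumes "is_graph G" "e \<in> edges G"
  shows "\<exists>u v. e = {u, v} \<and> u \<in> verts G \<and> v \<in> verts G \<and> u \<noteq> v"
  using assms unfolding is_graph_def by blast

lemma accept_induced_clr:
  assumes G: "is_graph G" and L: "is_cdigraph k L" and sh: "shadow m L = induced G S" 
    and u: "u \<in> S" and v: "v \<in> S" and uv: "u \<noteq> v"
  shows "ed m (clr L u v) \<longleftrightarrow> adj G u v = 1"
proof -
  have "dverts L = S" using arg_cong[OF sh, of verts] by simp
  then have "ed m (clr L u v) \<longleftrightarrow> {u, v} \<in> edges (induced G S)"
    using shadow_edge_iff[OF L, of u v m] u v uv sh by simp
  also have "\<dots> \<longleftrightarrow> adj G u v = 1" using u v by (simp add: induced_def edges_def adj_def)
  finally show ?thesis .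
qed

definition accepts :: "nat \<Rightarrow> nat \<Rightarrow> cdigraph set \<Rightarrow> nat \<Rightarrow> graph \<Rightarrow> bool" where
  "accepts k m T q F \<longleftrightarrow> (\<exists>L. is_cdigraph k L \<and> shadow m L = F \<and> sample_prob dverts dinduced T L q \<ge> 1/2)"

definition diff_edges :: "graph \<Rightarrow> graph \<Rightarrow> nat set set" where
  "diff_edges G H = edges G - edges H \<union> (edges H - edges G)"

text \<open>For the case m = k, in which accepted samples are complete graphs. The loss 1/card S
  comes from the diagonal.\<close>

lemma avg_pairs_complete:
  assumes "finite S" "S \<noteq> {}" and g: "\<And>u v. u \<in> S \<Longrightarrow> v \<in> S \<Longrightarrow> u \<noteq> v \<Longrightarrow> g u v = (1::real)" and g0: "\<And>u v. 0 \<le> g u v"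
  shows "avg (tup S 2) (\<lambda>xs. g (xs ! 0) (xs ! 1)) \<ge> 1 - 1 / real (card S)"
proof -
  have t2: "tup S 2 = tup S (Suc (Suc 0))" by (simp add: numeral_2_eq_2)
  have r: "real (card S) > 0" using assms by (simp add: card_gt_0_iff)
  have "avg (tup S 2) (\<lambda>xs. g (xs ! 0) (xs ! 1)) = avg S (\<lambda>u. avg S (\<lambda>v. g u v))"
    unfolding t2 avg_tup_Suc[OF assms(1)] tup_0 by (simp add: avg_def)
  also have "\<dots> \<ge> avg S (\<lambda>u. 1 - 1 / real (card S))"
  proof (rule avg_mono)
    fix u assume u: "u \<in> S"
    have "real (card S) - 1 = (\<Sum>v\<in>S. 1 - of_bool (v = u))"
      using u assms(1) by (simp add: sum_subtractf sum_of_bool_eq)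
    also have "\<dots> \<le> (\<Sum>v\<in>S. g u v)"
      using g[OF u] g0 by (intro sum_mono) (auto simp: of_bool_def)
    finally have "(real (card S) - 1) / real (card S) \<le> avg S (\<lambda>v. g u v)"
      unfolding avg_def by (rule divide_right_mono) simp
    then show "1 - 1 / real (card S) \<le> avg S (\<lambda>v. g u v)" using r by (simp add: diff_divide_distrib)
  qed
  finally show ?thesis using assms by (simp add: avg_const)
qed

text \<open>Converts edge density into a count of ordered non-adjacent pairs, diagonal included,
  which bounds what a colouring with m = k gets wrong.\<close>

lemma card_nonadjacent:
  assumes "finite V" and g: "\<And>u v. g u v = 0 \<or> g u v = (1::real)"
  shows "real (card {(u, v) \<in> V \<times> V. g u v = 0}) = (1 - avg (tup V 2) (\<lambda>xs. g (xs ! 0) (xs ! 1))) * (real (card V))\<^sup>2"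
proof (cases "V = {}")
  case False
  have t2: "tup V 2 = tup V (Suc (Suc 0))" by (simp add: numeral_2_eq_2)
  have n: "real (card V) > 0" using assms False by (simp add: card_gt_0_iff)
  have "avg (tup V 2) (\<lambda>xs. g (xs ! 0) (xs ! 1)) = avg V (\<lambda>u. avg V (\<lambda>v. g u v))"
    unfolding t2 avg_tup_Suc[OF assms(1)] tup_0 by (simp add: avg_def)
  also have "\<dots> = (\<Sum>u\<in>V. \<Sum>v\<in>V. g u v) / (real (card V))\<^sup>2"
    by (simp add: avg_def power2_eq_square flip: sum_divide_distrib)
  finally have "avg (tup V 2) (\<lambda>xs. g (xs ! 0) (xs ! 1)) * (real (card V))\<^sup>2 = (\<Sum>u\<in>V. \<Sum>v\<in>V. g u v)"
    using n by simp
  moreover have "(\<Sum>u\<in>V. \<Sum>v\<in>V. g u v) = (\<Sum>(u, v)\<in>V \<times> V. g u v)" by (rule sum.cartesian_product)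
  moreover have "(\<Sum>(u, v)\<in>V \<times> V. g u v) = (\<Sum>p\<in>V \<times> V. 1 - of_bool (case p of (u, v) \<Rightarrow> g u v = 0))"
  proof (rule sum.cong[OF refl])
    fix p assume "p \<in> V \<times> V"
    show "(case p of (u, v) \<Rightarrow> g u v) = 1 - of_bool (case p of (u, v) \<Rightarrow> g u v = 0)"
      using g[of "fst p" "snd p"] by (cases p) auto
  qed
  moreover have "\<dots> = (real (card V))\<^sup>2 - real (card {p \<in> V \<times> V. case p of (u, v) \<Rightarrow> g u v = 0})"
    using assms(1) by (simp add: sum_subtractf sum_of_bool_eq Int_def card_cartesian_product power2_eq_square)
  moreover have "{p \<in> V \<times> V. case p of (u, v) \<Rightarrow> g u v = 0} = {(u, v) \<in> V \<times> V. g u v = 0}" by auto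
  ultimately show ?thesis by (simp add: left_diff_distrib)
qed simp

text \<open>Union bound: three kinds of bad events, each on at most 1/9 of the samples, cover at
  most a third, and \<A> is larger. The functions are quantified after the threshold, so they may
  depend on the graph.\<close>

lemma ex_good_sample:
  fixes K q :: nat
  assumes "\<sigma> > 0" "\<kappa> > 0" "\<theta> > 0"
  shows "\<exists>R. \<forall>(V :: nat set) r f g (ty :: nat \<Rightarrow> nat) \<A>. finite V \<and> R \<le> r \<and> r \<le> card V \<and> (\<forall>u\<in>V. \<forall>v\<in>V. \<bar>f u v\<bar> \<le> 1 \<and> \<bar>g u v\<bar> \<le> 1) \<and>
     \<A> \<subseteq> subs V r \<and> real (card \<A>) > 1/3 * real (card V choose r) \<longrightarrow>
     (\<exists>S\<in>\<A>. avg (tup S 4) (c4 f) \<le> avg (tup V 4) (c4 f) + \<sigma> \<and>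
        (\<Sum>a<K. \<bar>real (card {x\<in>S. ty x = a}) / real (card S) - real (card {x\<in>V. ty x = a}) / real (card V)\<bar>) \<le> \<kappa> \<and>
        \<bar>avg (tup S 2) (\<lambda>xs. g (xs ! 0) (xs ! 1)) - avg (tup V 2) (\<lambda>xs. g (xs ! 0) (xs ! 1))\<bar> \<le> \<theta>)"
proof -
  \<comment> \<open>The tolerance \<kappa> and the probability 1/9 are shared among the K types;
    \<open>Suc K\<close> keeps the denominators positive.\<close>
  define \<kappa>' where "\<kappa>' = \<kappa> / real (Suc K)"
  define \<beta> where "\<beta> = 1 / (9 * real (Suc K))"
  have pos: "\<kappa>' > 0" "\<beta> > 0" "(1/9 :: real) > 0" using assms by (simp_all add: \<kappa>'_def \<beta>_def)
  from concentration_eventually[OF assms(1) pos(3), of 4, where 'a = nat] obtain R1 where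
    R1: "\<forall>(V :: nat set) r h. finite V \<and> R1 \<le> r \<and> r \<le> card V \<and> (\<forall>xs\<in>tup V 4. \<bar>h xs\<bar> \<le> 1) \<longrightarrow>
     real (card {S \<in> subs V r. \<bar>avg (tup S 4) h - avg (tup V 4) h\<bar> \<ge> \<sigma>}) \<le> 1/9 * real (card V choose r)" by (elim exE)
  from concentration_eventually[OF pos(1,2), of 1, where 'a = nat] obtain R2 where
    R2: "\<forall>(V :: nat set) r h. finite V \<and> R2 \<le> r \<and> r \<le> card V \<and> (\<forall>xs\<in>tup V 1. \<bar>h xs\<bar> \<le> 1) \<longrightarrow>
     real (card {S \<in> subs V r. \<bar>avg (tup S 1) h - avg (tup V 1) h\<bar> \<ge> \<kappa>'}) \<le> \<beta> * real (card V choose r)" by (elim exE)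
  from concentration_eventually[OF assms(3) pos(3), of 2, where 'a = nat] obtain R3 where
    R3: "\<forall>(V :: nat set) r h. finite V \<and> R3 \<le> r \<and> r \<le> card V \<and> (\<forall>xs\<in>tup V 2. \<bar>h xs\<bar> \<le> 1) \<longrightarrow>
     real (card {S \<in> subs V r. \<bar>avg (tup S 2) h - avg (tup V 2) h\<bar> \<ge> \<theta>}) \<le> 1/9 * real (card V choose r)" by (elim exE)
  show ?thesis
  proof (intro exI[of _ "R1 + R2 + R3"] allI impI, elim conjE)
    fix V :: "nat set" and r f g and ty :: "nat \<Rightarrow> nat" and \<A>
    assume V: "finite V" and R: "R1 + R2 + R3 \<le> r" and r: "r \<le> card V" and fg: "\<forall>u\<in>V. \<forall>v\<in>V. \<bar>f u v\<bar> \<le> (1::real) \<and> \<bar>g u v\<bar> \<le> (1::real)"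
      and \<A>: "\<A> \<subseteq> subs V r" and large: "real (card \<A>) > 1/3 * real (card V choose r)"
    define g2 where "g2 = (\<lambda>xs. g (xs ! 0) (xs ! 1))"
    define hty where "hty = (\<lambda>a xs. of_bool (ty (xs ! 0) = a) :: real)"
    define B1 where "B1 = {S \<in> subs V r. \<bar>avg (tup S 4) (c4 f) - avg (tup V 4) (c4 f)\<bar> \<ge> \<sigma>}"
    define B2 where "B2 = (\<lambda>a. {S \<in> subs V r. \<bar>avg (tup S 1) (hty a) - avg (tup V 1) (hty a)\<bar> \<ge> \<kappa>'})"
    define B3 where "B3 = {S \<in> subs V r. \<bar>avg (tup S 2) g2 - avg (tup V 2) g2\<bar> \<ge> \<theta>}"
    let ?C = "real (card V choose r)"
    have "\<bar>c4 f xs\<bar> \<le> 1" if "xs \<in> tup V 4" for xs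
    proof -
      have mem: "xs ! i \<in> V" if "i < 4" for i using \<open>xs \<in> tup V 4\<close> that by (auto simp: tup_def)
      have "\<bar>f (xs ! i) (xs ! j)\<bar> \<le> 1" if "i < 4" "j < 4" for i j using fg mem[OF that(1)] mem[OF that(2)] by blast
      then show ?thesis unfolding c4_def abs_mult by (intro mult_le_one mult_nonneg_nonneg abs_ge_zero) auto
    qed
    then have c1: "real (card B1) \<le> 1/9 * ?C" unfolding B1_def using V r R by (intro R1[rule_format]) auto
    have c2: "real (card (B2 a)) \<le> \<beta> * ?C" for a unfolding B2_def using V r R by (intro R2[rule_format]) (auto simp: hty_def)
    have "\<bar>g2 xs\<bar> \<le> 1" if "xs \<in> tup V 2" for xs
    proof -
      have "xs ! 0 \<in> V" "xs ! 1 \<in> V" using that by (auto simp: tup_def)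
      then show ?thesis using fg unfolding g2_def by blast
    qed
    then have c3: "real (card B3) \<le> 1/9 * ?C" unfolding B3_def using V r R by (intro R3[rule_format]) auto
    have "real (card (\<Union>a<K. B2 a)) \<le> (\<Sum>a<K. real (card (B2 a)))"
      using card_UN_le[of "{..<K}" B2] by (simp flip: of_nat_sum)
    also have "\<dots> \<le> (\<Sum>a<K. \<beta> * ?C)" by (intro sum_mono c2)
    also have "\<dots> = (real K * \<beta>) * ?C" by simp
    also have "\<dots> \<le> 1/9 * ?C"
    proof (rule mult_right_mono)
      show "real K * \<beta> \<le> 1/9" by (simp add: \<beta>_def pos_divide_le_eq)
    qed simp
    finally have c2': "real (card (\<Union>a<K. B2 a)) \<le> 1/9 * ?C" .
    have "\<not> \<A> \<subseteq> B1 \<union> (\<Union>a<K. B2 a) \<union> B3"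
    proof
      assume sub: "\<A> \<subseteq> B1 \<union> (\<Union>a<K. B2 a) \<union> B3"
      have "finite (B1 \<union> (\<Union>a<K. B2 a) \<union> B3)" using V by (auto simp: B1_def B2_def B3_def)
      then have "card \<A> \<le> card (B1 \<union> (\<Union>a<K. B2 a) \<union> B3)" using sub by (rule card_mono)
      also have "\<dots> \<le> card B1 + card (\<Union>a<K. B2 a) + card B3"
        using card_Un_le[of "B1 \<union> (\<Union>a<K. B2 a)" B3] card_Un_le[of B1 "\<Union>a<K. B2 a"] by linarith
      finally have "real (card \<A>) \<le> 1/3 * ?C" using c1 c2' c3 by linarith
      then show False using large by linarith
    qed
    then obtain S where S: "S \<in> \<A>" "S \<notin> B1" "\<And>a. a < K \<Longrightarrow> S \<notin> B2 a" "S \<notin> B3" by blast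
    have Ss: "S \<in> subs V r" using S \<A> by blast
    have t1: "avg (tup X 1) (hty a) = real (card {x\<in>X. ty x = a}) / real (card X)" if "finite X" for X a
    proof -
      have "avg (tup X 1) (hty a) = avg X (\<lambda>x. of_bool (ty x = a))"
        unfolding One_nat_def avg_tup_Suc[OF that] tup_0 by (simp add: avg_def hty_def)
      then show ?thesis using that by (simp add: avg_def sum_of_bool_eq Int_def)
    qed
    have finS: "finite S" using Ss V finite_subset by (auto simp: subs_def)
    have "(\<Sum>a<K. \<bar>real (card {x\<in>S. ty x = a}) / real (card S) - real (card {x\<in>V. ty x = a}) / real (card V)\<bar>) \<le> (\<Sum>a<K. \<kappa>')"
    proof (rule sum_mono)
      fix a assume "a \<in> {..<K}"
      then have "S \<notin> B2 a" using S by blast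
      then show "\<bar>real (card {x\<in>S. ty x = a}) / real (card S) - real (card {x\<in>V. ty x = a}) / real (card V)\<bar> \<le> \<kappa>'"
        using Ss t1[OF finS, of a] t1[OF V, of a] by (simp add: B2_def)
    qed
    also have "\<dots> \<le> \<kappa>"
    proof -
      have "real K * \<kappa> \<le> \<kappa> * real (Suc K)" using assms(2) by (simp add: algebra_simps)
      then show ?thesis by (simp add: \<kappa>'_def pos_divide_le_eq del: of_nat_Suc)
    qed
    finally have types: "(\<Sum>a<K. \<bar>real (card {x\<in>S. ty x = a}) / real (card S) - real (card {x\<in>V. ty x = a}) / real (card V)\<bar>) \<le> \<kappa>" .
    have "avg (tup S 4) (c4 f) \<le> avg (tup V 4) (c4 f) + \<sigma>" using S(2) Ss by (simp add: B1_def abs_le_iff)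
    moreover have "\<bar>avg (tup S 2) g2 - avg (tup V 2) g2\<bar> \<le> \<theta>" using S(4) Ss by (simp add: B3_def)
    ultimately show "\<exists>S\<in>\<A>. avg (tup S 4) (c4 f) \<le> avg (tup V 4) (c4 f) + \<sigma> \<and>
        (\<Sum>a<K. \<bar>real (card {x\<in>S. ty x = a}) / real (card S) - real (card {x\<in>V. ty x = a}) / real (card V)\<bar>) \<le> \<kappa> \<and>
        \<bar>avg (tup S 2) (\<lambda>xs. g (xs ! 0) (xs ! 1)) - avg (tup V 2) (\<lambda>xs. g (xs ! 0) (xs ! 1))\<bar> \<le> \<theta>"
      using S(1) types unfolding g2_def by blast
  qed
qed

section \<open>Colouring a graph whose samples can be coloured\<close>

lemma kern_cong_itup:
  assumes A: "A \<subseteq> PiE (idx q) (\<lambda>_. C)" and xs: "xs \<in> itup V q"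
    and W: "\<And>c u v. c \<in> C \<Longrightarrow> u \<in> V \<Longrightarrow> v \<in> V \<Longrightarrow> u \<noteq> v \<Longrightarrow> 0 \<le> W c u v \<and> W' c u v = W c u v"
  shows "kern q A W xs = kern q A W' xs"
proof (rule antisym)
  show "kern q A W xs \<le> kern q A W' xs" by (rule kern_mono[OF A xs]) (simp add: W)
  show "kern q A W' xs \<le> kern q A W xs" by (rule kern_mono[OF A xs]) (simp add: W)
qed

definition of_col :: "nat set \<Rightarrow> (nat \<Rightarrow> nat \<Rightarrow> nat \<times> nat) \<Rightarrow> cdigraph" where
  "of_col V col = (V, \<lambda>(u, v). if u \<in> V \<and> v \<in> V \<and> u \<noteq> v then fst (col u v) else 0)"

lemma dverts_of_col [simp]: "dverts (of_col V col) = V"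
  by (simp add: of_col_def dverts_def)

lemma clr_of_col:
  assumes "u \<in> V" "v \<in> V" "u \<noteq> v" "col v u = prod.swap (col u v)"
  shows "clr (of_col V col) u v = col u v"
  using assms by (simp add: clr_def of_col_def dcol_def)

lemma is_cdigraph_of_col:
  assumes "finite V" "\<And>u v. u \<in> V \<Longrightarrow> v \<in> V \<Longrightarrow> u \<noteq> v \<Longrightarrow> col u v \<in> {1..k} \<times> {1..k}"
  shows "is_cdigraph k (of_col V col)"
  unfolding is_cdigraph_def dverts_of_col
proof (intro conjI allI impI)
  show "finite V" by (rule assms(1))
next
  fix u v assume "u \<in> V \<and> v \<in> V \<and> u \<noteq> v"
  then show "dcol (of_col V col) (u, v) \<in> {1..k}"
    using assms(2)[of u v] by (auto simp: of_col_def dcol_def)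
next
  fix u v assume "\<not> (u \<in> V \<and> v \<in> V \<and> u \<noteq> v)"
  then show "dcol (of_col V col) (u, v) = 0" unfolding of_col_def dcol_def snd_conv case_prod_conv by argo
qed

lemma sample_prob_kern:
  assumes T: "cdigraph_property k T" and L: "is_cdigraph k L" and q: "q \<le> card (dverts L)"
  shows "sample_prob dverts dinduced T L q = avg (itup (dverts L) q) (kern q (pats q k T) (\<lambda>c u v. of_bool (u \<noteq> v \<and> clr L u v = c)))"
proof -
  have "finite (dverts L)" using L by (simp add: is_cdigraph_def)
  from sample_prob_avg[OF this q, of T] show ?thesis
    by (simp add: kern_pats[OF T L] cong: avg_cong)
qed

text \<open>\<open>ex_good_sample\<close> supplies an accepted sample that is also typical, and
  \<open>recolour\<close> carries its colouring to \<open>G\<close>. As \<open>R\<close> is fixed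
  before \<open>G\<close>, every constant may depend only on q, k, m and \<open>T\<close>.\<close>

lemma soundness:
  assumes mk: "1 \<le> m" "m \<le> k" and q: "q \<ge> 1" and T: "cdigraph_property k T"
  shows "\<exists>R. \<forall>G r. is_graph G \<and> R \<le> r \<and> r \<le> card (verts G) \<and>
     real (card {S \<in> subs (verts G) r. accepts k m T q (induced G S)}) > 1/3 * real (card (verts G) choose r) \<longrightarrow>
     (\<exists>L. is_cdigraph k L \<and> dverts L = verts G \<and> sample_prob dverts dinduced T L q > 1/3 \<and>
        real (card (diff_edges (shadow m L) G)) \<le> (real (card (verts G)))\<^sup>2 / real q)"
proof -
  define C where "C = {1..k} \<times> {1..k}"
  define A where "A = pats q k T"
  \<comment> \<open>Number of factor exchanges made by the counting lemma over all patterns; the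
    added 1 keeps it positive.\<close>
  define N where "N = real (card A) * real (card (idx q)) + 1"
  have finC: "finite C" by (simp add: C_def)
  have A: "A \<subseteq> PiE (idx q) (\<lambda>_. {1..k} \<times> {1..k})" by (auto simp: A_def pats_def)
  have N: "N \<ge> 1" "real (card A) * real (card (idx q)) \<le> N" by (simp_all add: N_def)
  \<comment> \<open>Makes the regularity error N * 4\<eta> equal to 1/60.\<close>
  define \<eta> where "\<eta> = 1 / (240 * N)"
  have \<eta>: "\<eta> > 0" using N by (simp add: \<eta>_def)
  from weak_regularity[OF finC \<eta>, where 'a = nat] obtain t where t: "t > 0" and
    FK1: "\<forall>(V :: nat set) w g. finite V \<and> V \<noteq> {} \<and> (\<forall>c\<in>C. \<forall>u\<in>V. \<forall>v\<in>V. 0 \<le> w c u v \<and> w c u v \<le> 1 \<and> 0 \<le> g c u v \<and> g c u v \<le> 1) \<longrightarrow>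
     (\<exists>l. (\<forall>u\<in>V. l u < t) \<and> (\<forall>c\<in>C. \<forall>A\<subseteq>V. \<forall>B\<subseteq>V. 
        \<bar>\<Sum>u\<in>A. \<Sum>v\<in>B. w c u v * (g c u v - blk_avg V l (w c) (g c) (l u) (l v))\<bar> \<le> \<eta> * (real (card V))\<^sup>2))"
    by (elim exE conjE)
  \<comment> \<open>Chosen after \<open>t\<close>, so that each exchange with the step function
    costs N t^2 \<rho> = 1/60.\<close>
  define \<rho> where "\<rho> = 1 / (60 * N * (real t)\<^sup>2)"
  have t1: "(real t)\<^sup>2 \<ge> 1" using t by simp
  have Nt: "N * (real t)\<^sup>2 \<ge> 1" using mult_mono[of 1 N 1 "(real t)\<^sup>2"] N t1 by simp
  have \<rho>: "\<rho> > 0" "\<rho> \<le> 1" using Nt N t by (simp_all add: \<rho>_def)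
  \<comment> \<open>One half of \<rho>^4 bounds the 4-cycle density on \<open>V\<close> and the
    other half is the sampling error; together they give \<rho> on \<open>S\<close> by
    \<open>cutb_of_c4\<close>.\<close>
  define \<sigma> where "\<sigma> = \<rho> ^ 4 / 2"
  have \<sigma>: "\<sigma> > 0" "\<sigma> / 4 > 0" using \<rho> by (simp_all add: \<sigma>_def)
  have \<sigma>\<rho>: "\<sigma> \<le> \<rho>"
  proof -
    have "\<rho> ^ 4 \<le> \<rho> ^ 1" using \<rho> by (intro power_decreasing) auto
    then show ?thesis using \<rho> by (simp add: \<sigma>_def)
  qed
  have "finite {()}" by simp
  \<comment> \<open>Frieze-Kannan regularity in its ordinary form, with a single index and, later,
    weight 1. The accuracy is \<sigma>/4 since \<open>cutb_of_sets\<close> costs a factor 4.\<close>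
  from weak_regularity[OF this \<sigma>(2), where 'a = nat] obtain K where K: "K > 0" and
    FK2: "\<forall>(V :: nat set) w g. finite V \<and> V \<noteq> {} \<and> (\<forall>c\<in>{()}. \<forall>u\<in>V. \<forall>v\<in>V. 0 \<le> w c u v \<and> w c u v \<le> 1 \<and> 0 \<le> g c u v \<and> g c u v \<le> 1) \<longrightarrow>
     (\<exists>l. (\<forall>u\<in>V. l u < K) \<and> (\<forall>c\<in>{()}. \<forall>A\<subseteq>V. \<forall>B\<subseteq>V. 
        \<bar>\<Sum>u\<in>A. \<Sum>v\<in>B. w c u v * (g c u v - blk_avg V l (w c) (g c) (l u) (l v))\<bar> \<le> \<sigma> / 4 * (real (card V))\<^sup>2))"
    by (elim exE conjE)
  \<comment> \<open>q \<kappa> = 1/120 is half of the budget for cells; the other half goes to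
    rounding.\<close>
  define \<kappa> where "\<kappa> = 1 / (120 * real q)"
  \<comment> \<open>2\<theta> = 1/q: one \<theta> for the diagonal of \<open>S\<close>, one for the
    deviation of the edge density.\<close>
  define \<theta> where "\<theta> = 1 / (2 * real q)"
  have \<kappa>\<theta>: "\<kappa> > 0" "\<theta> > 0" using q by (simp_all add: \<kappa>_def \<theta>_def)
  from ex_good_sample[OF \<sigma>(1) \<kappa>\<theta>, of K] obtain R1 where R1: "\<forall>(V :: nat set) r f g (ty :: nat \<Rightarrow> nat) \<A>. finite V \<and> R1 \<le> r \<and> r \<le> card V \<and> (\<forall>u\<in>V. \<forall>v\<in>V. \<bar>f u v\<bar> \<le> 1 \<and> \<bar>g u v\<bar> \<le> 1) \<and>
     \<A> \<subseteq> subs V r \<and> real (card \<A>) > 1/3 * real (card V choose r) \<longrightarrow>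
     (\<exists>S\<in>\<A>. avg (tup S 4) (c4 f) \<le> avg (tup V 4) (c4 f) + \<sigma> \<and>
        (\<Sum>a<K. \<bar>real (card {x\<in>S. ty x = a}) / real (card S) - real (card {x\<in>V. ty x = a}) / real (card V)\<bar>) \<le> \<kappa> \<and>
        \<bar>avg (tup S 2) (\<lambda>xs. g (xs ! 0) (xs ! 1)) - avg (tup V 2) (\<lambda>xs. g (xs ! 0) (xs ! 1))\<bar> \<le> \<theta>)" by (elim exE)
  \<comment> \<open>In the sample size, 2q serves \<theta>, 240 q^2 the repetitions in tuples, and
    120 q K t the rounding of labels.\<close>
  show ?thesis
  proof (intro exI[of _ "R1 + 2 * q + 240 * q\<^sup>2 + 120 * q * (K * t) + 1"] allI impI, elim conjE)
    fix G r
    assume G: "is_graph G" and R: "R1 + 2 * q + 240 * q\<^sup>2 + 120 * q * (K * t) + 1 \<le> r" and r: "r \<le> card (verts G)"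
      and large: "real (card {S \<in> subs (verts G) r. accepts k m T q (induced G S)}) > 1/3 * real (card (verts G) choose r)"
    define V where "V = verts G"
    define g where "g = adj G"
    have V: "finite V" using G by (simp add: V_def is_graph_def)
    have n: "r \<le> card V" using r by (simp add: V_def)
    have r0: "real r > 0" using R by simp
    have V_ne: "V \<noteq> {}" using n R by auto
    have g_bin: "g u v = 0 \<or> g u v = 1" for u v unfolding g_def by (rule adj_01)
    have g_le: "0 \<le> g u v \<and> g u v \<le> 1" for u v using g_bin[of u v] by auto
    have "finite V \<and> V \<noteq> {} \<and> (\<forall>c\<in>{()}. \<forall>u\<in>V. \<forall>v\<in>V. 0 \<le> (1::real) \<and> 1 \<le> (1::real) \<and> 0 \<le> g u v \<and> g u v \<le> 1)"
      using V V_ne g_le by simp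
    from FK2[rule_format, OF this] obtain ty where ty: "\<forall>u\<in>V. ty u < K" and
      regV: "\<forall>c\<in>{()}. \<forall>A\<subseteq>V. \<forall>B\<subseteq>V. \<bar>\<Sum>u\<in>A. \<Sum>v\<in>B. 1 * (g u v - blk_avg V ty (\<lambda>_ _. 1) g (ty u) (ty v))\<bar> \<le> \<sigma> / 4 * (real (card V))\<^sup>2"
      by (elim exE conjE)
    define Ub where "Ub = blk_avg V ty (\<lambda>_ _. 1) g"
    have Ub: "0 \<le> Ub i j \<and> Ub i j \<le> 1" for i j
      unfolding Ub_def using g_le by (auto intro: blk_avg_nonneg blk_avg_le_1)
    define f where "f = (\<lambda>u v. g u v - Ub (ty u) (ty v))"
    have f1: "\<bar>f u v\<bar> \<le> 1" for u v using g_le[of u v] Ub[of "ty u" "ty v"] by (auto simp: f_def abs_le_iff)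
    have cutV': "cutb V f \<sigma>"
    proof -
      have "cutb V f (4 * (\<sigma> / 4))"
        using regV by (intro cutb_of_sets V) (simp add: f_def Ub_def)
      then show ?thesis by simp
    qed
    have cutV: "cutb V f \<rho>" by (rule cutb_mono[OF cutV' \<sigma>\<rho>])
    have c4V: "avg (tup V 4) (c4 f) \<le> \<sigma>" using c4_le_cutb[OF V V_ne cutV' f1] by (simp add: abs_le_iff)
    define \<A> where "\<A> = {S \<in> subs V r. accepts k m T q (induced G S)}"
    have "finite V \<and> R1 \<le> r \<and> r \<le> card V \<and> (\<forall>u\<in>V. \<forall>v\<in>V. \<bar>f u v\<bar> \<le> 1 \<and> \<bar>g u v\<bar> \<le> 1) \<and>
     \<A> \<subseteq> subs V r \<and> real (card \<A>) > 1/3 * real (card V choose r)"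
      using V R n f1 g_le large by (auto simp: \<A>_def V_def)
    from R1[rule_format, where ty = ty, OF this] obtain S where S: "S \<in> \<A>" and c4S: "avg (tup S 4) (c4 f) \<le> avg (tup V 4) (c4 f) + \<sigma>" and
      types: "(\<Sum>a<K. \<bar>real (card {x\<in>S. ty x = a}) / real (card S) - real (card {x\<in>V. ty x = a}) / real (card V)\<bar>) \<le> \<kappa>" and
      dens: "\<bar>avg (tup S 2) (\<lambda>xs. g (xs ! 0) (xs ! 1)) - avg (tup V 2) (\<lambda>xs. g (xs ! 0) (xs ! 1))\<bar> \<le> \<theta>"
      by (elim bexE conjE)
    have SV: "S \<subseteq> V" and cS: "card S = r" and acc: "accepts k m T q (induced G S)"
      using S by (auto simp: \<A>_def subs_def)
    have finS: "finite S" using SV V finite_subset by blast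
    have S_ne: "S \<noteq> {}" using cS r0 by auto
    have cutS: "cutb S f \<rho>"
    proof (rule cutb_of_c4[OF finS])
      show "avg (tup S 4) (c4 f) \<le> \<rho> ^ 4" using c4S c4V by (simp add: \<sigma>_def)
    qed (use \<rho> in simp)
    obtain L0 where L0: "is_cdigraph k L0" and sh: "shadow m L0 = induced G S" and sp: "sample_prob dverts dinduced T L0 q \<ge> 1/2"
      using acc unfolding accepts_def by blast
    have dv: "dverts L0 = S" using arg_cong[OF sh, of verts] by simp
    have edg: "ed m (clr L0 u v) \<longleftrightarrow> g u v = 1" if "u \<in> S" "v \<in> S" "u \<noteq> v" for u v
      unfolding g_def by (rule accept_induced_clr[OF G L0 sh that])
    have "finite S \<and> S \<noteq> {} \<and> (\<forall>c\<in>C. \<forall>u\<in>S. \<forall>v\<in>S. 0 \<le> wt m g c u v \<and> wt m g c u v \<le> 1 \<and>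
        0 \<le> (of_bool (u \<noteq> v \<and> clr L0 u v = c) :: real) \<and> (of_bool (u \<noteq> v \<and> clr L0 u v = c) :: real) \<le> 1)"
      using finS S_ne g_le by (simp add: wt_def)
    from FK1[rule_format, OF this] obtain l where l: "\<forall>u\<in>S. l u < t" and
      regS: "\<forall>c\<in>C. \<forall>A\<subseteq>S. \<forall>B\<subseteq>S. \<bar>\<Sum>u\<in>A. \<Sum>v\<in>B. wt m g c u v * (of_bool (u \<noteq> v \<and> clr L0 u v = c) - 
         blk_avg S l (wt m g c) (\<lambda>u v. of_bool (u \<noteq> v \<and> clr L0 u v = c)) (l u) (l v))\<bar> \<le> \<eta> * (real (card S))\<^sup>2"
      by (elim exE conjE)
    interpret recolouring V S g "clr L0" k m q t K A ty l Ub \<eta> \<rho> \<kappa>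
    proof unfold_locales
      show "clr L0 v u = prod.swap (clr L0 u v) \<and> (ed m (clr L0 u v) \<longleftrightarrow> g u v = 1)" if "u \<in> S" "v \<in> S" "u \<noteq> v" for u v
        using edg[OF that] clr_swap by blast
      show "\<bar>\<Sum>u\<in>X. \<Sum>v\<in>Y. wt m g c u v * (of_bool (u \<noteq> v \<and> clr L0 u v = c) -
          blk_avg S l (wt m g c) (\<lambda>u v. of_bool (u \<noteq> v \<and> clr L0 u v = c)) (l u) (l v))\<bar> \<le> \<eta> * (real (card S))\<^sup>2"
        if "c \<in> {1..k} \<times> {1..k}" "X \<subseteq> S" "Y \<subseteq> S" for c X Y
        using regS[rule_format, of c X Y] that unfolding C_def by blast
      show "cutb S (\<lambda>u v. g u v - Ub (ty u) (ty v)) \<rho>" using cutS unfolding f_def .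
      show "cutb V (\<lambda>u v. g u v - Ub (ty u) (ty v)) \<rho>" using cutV unfolding f_def .
      show "g v u = g u v" for u v unfolding g_def by (rule adj_swap)
    qed (use V SV S_ne mk A g_bin l t ty Ub types in auto)
    obtain col where col: "\<forall>u\<in>V. \<forall>v\<in>V. u \<noteq> v \<longrightarrow> col u v \<in> {1..k} \<times> {1..k} \<and> col v u = prod.swap (col u v) \<and>
       (g u v = 1 \<longrightarrow> ed m (col u v)) \<and> (g u v = 0 \<and> m < k \<longrightarrow> \<not> ed m (col u v))"
      and le: "avg (tup S q) (kern q A (\<lambda>c u v. of_bool (u \<noteq> v \<and> clr L0 u v = c))) 
       \<le> avg (itup V q) (kern q A (\<lambda>c u v. of_bool (col u v = c))) + 
          real (card A) * real (card (idx q)) * (4 * \<eta>) + 2 * (real (card A) * real (card (idx q)) * ((real t)\<^sup>2 * \<rho>)) + 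
          real q * (\<kappa> + real (K * t) / real (card V)) + 2 * real (q\<^sup>2) / real (card V)"
      using recolour by (elim exE conjE)
    have small_q: "2 * real (q\<^sup>2) / real p \<le> 1/120" if "r \<le> p" for p
    proof -
      have "240 * q\<^sup>2 \<le> p" using R that by simp
      then have "real (240 * q\<^sup>2) \<le> real p" by (rule of_nat_mono)
      moreover have "real p > 0" using r0 that by simp
      ultimately show ?thesis by (simp add: pos_divide_le_eq)
    qed
    have kb: "\<bar>kern q A (\<lambda>c u v. of_bool (u \<noteq> v \<and> clr L0 u v = c)) xs\<bar> \<le> 1" if "xs \<in> tup S q" for xs
    proof -
      have "0 \<le> kern q A X xs \<and> kern q A X xs \<le> 1"
        by (rule kern_bounds[OF AC finC that]) (use X01 X_sum[OF finC] in auto)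
      then show ?thesis unfolding X_def[abs_def] by simp
    qed
    have "avg (itup S q) (kern q A (\<lambda>c u v. of_bool (u \<noteq> v \<and> clr L0 u v = c))) \<ge> 1/2"
      using sp sample_prob_kern[OF T L0, of q] cS R by (simp add: dv A_def)
    moreover have "\<bar>avg (tup S q) (kern q A (\<lambda>c u v. of_bool (u \<noteq> v \<and> clr L0 u v = c))) - 
        avg (itup S q) (kern q A (\<lambda>c u v. of_bool (u \<noteq> v \<and> clr L0 u v = c)))\<bar> \<le> 2 * real (q\<^sup>2) / real (card S)"
      by (rule avg_tup_itup[OF finS kb])
    ultimately have start: "avg (tup S q) (kern q A (\<lambda>c u v. of_bool (u \<noteq> v \<and> clr L0 u v = c))) \<ge> 1/2 - 1/120"
      unfolding cS using small_q[OF order.refl] by linarith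
    have e1: "real (card A) * real (card (idx q)) * (4 * \<eta>) \<le> 1/60"
    proof -
      have "real (card A) * real (card (idx q)) * (4 * \<eta>) \<le> N * (4 * \<eta>)" using N \<eta> by (intro mult_right_mono) auto
      also have "\<dots> = 1/60" using N by (simp add: \<eta>_def)
      finally show ?thesis .
    qed
    have e2: "real (card A) * real (card (idx q)) * ((real t)\<^sup>2 * \<rho>) \<le> 1/60"
    proof -
      have "real (card A) * real (card (idx q)) * ((real t)\<^sup>2 * \<rho>) \<le> N * ((real t)\<^sup>2 * \<rho>)" using N \<rho> by (intro mult_right_mono) auto
      also have "\<dots> = 1/60" using N t by (simp add: \<rho>_def)
      finally show ?thesis .
    qed
    have e3: "real q * (\<kappa> + real (K * t) / real (card V)) \<le> 1/60"
    proof -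
      have "120 * q * (K * t) \<le> card V" using R n by simp
      then have "real (120 * q * (K * t)) \<le> real (card V)" by (rule of_nat_mono)
      moreover have "real (card V) > 0" using n r0 by simp
      ultimately have "real q * (real (K * t) / real (card V)) \<le> 1/120" by (simp add: pos_divide_le_eq)
      moreover have "real q * \<kappa> = 1/120" using q by (simp add: \<kappa>_def)
      ultimately show ?thesis unfolding distrib_left by linarith
    qed
    \<comment> \<open>The losses are 1/120 on \<open>S\<close>, then 1/60, twice 1/60, 1/60 and
      1/120, in all 1/12, so at least 5/12 remains.\<close>
    have big: "avg (itup V q) (kern q A (\<lambda>c u v. of_bool (col u v = c))) > 1/3"
      using le start e1 e2 e3 small_q[OF n] by linarith
    define L where "L = of_col V col"
    have L: "is_cdigraph k L" unfolding L_def by (intro is_cdigraph_of_col V) (use col in blast)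
    have dL: "dverts L = V" by (simp add: L_def)
    have cL: "clr L u v = col u v" if "u \<in> V" "v \<in> V" "u \<noteq> v" for u v
      unfolding L_def by (rule clr_of_col[OF that]) (use col that in blast)
    have "avg (itup V q) (kern q A (\<lambda>c u v. of_bool (col u v = c))) = avg (itup V q) (kern q A (\<lambda>c u v. of_bool (u \<noteq> v \<and> clr L u v = c)))"
      by (intro avg_cong kern_cong_itup[OF A]) (auto simp: cL)
    also have "\<dots> = sample_prob dverts dinduced T L q"
      using sample_prob_kern[OF T L, of q] n R by (simp add: dL A_def)
    finally have spL: "sample_prob dverts dinduced T L q > 1/3" using big by simp
    have sub: "diff_edges (shadow m L) G \<subseteq> (if m < k then {} else (\<lambda>(u, v). {u, v}) ` {(u, v) \<in> V \<times> V. g u v = 0})"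
    proof
      fix e assume e: "e \<in> diff_edges (shadow m L) G"
      then have "(e \<in> edges (shadow m L) \<or> e \<in> edges G)" and ne: "\<not> (e \<in> edges (shadow m L) \<longleftrightarrow> e \<in> edges G)"
        by (auto simp: diff_edges_def)
      then obtain u v where uv: "e = {u, v}" "u \<in> V" "v \<in> V" "u \<noteq> v"
        using graph_edgeD[OF G] graph_edgeD[OF is_graph_shadow[OF L, of m]] unfolding verts_shadow dL V_def by metis
      have "e \<in> edges (shadow m L) \<longleftrightarrow> ed m (col u v)"
        using shadow_edge_iff[OF L, of u v m] uv cL dL by simp
      moreover have "e \<in> edges G \<longleftrightarrow> g u v = 1" using uv by (simp add: g_def adj_def)
      ultimately have "\<not> (ed m (col u v) \<longleftrightarrow> g u v = 1)" using ne by blast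
      moreover have "(g u v = 1 \<longrightarrow> ed m (col u v)) \<and> (g u v = 0 \<and> m < k \<longrightarrow> \<not> ed m (col u v))"
        using col uv(2-4) by blast
      ultimately have "g u v = 0" "\<not> m < k" using g_bin[of u v] by blast+
      then show "e \<in> (if m < k then {} else (\<lambda>(u, v). {u, v}) ` {(u, v) \<in> V \<times> V. g u v = 0})" using uv by auto
    qed
    have diff: "real (card (diff_edges (shadow m L) G)) \<le> (real (card V))\<^sup>2 / real q"
    proof (cases "m < k")
      case True
      then have "diff_edges (shadow m L) G = {}" using sub by simp
      then show ?thesis by simp
    next
      case False
      \<comment> \<open>For \<open>m = k\<close> non-edges cannot be coloured correctly, but then \<open>S\<close> is complete and \<open>G\<close> has few of them.\<close>
      have fin: "finite {(u, v) \<in> V \<times> V. g u v = 0}" by (rule finite_subset[of _ "V \<times> V"]) (use V in auto)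
      have "card (diff_edges (shadow m L) G) \<le> card ((\<lambda>(u, v). {u, v}) ` {(u, v) \<in> V \<times> V. g u v = 0})"
        using sub False fin by (intro card_mono) auto
      also have "\<dots> \<le> card {(u, v) \<in> V \<times> V. g u v = 0}" by (rule card_image_le[OF fin])
      finally have "real (card (diff_edges (shadow m L) G)) \<le> real (card {(u, v) \<in> V \<times> V. g u v = 0})" by (rule of_nat_mono)
      also have "\<dots> = (1 - avg (tup V 2) (\<lambda>xs. g (xs ! 0) (xs ! 1))) * (real (card V))\<^sup>2"
        by (rule card_nonadjacent[OF V g_bin])
      also have "\<dots> \<le> 1 / real q * (real (card V))\<^sup>2"
      proof (rule mult_right_mono)
        have "g u v = 1" if uv: "u \<in> S" "v \<in> S" "u \<noteq> v" for u v
        proof -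
          have "dcol L0 (u, v) \<in> {1..k}" using dcol_range[OF L0] dv uv by blast
          then have "ed m (clr L0 u v)" using False by (simp add: ed_def clr_def)
          then show ?thesis using edg[OF uv] by blast
        qed
        then have "avg (tup S 2) (\<lambda>xs. g (xs ! 0) (xs ! 1)) \<ge> 1 - 1 / real (card S)"
          using g_le by (intro avg_pairs_complete finS S_ne) auto
        moreover have "1 / real (card S) \<le> \<theta>"
          unfolding \<theta>_def cS using R q by (intro divide_left_mono) auto
        moreover have "\<theta> + \<theta> = 1 / real q" by (simp add: \<theta>_def)
        ultimately show "1 - avg (tup V 2) (\<lambda>xs. g (xs ! 0) (xs ! 1)) \<le> 1 / real q" using dens by linarith
      qed simp
      finally show ?thesis by simp
    qed
    show "\<exists>L. is_cdigraph k L \<and> dverts L = verts G \<and> sample_prob dverts dinduced T L q > 1/3 \<and>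
        real (card (diff_edges (shadow m L) G)) \<le> (real (card (verts G)))\<^sup>2 / real q"
      using L dL spL diff unfolding V_def by blast
  qed
qed

section \<open>Edit distance and the two implications\<close>

text \<open>An empty family has infimum infinity and counts as far for every \<open>x\<close>.
  Otherwise the infimum is attained by well-ordering.\<close>

lemma enat_ge_real_INF:
  "enat_ge_real (INF H\<in>A. enat (f H)) x \<longleftrightarrow> (\<forall>H\<in>A. real (f H) \<ge> x)"
proof
  assume *: "enat_ge_real (INF H\<in>A. enat (f H)) x"
  show "\<forall>H\<in>A. real (f H) \<ge> x"
  proof
    fix H assume H: "H \<in> A"
    have le: "(INF H\<in>A. enat (f H)) \<le> enat (f H)" using H by (rule INF_lower)
    then obtain p where p: "(INF H\<in>A. enat (f H)) = enat p" by (cases "INF H\<in>A. enat (f H)") auto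
    then have "real p \<ge> x" using * by (simp add: enat_ge_real_def)
    moreover have "p \<le> f H" using le p by simp
    ultimately show "real (f H) \<ge> x" by linarith
  qed
next
  assume *: "\<forall>H\<in>A. real (f H) \<ge> x"
  show "enat_ge_real (INF H\<in>A. enat (f H)) x"
    unfolding enat_ge_real_def
  proof (intro allI impI)
    fix p assume p: "(INF H\<in>A. enat (f H)) = enat p"
    have "A \<noteq> {}" using p by (auto simp: top_enat_def)
    then have "(\<lambda>H. enat (f H)) ` A \<noteq> {}" by simp
    from wellorder_InfI[OF _, of _ "(\<lambda>H. enat (f H)) ` A"] this
    have "Inf ((\<lambda>H. enat (f H)) ` A) \<in> (\<lambda>H. enat (f H)) ` A" by blast
    then obtain H where "H \<in> A" "enat p = enat (f H)" using p by auto
    then show "real p \<ge> x" using * by auto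
  qed
qed

lemma graph_far_iff:
  "enat_ge_real (graph_edit_dist P G) x \<longleftrightarrow> (\<forall>H\<in>P. verts H = verts G \<longrightarrow> real (card (diff_edges G H)) \<ge> x)"
  unfolding graph_edit_dist_def diff_edges_def enat_ge_real_INF by blast

definition diff_pairs :: "cdigraph \<Rightarrow> cdigraph \<Rightarrow> (nat \<times> nat) set" where
  "diff_pairs L M = {(u, v). u \<in> dverts L \<and> v \<in> dverts L \<and> u \<noteq> v \<and> dcol L (u, v) \<noteq> dcol M (u, v)}"

lemma cdigraph_far_iff:
  "enat_ge_real (cdigraph_edit_dist Q L) x \<longleftrightarrow> (\<forall>M\<in>Q. dverts M = dverts L \<longrightarrow> real (card (diff_pairs L M)) \<ge> x)"
  unfolding cdigraph_edit_dist_def diff_pairs_def enat_ge_real_INF by blast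

lemma finite_diff_pairs: "is_cdigraph k L \<Longrightarrow> finite (diff_pairs L M)"
  by (rule finite_subset[of _ "dverts L \<times> dverts L"]) (auto simp: diff_pairs_def is_cdigraph_def)

lemma finite_edges:
  assumes "is_graph G"
  shows "finite (edges G)"
proof (rule finite_subset)
  show "edges G \<subseteq> Pow (verts G)" using graph_edgeD[OF assms] by fastforce
  show "finite (Pow (verts G))" using assms by (simp add: is_graph_def)
qed

lemma diff_edges_commute: "diff_edges G H = diff_edges H G"
  by (auto simp: diff_edges_def)

lemma finite_diff_edges: "is_graph G \<Longrightarrow> is_graph H \<Longrightarrow> finite (diff_edges G H)"
  by (simp add: diff_edges_def finite_edges)

lemma card_diff_edges_triangle:
  assumes "is_graph F" "is_graph G" "is_graph H"
  shows "card (diff_edges F H) \<le> card (diff_edges F G) + card (diff_edges G H)"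
proof -
  have "card (diff_edges F H) \<le> card (diff_edges F G \<union> diff_edges G H)"
    by (intro card_mono finite_UnI finite_diff_edges assms) (auto simp: diff_edges_def)
  then show ?thesis using card_Un_le order.trans by blast
qed

text \<open>An edge on which the shadows differ has an orientation on which the colours differ, so
  taking shadows does not increase distances.\<close>

lemma card_diff_shadow:
  assumes L: "is_cdigraph k L" and M: "is_cdigraph k M" and dv: "dverts M = dverts L"
  shows "card (diff_edges (shadow m L) (shadow m M)) \<le> card (diff_pairs L M)"
proof -
  have "diff_edges (shadow m L) (shadow m M) \<subseteq> (\<lambda>(u, v). {u, v}) ` diff_pairs L M"
  proof
    fix e assume "e \<in> diff_edges (shadow m L) (shadow m M)"
    then have mem: "e \<in> edges (shadow m L) \<or> e \<in> edges (shadow m M)" and ne: "\<not> (e \<in> edges (shadow m L) \<longleftrightarrow> e \<in> edges (shadow m M))"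
      by (auto simp: diff_edges_def)
    obtain u v where uv: "e = {u, v}" "u \<in> dverts L" "v \<in> dverts L" "u \<noteq> v"
      using mem graph_edgeD[OF is_graph_shadow[OF L, of m], of e] graph_edgeD[OF is_graph_shadow[OF M, of m], of e] dv
      unfolding verts_shadow by metis
    have "clr L u v \<noteq> clr M u v"
      using ne shadow_edge_iff[OF L uv(2-4), of m] shadow_edge_iff[OF M, of u v m] uv dv by metis
    then have "(u, v) \<in> diff_pairs L M \<or> (v, u) \<in> diff_pairs L M"
      using uv by (auto simp: clr_def diff_pairs_def)
    then show "e \<in> (\<lambda>(u, v). {u, v}) ` diff_pairs L M"
    proof
      assume "(u, v) \<in> diff_pairs L M"
      then show ?thesis using uv by (intro image_eqI[of _ _ "(u, v)"]) auto
    next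
      assume "(v, u) \<in> diff_pairs L M"
      then show ?thesis using uv by (intro image_eqI[of _ _ "(v, u)"]) auto
    qed
  qed
  then have "card (diff_edges (shadow m L) (shadow m M)) \<le> card ((\<lambda>(u, v). {u, v}) ` diff_pairs L M)"
    using finite_diff_pairs[OF L] by (intro card_mono) auto
  also have "\<dots> \<le> card (diff_pairs L M)" by (rule card_image_le[OF finite_diff_pairs[OF L]])
  finally show ?thesis .
qed

section \<open>Pulling properties and tests back to coloured digraphs\<close>

lemma sample_prob_subs:
  "sample_prob Vf ind T G r = real (card {S \<in> subs (Vf G) r. ind G S \<in> T}) / real (card (Vf G) choose r)"
proof -
  have "{S. S \<subseteq> Vf G \<and> card S = r \<and> ind G S \<in> T} = {S \<in> subs (Vf G) r. ind G S \<in> T}"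
    by (auto simp: subs_def)
  then show ?thesis by (simp add: sample_prob_def)
qed

lemma shadow_dinduced:
  assumes L: "is_cdigraph k L" and S: "S \<subseteq> dverts L"
  shows "shadow m (dinduced L S) = induced (shadow m L) S"
proof -
  have "{{u, v} |u v. u \<in> S \<and> v \<in> S \<and> u \<noteq> v \<and> (dcol (dinduced L S) (u, v) \<in> {1..m} \<or> dcol (dinduced L S) (v, u) \<in> {1..m})} = 
     {e \<in> edges (shadow m L). e \<subseteq> S}" (is "?A = ?B")
  proof (intro equalityI subsetI)
    fix e assume "e \<in> ?A"
    then obtain u v where "e = {u, v}" "u \<in> S" "v \<in> S" "u \<noteq> v" "dcol L (u, v) \<in> {1..m} \<or> dcol L (v, u) \<in> {1..m}"
      unfolding dcol_dinduced by auto
    then show "e \<in> ?B" using S unfolding shadow_def edges_def by auto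
  next
    fix e assume e: "e \<in> ?B"
    then obtain u v where uv: "e = {u, v}" "u \<noteq> v" "dcol L (u, v) \<in> {1..m} \<or> dcol L (v, u) \<in> {1..m}"
      unfolding shadow_def edges_def by auto
    then have "u \<in> S" "v \<in> S" using e by auto
    then show "e \<in> ?A" using uv unfolding dcol_dinduced by auto
  qed
  then show ?thesis unfolding shadow_def[of m "dinduced L S"] induced_def by simp
qed

lemma shadow_edges_image:
  assumes f: "bij_betw f (dverts L) (dverts M)"
    and c: "\<And>u v. u \<in> dverts L \<Longrightarrow> v \<in> dverts L \<Longrightarrow> u \<noteq> v \<Longrightarrow> dcol M (f u, f v) = dcol L (u, v)"
  shows "edges (shadow m M) = (\<lambda>e. f ` e) ` edges (shadow m L)"
proof (intro equalityI subsetI)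
  fix e assume "e \<in> edges (shadow m M)"
  then obtain x y where e: "e = {x, y}" and xy: "x \<in> dverts M" "y \<in> dverts M" "x \<noteq> y"
    and col: "dcol M (x, y) \<in> {1..m} \<or> dcol M (y, x) \<in> {1..m}"
    unfolding shadow_def edges_def by auto
  have "x \<in> f ` dverts L" "y \<in> f ` dverts L" using f xy by (simp_all add: bij_betw_def)
  then obtain u v where uv: "u \<in> dverts L" "v \<in> dverts L" "x = f u" "y = f v" by (elim imageE)
  then have "u \<noteq> v" using xy by blast
  then have "{u, v} \<in> edges (shadow m L)"
    using uv col c[of u v] c[of v u] unfolding shadow_def edges_def by auto
  moreover have "e = f ` {u, v}" using e uv by simp
  ultimately show "e \<in> (\<lambda>e. f ` e) ` edges (shadow m L)" by blast
next
  fix e assume "e \<in> (\<lambda>e. f ` e) ` edges (shadow m L)"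
  then obtain u v where e: "e = f ` {u, v}" and uv: "u \<in> dverts L" "v \<in> dverts L" "u \<noteq> v"
    and col: "dcol L (u, v) \<in> {1..m} \<or> dcol L (v, u) \<in> {1..m}"
    unfolding shadow_def edges_def by auto
  have "f u \<in> dverts M" "f v \<in> dverts M" "f u \<noteq> f v"
    using f uv by (auto simp: bij_betw_def inj_on_def)
  moreover have "e = {f u, f v}" using e by simp
  moreover have "dcol M (f u, f v) \<in> {1..m} \<or> dcol M (f v, f u) \<in> {1..m}"
    using col c[OF uv] c[OF uv(2,1) uv(3)[symmetric]] by simp
  ultimately show "e \<in> edges (shadow m M)"
    unfolding shadow_def edges_def snd_conv by blast
qed

lemma graph_iso_shadow:
  assumes "cdigraph_iso L M"
  shows "graph_iso (shadow m L) (shadow m M)"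
proof -
  obtain f where "bij_betw f (dverts L) (dverts M)"
    "\<And>u v. u \<in> dverts L \<Longrightarrow> v \<in> dverts L \<Longrightarrow> u \<noteq> v \<Longrightarrow> dcol M (f u, f v) = dcol L (u, v)"
    using assms unfolding cdigraph_iso_def by blast
  then show ?thesis using shadow_edges_image[of f L M m] unfolding graph_iso_def verts_shadow by blast
qed

lemma pullback_property:
  assumes "graph_property T"
  shows "cdigraph_property k {L. is_cdigraph k L \<and> shadow m L \<in> T}"
  unfolding cdigraph_property_def
proof (intro conjI ballI allI impI)
  fix L M assume "L \<in> {L. is_cdigraph k L \<and> shadow m L \<in> T} \<and> is_cdigraph k M \<and> cdigraph_iso L M"
  then have "shadow m L \<in> T" "is_cdigraph k M" "graph_iso (shadow m L) (shadow m M)" "is_graph (shadow m M)"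
    using graph_iso_shadow[of L M m] is_graph_shadow[of k M m] by simp_all
  then show "M \<in> {L. is_cdigraph k L \<and> shadow m L \<in> T}" using assms unfolding graph_property_def by blast
qed simp

lemma sample_prob_pullback:
  assumes L: "is_cdigraph k L"
  shows "sample_prob dverts dinduced {L. is_cdigraph k L \<and> shadow m L \<in> T} L r = sample_prob verts induced T (shadow m L) r"
proof -
  have "{S \<in> subs (dverts L) r. dinduced L S \<in> {L. is_cdigraph k L \<and> shadow m L \<in> T}} = 
    {S \<in> subs (dverts L) r. induced (shadow m L) S \<in> T}"
    using is_cdigraph_dinduced[OF L] shadow_dinduced[OF L] by (auto simp: subs_def)
  then show ?thesis unfolding sample_prob_subs by simp
qed

lemma graph_eqI: "verts G = verts H \<Longrightarrow> edges G = edges H \<Longrightarrow> G = H"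
  unfolding verts_def edges_def by (rule prod_eqI)

text \<open>Only pairs on differing edges are recoloured: both orientations get 1 on an edge of
  \<open>H\<close> and 2 on a non-edge. The two orientations account for the factor 2.\<close>

lemma ex_lift:
  assumes L: "is_cdigraph 2 L" and H: "is_graph H" and vH: "verts H = dverts L"
  shows "\<exists>M. is_cdigraph 2 M \<and> shadow 1 M = H \<and> dverts M = dverts L \<and>
     card (diff_pairs L M) \<le> 2 * card (diff_edges (shadow 1 L) H)"
proof -
  let ?V = "dverts L" and ?D = "diff_edges (shadow 1 L) H"
  define c where "c = (\<lambda>u v. if {u, v} \<notin> ?D then dcol L (u, v) else if {u, v} \<in> edges H then 1 else (2 :: nat))"
  define M where "M = (?V, \<lambda>(u, v). if u \<in> ?V \<and> v \<in> ?V \<and> u \<noteq> v then c u v else 0)"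
  have dM [simp]: "dverts M = ?V" by (simp add: M_def dverts_def)
  have cM: "dcol M (u, v) = (if u \<in> ?V \<and> v \<in> ?V \<and> u \<noteq> v then c u v else 0)" for u v by (simp add: M_def dcol_def)
  have M: "is_cdigraph 2 M"
    unfolding is_cdigraph_def dM
  proof (intro conjI allI impI)
    show "finite ?V" using L by (simp add: is_cdigraph_def)
  next
    fix u v assume uv: "u \<in> ?V \<and> v \<in> ?V \<and> u \<noteq> v"
    then show "dcol M (u, v) \<in> {1..2}" using dcol_range[OF L, of u v] unfolding cM c_def by simp
  next
    fix u v assume "\<not> (u \<in> ?V \<and> v \<in> ?V \<and> u \<noteq> v)"
    then show "dcol M (u, v) = 0" unfolding cM by argo
  qed
  have edge: "{u, v} \<in> edges (shadow 1 M) \<longleftrightarrow> {u, v} \<in> edges H" if uv: "u \<in> ?V" "v \<in> ?V" "u \<noteq> v" for u v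
  proof -
    have "{u, v} \<in> edges (shadow 1 M) \<longleftrightarrow> ed 1 (clr M u v)" using shadow_edge_iff[OF M, of u v 1] uv by simp
    also have "clr M u v = (c u v, c v u)" using uv by (simp add: clr_def cM)
    also have "ed 1 (c u v, c v u) \<longleftrightarrow> {u, v} \<in> edges H"
    proof (cases "{u, v} \<in> ?D")
      case True
      then show ?thesis by (simp add: c_def ed_def insert_commute[of v u])
    next
      case False
      then have "(c u v, c v u) = clr L u v" by (simp add: c_def clr_def insert_commute[of v u])
      then have "ed 1 (c u v, c v u) \<longleftrightarrow> {u, v} \<in> edges (shadow 1 L)" using shadow_edge_iff[OF L uv, of 1] by simp
      then show ?thesis using False by (auto simp: diff_edges_def)
    qed
    finally show ?thesis .
  qed
  have "shadow 1 M = H"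
  proof (rule graph_eqI)
    show "edges (shadow 1 M) = edges H"
    proof (intro equalityI subsetI)
      fix e assume "e \<in> edges (shadow 1 M)"
      moreover from this obtain u v where "e = {u, v}" "u \<in> ?V" "v \<in> ?V" "u \<noteq> v"
        using graph_edgeD[OF is_graph_shadow[OF M]] unfolding verts_shadow dM by blast
      ultimately show "e \<in> edges H" using edge by blast
    next
      fix e assume "e \<in> edges H"
      moreover from this obtain u v where "e = {u, v}" "u \<in> ?V" "v \<in> ?V" "u \<noteq> v"
        using graph_edgeD[OF H] unfolding vH by blast
      ultimately show "e \<in> edges (shadow 1 M)" using edge by blast
    qed
  qed (simp add: vH)
  moreover have "card (diff_pairs L M) \<le> 2 * card ?D"
  proof -
    have gL: "is_graph (shadow 1 L)" by (rule is_graph_shadow[OF L])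
    have finD: "finite ?D" by (rule finite_diff_edges[OF gL H])
    have two: "finite {(u, v). {u, v} = e} \<and> card {(u, v). {u, v} = e} \<le> 2" if e: "e \<in> ?D" for e
    proof -
      obtain a b where ab: "e = {a, b}" using e graph_edgeD[OF gL, of e] graph_edgeD[OF H, of e] unfolding diff_edges_def by blast
      have sub: "{(u, v). {u, v} = e} \<subseteq> set [(a, b), (b, a)]" unfolding ab by (auto simp: doubleton_eq_iff)
      have "card {(u, v). {u, v} = e} \<le> card (set [(a, b), (b, a)])" by (rule card_mono[OF _ sub]) simp
      also have "\<dots> \<le> 2" using card_length[of "[(a, b), (b, a)]"] by simp
      finally show ?thesis using finite_subset[OF sub] by simp
    qed
    have "diff_pairs L M \<subseteq> (\<Union>e\<in>?D. {(u, v). {u, v} = e})"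
    proof
      fix p assume p: "p \<in> diff_pairs L M"
      obtain u v where uv: "p = (u, v)" by fastforce
      then have "u \<in> ?V" "v \<in> ?V" "u \<noteq> v" "dcol L (u, v) \<noteq> dcol M (u, v)" using p by (auto simp: diff_pairs_def)
      then have "dcol L (u, v) \<noteq> c u v" by (simp add: cM)
      then have "{u, v} \<in> ?D" unfolding c_def by presburger
      then show "p \<in> (\<Union>e\<in>?D. {(u, v). {u, v} = e})" using uv by simp
    qed
    then have "card (diff_pairs L M) \<le> card (\<Union>e\<in>?D. {(u, v). {u, v} = e})"
      using finD two by (intro card_mono finite_UN_I) blast+
    also have "\<dots> \<le> (\<Sum>e\<in>?D. card {(u, v). {u, v} = e})" by (rule card_UN_le[OF finD])
    also have "\<dots> \<le> (\<Sum>e\<in>?D. 2)" using two by (intro sum_mono) blast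
    finally show ?thesis by simp
  qed
  ultimately show ?thesis using M by (intro exI[of _ M]) simp
qed

text \<open>The colouring carries no information here: any test for \<open>P\<close> can be run on the shadow.\<close>

lemma testable_imp_nd_testable:
  assumes P: "graph_property P" and "testable P"
  shows "nd_testable P"
proof -
  define Q where "Q = {L. is_cdigraph 2 L \<and> shadow 1 L \<in> P}"
  obtain T where T: "graph_property T"
    and comp: "\<And>G r. G \<in> P \<Longrightarrow> 1 \<le> r \<Longrightarrow> r \<le> card (verts G) \<Longrightarrow> sample_prob verts induced T G r \<ge> 2/3"
    and sound: "\<And>\<epsilon>::real. \<epsilon> > 0 \<Longrightarrow> \<exists>r0::nat. r0 \<ge> 1 \<and>
        (\<forall>G. is_graph G \<and> enat_ge_real (graph_edit_dist P G) (\<epsilon> * real (card (verts G))^2) \<longrightarrow>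
           (\<forall>r. r0 \<le> r \<and> r \<le> card (verts G) \<longrightarrow> sample_prob verts induced T G r \<le> 1/3))"
    using assms(2) unfolding testable_def by blast
  define T' where "T' = {L. is_cdigraph 2 L \<and> shadow 1 L \<in> T}"
  have sp: "sample_prob dverts dinduced T' L r = sample_prob verts induced T (shadow 1 L) r" if "is_cdigraph 2 L" for L r
    unfolding T'_def by (rule sample_prob_pullback[OF that])
  have "ctestable 2 Q"
    unfolding ctestable_def
  proof (intro exI[of _ T'] conjI ballI allI impI)
    show "cdigraph_property 2 T'" unfolding T'_def by (rule pullback_property[OF T])
  next
    fix L r assume "L \<in> Q" "1 \<le> r \<and> r \<le> card (dverts L)"
    then show "2/3 \<le> sample_prob dverts dinduced T' L r"
      using sp[of L r] comp[of "shadow 1 L" r] by (simp add: Q_def)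
  next
    fix \<epsilon> :: real assume \<epsilon>: "\<epsilon> > 0"
    \<comment> \<open>By \<open>ex_lift\<close>, a graph at distance d from the shadow lifts to a
      colouring at distance at most 2d, so \<epsilon>-far colourings have \<epsilon>/2-far
      shadows.\<close>
    then obtain r0 :: nat where r0: "r0 \<ge> 1" and s: "\<And>G r. is_graph G \<Longrightarrow> enat_ge_real (graph_edit_dist P G) (\<epsilon> / 2 * real (card (verts G))^2) \<Longrightarrow>
           r0 \<le> r \<Longrightarrow> r \<le> card (verts G) \<Longrightarrow> sample_prob verts induced T G r \<le> 1/3"
      using sound[of "\<epsilon> / 2"] by auto
    show "\<exists>r0\<ge>1. \<forall>L. is_cdigraph 2 L \<and> enat_ge_real (cdigraph_edit_dist Q L) (\<epsilon> * (real (card (dverts L)))\<^sup>2) \<longrightarrow>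
        (\<forall>r. r0 \<le> r \<and> r \<le> card (dverts L) \<longrightarrow> sample_prob dverts dinduced T' L r \<le> 1/3)"
    proof (intro exI[of _ r0] conjI allI impI; (elim conjE)?)
      fix L r assume L: "is_cdigraph 2 L" and far: "enat_ge_real (cdigraph_edit_dist Q L) (\<epsilon> * (real (card (dverts L)))\<^sup>2)"
        and r: "r0 \<le> r" "r \<le> card (dverts L)"
      have "enat_ge_real (graph_edit_dist P (shadow 1 L)) (\<epsilon> / 2 * (real (card (dverts L)))\<^sup>2)"
        unfolding graph_far_iff
      proof (intro ballI impI)
        fix H assume H: "H \<in> P" "verts H = verts (shadow 1 L)"
        then have "is_graph H" using P by (simp add: graph_property_def)
        then obtain M where M: "is_cdigraph 2 M" "shadow 1 M = H" "dverts M = dverts L"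
          and le: "card (diff_pairs L M) \<le> 2 * card (diff_edges (shadow 1 L) H)"
          using ex_lift[OF L, of H] H by auto
        have "M \<in> Q" using M H by (simp add: Q_def)
        then have "real (card (diff_pairs L M)) \<ge> \<epsilon> * (real (card (dverts L)))\<^sup>2" using far M unfolding cdigraph_far_iff by blast
        then show "\<epsilon> / 2 * (real (card (dverts L)))\<^sup>2 \<le> real (card (diff_edges (shadow 1 L) H))" using le by linarith
      qed
      then show "sample_prob dverts dinduced T' L r \<le> 1/3"
        using sp[OF L, of r] s[OF is_graph_shadow[OF L, of 1], of r] r by simp
    qed (use r0 in simp)
  qed
  moreover have "shadow 1 ` Q = P"
  proof (intro equalityI subsetI)
    fix H assume H: "H \<in> P"
    then have gH: "is_graph H" using P by (simp add: graph_property_def)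
    \<comment> \<open>An arbitrary starting colouring on the nodes of \<open>H\<close>;
      \<open>ex_lift\<close> corrects it.\<close>
    define L where "L = (verts H, \<lambda>(u, v). if u \<in> verts H \<and> v \<in> verts H \<and> u \<noteq> v then 1 else (0::nat))"
    have "is_cdigraph 2 L" "dverts L = verts H"
      using gH by (auto simp: L_def is_cdigraph_def dverts_def dcol_def is_graph_def)
    then obtain M where "is_cdigraph 2 M" "shadow 1 M = H" using ex_lift[of L H] gH by auto
    then show "H \<in> shadow 1 ` Q" using H unfolding Q_def by blast
  qed (auto simp: Q_def)
  moreover have "cdigraph_property 2 Q" unfolding Q_def by (rule pullback_property[OF P])
  ultimately show ?thesis unfolding nd_testable_def by (intro exI[of _ 2] exI[of _ 1] exI[of _ Q]) simp
qed

section \<open>Assembling the test for the shadow property\<close>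

lemma sample_prob_iso:
  assumes T: "cdigraph_property k T" and L: "is_cdigraph k L" and M: "is_cdigraph k M"
    and f: "bij_betw f (dverts L) (dverts M)"
    and c: "\<And>u v. u \<in> dverts L \<Longrightarrow> v \<in> dverts L \<Longrightarrow> u \<noteq> v \<Longrightarrow> dcol M (f u, f v) = dcol L (u, v)"
  shows "sample_prob dverts dinduced T M q = sample_prob dverts dinduced T L q"
proof -
  have inj: "inj_on f (dverts L)" and im: "f ` dverts L = dverts M" using f by (auto simp: bij_betw_def)
  have mem: "dinduced L S \<in> T \<longleftrightarrow> dinduced M (f ` S) \<in> T" if S: "S \<subseteq> dverts L" for S
  proof (rule property_iso_iff[OF T])
    show "is_cdigraph k (dinduced L S)" by (rule is_cdigraph_dinduced[OF L S])
    show "is_cdigraph k (dinduced M (f ` S))" by (rule is_cdigraph_dinduced[OF M]) (use S im in blast)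
    have injS: "inj_on f S" using inj S by (rule inj_on_subset)
    show "cdigraph_iso (dinduced L S) (dinduced M (f ` S))"
      unfolding cdigraph_iso_def dverts_dinduced
    proof (intro exI[of _ f] conjI ballI impI)
      show "bij_betw f S (f ` S)" using injS by (simp add: bij_betw_def)
      fix u v assume uv: "u \<in> S" "v \<in> S" "u \<noteq> v"
      then have "f u \<noteq> f v" using injS by (auto simp: inj_on_def)
      then show "dcol (dinduced M (f ` S)) (f u, f v) = dcol (dinduced L S) (u, v)"
        using uv S c[of u v] by (auto simp: dcol_dinduced)
    qed
  qed
  have "{S \<in> subs (dverts M) q. dinduced M S \<in> T} = (\<lambda>S. f ` S) ` {S \<in> subs (dverts L) q. dinduced L S \<in> T}"
  proof (intro equalityI subsetI)
    fix S' assume S': "S' \<in> {S \<in> subs (dverts M) q. dinduced M S \<in> T}"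
    then obtain S where S: "S \<subseteq> dverts L" "S' = f ` S" unfolding im[symmetric] by (auto simp: subs_def subset_image_iff)
    moreover have "card S = q" using S' S card_image[OF inj_on_subset[OF inj S(1)]] by (simp add: subs_def)
    ultimately show "S' \<in> (\<lambda>S. f ` S) ` {S \<in> subs (dverts L) q. dinduced L S \<in> T}"
      using S' mem[OF S(1)] by (auto simp: subs_def)
  next
    fix S' assume "S' \<in> (\<lambda>S. f ` S) ` {S \<in> subs (dverts L) q. dinduced L S \<in> T}"
    then obtain S where S: "S \<subseteq> dverts L" "card S = q" "dinduced L S \<in> T" "S' = f ` S" by (auto simp: subs_def)
    then show "S' \<in> {S \<in> subs (dverts M) q. dinduced M S \<in> T}"
      using mem[OF S(1)] im card_image[OF inj_on_subset[OF inj S(1)]] by (auto simp: subs_def)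
  qed
  moreover have "inj_on (\<lambda>S. f ` S) {S \<in> subs (dverts L) q. dinduced L S \<in> T}"
    using inj_on_image_eq_iff[OF inj] by (auto simp: inj_on_def subs_def)
  ultimately have "card {S \<in> subs (dverts M) q. dinduced M S \<in> T} = card {S \<in> subs (dverts L) q. dinduced L S \<in> T}"
    by (simp add: card_image)
  then show ?thesis unfolding sample_prob_subs using bij_betw_same_card[OF f] by simp
qed

text \<open>The witnessing colouring is transported along the inverse of the isomorphism.\<close>

lemma accepts_iso:
  assumes T: "cdigraph_property k T" and acc: "accepts k m T q F" and H: "is_graph H" and iso: "graph_iso F H"
  shows "accepts k m T q H"
proof -
  obtain L where L: "is_cdigraph k L" and sh: "shadow m L = F" and sp: "sample_prob dverts dinduced T L q \<ge> 1/2"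
    using acc unfolding accepts_def by blast
  obtain f where "bij_betw f (verts F) (verts H)" and eH: "edges H = (\<lambda>e. f ` e) ` edges F"
    using iso unfolding graph_iso_def by blast
  then have f: "bij_betw f (dverts L) (verts H)" using sh by auto
  let ?g = "inv_into (dverts L) f"
  define M where "M = (verts H, \<lambda>(x, y). if x \<in> verts H \<and> y \<in> verts H \<and> x \<noteq> y then dcol L (?g x, ?g y) else 0)"
  have dM: "dverts M = verts H" by (simp add: M_def dverts_def)
  have cM: "dcol M (x, y) = (if x \<in> verts H \<and> y \<in> verts H \<and> x \<noteq> y then dcol L (?g x, ?g y) else 0)" for x y
    by (simp add: M_def dcol_def)
  have g: "?g x \<in> dverts L" "f (?g x) = x" if "x \<in> verts H" for x
    using f that by (auto simp: bij_betw_def inv_into_into f_inv_into_f)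
  have M: "is_cdigraph k M"
    unfolding is_cdigraph_def dM
  proof (intro conjI allI impI)
    show "finite (verts H)" using H by (simp add: is_graph_def)
  next
    fix x y assume xy: "x \<in> verts H \<and> y \<in> verts H \<and> x \<noteq> y"
    then have "?g x \<noteq> ?g y" using g by metis
    then show "dcol M (x, y) \<in> {1..k}" using dcol_range[OF L, of "?g x" "?g y"] g xy unfolding cM by simp
  next
    fix x y assume "\<not> (x \<in> verts H \<and> y \<in> verts H \<and> x \<noteq> y)"
    then show "dcol M (x, y) = 0" unfolding cM by argo
  qed
  have f': "bij_betw f (dverts L) (dverts M)" using f dM by simp
  have c: "dcol M (f u, f v) = dcol L (u, v)" if uv: "u \<in> dverts L" "v \<in> dverts L" "u \<noteq> v" for u v
  proof -
    have inj: "inj_on f (dverts L)" and im: "f ` dverts L = verts H" using f by (auto simp: bij_betw_def)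
    then have "f u \<in> verts H" "f v \<in> verts H" "f u \<noteq> f v" using uv by (auto simp: inj_on_def)
    then show ?thesis using uv inj by (simp add: cM inv_into_f_f)
  qed
  have "shadow m M = H"
    using shadow_edges_image[OF f' c, of m] eH sh dM by (intro graph_eqI) simp_all
  moreover have "sample_prob dverts dinduced T M q \<ge> 1/2" using sp sample_prob_iso[OF T L M f' c] by simp
  ultimately show ?thesis using M unfolding accepts_def by blast
qed

text \<open>\<phi> r is the largest q with q and R q both at most r, or 0 if there is none. A fixed
  q is a candidate from r = q + R q on, so \<phi> tends to infinity.\<close>

lemma ex_slow_function:
  fixes R :: "nat \<Rightarrow> nat"
  shows "\<exists>\<phi>. (\<forall>r. \<phi> r = 0 \<or> R (\<phi> r) \<le> r) \<and> (\<forall>r. \<phi> r \<le> r) \<and> (\<forall>q. \<exists>r0. \<forall>r\<ge>r0. q \<le> \<phi> r)"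
proof -
  define A where "A = (\<lambda>r. insert 0 {q. q \<le> r \<and> R q \<le> r})"
  define \<phi> where "\<phi> = (\<lambda>r. Max (A r))"
  have fin: "finite (A r)" for r by (simp add: A_def)
  have mem: "\<phi> r \<in> A r" for r unfolding \<phi>_def by (rule Max_in[OF fin]) (simp add: A_def)
  have "\<phi> r = 0 \<or> R (\<phi> r) \<le> r" "\<phi> r \<le> r" for r using mem[of r] by (auto simp: A_def)
  moreover have "q \<le> \<phi> r" if "r \<ge> q + R q" for q r
    unfolding \<phi>_def by (rule Max_ge[OF fin]) (use that in \<open>simp add: A_def\<close>)
  ultimately show ?thesis by blast
qed

lemma is_graph_induced:
  assumes "is_graph G" "S \<subseteq> verts G"
  shows "is_graph (induced G S)"
proof -
  have "finite S" using assms finite_subset by (auto simp: is_graph_def)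
  moreover have "\<exists>u v. e = {u, v} \<and> u \<in> S \<and> v \<in> S \<and> u \<noteq> v" if "e \<in> edges G" "e \<subseteq> S" for e
    using graph_edgeD[OF assms(1) that(1)] that(2) by auto
  ultimately show ?thesis unfolding is_graph_def verts_induced by (auto simp: induced_def edges_def)
qed

text \<open>If \<open>G\<close> is accepted too often, \<open>Sound\<close> gives a colouring
  \<open>L\<close> with shadow close to \<open>G\<close> and density of \<open>T\<close> above 1/3.
  Soundness of \<open>T\<close> puts \<open>L\<close> close to some member of \<open>Q\<close>,
  whose shadow lies in \<open>P\<close> and close to \<open>G\<close>.\<close>

lemma nd_testable_imp_testable:
  assumes "nd_testable P"
  shows "testable P"
proof -
  obtain k m Q where mk: "m \<le> k" "1 \<le> m" and Q: "cdigraph_property k Q" and "ctestable k Q" and QP: "shadow m ` Q = P"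
    using assms unfolding nd_testable_def by blast
  then obtain T where T: "cdigraph_property k T"
    and comp: "\<And>L r. L \<in> Q \<Longrightarrow> 1 \<le> r \<Longrightarrow> r \<le> card (dverts L) \<Longrightarrow> sample_prob dverts dinduced T L r \<ge> 2/3"
    and sound: "\<And>\<epsilon>::real. \<epsilon> > 0 \<Longrightarrow> \<exists>r0::nat. r0 \<ge> 1 \<and>
        (\<forall>L. is_cdigraph k L \<and> enat_ge_real (cdigraph_edit_dist Q L) (\<epsilon> * real (card (dverts L))^2) \<longrightarrow>
           (\<forall>r. r0 \<le> r \<and> r \<le> card (dverts L) \<longrightarrow> sample_prob dverts dinduced T L r \<le> 1/3))"
    unfolding ctestable_def by blast
  define Comp where "Comp = (\<lambda>q R. \<forall>L r. finite (dverts L) \<and> R \<le> r \<and> r \<le> card (dverts L) \<and> sample_prob dverts dinduced T L q \<ge> 2/3 \<longrightarrow>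
     real (card {S \<in> subs (dverts L) r. sample_prob dverts dinduced T (dinduced L S) q \<ge> 1/2}) \<ge> 2/3 * real (card (dverts L) choose r))"
  define Sound where "Sound = (\<lambda>q R. \<forall>G r. is_graph G \<and> R \<le> r \<and> r \<le> card (verts G) \<and>
     real (card {S \<in> subs (verts G) r. accepts k m T q (induced G S)}) > 1/3 * real (card (verts G) choose r) \<longrightarrow>
     (\<exists>L. is_cdigraph k L \<and> dverts L = verts G \<and> sample_prob dverts dinduced T L q > 1/3 \<and>
        real (card (diff_edges (shadow m L) G)) \<le> (real (card (verts G)))\<^sup>2 / real q))"
  have "\<forall>q. \<exists>R. q \<ge> 1 \<longrightarrow> Comp q R \<and> Sound q R"
  proof
    fix q :: nat
    show "\<exists>R. q \<ge> 1 \<longrightarrow> Comp q R \<and> Sound q R"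
    proof (cases "q \<ge> 1")
      case True
      obtain R1 where "Comp q R1" using completeness[OF True, of T] unfolding Comp_def by (elim exE)
      moreover obtain R2 where "Sound q R2" using soundness[OF mk(2,1) True T] unfolding Sound_def by (elim exE)
      \<comment> \<open>Both conditions persist when the threshold grows, so the sum serves
        both.\<close>
      ultimately have "Comp q (R1 + R2)" "Sound q (R1 + R2)"
        unfolding Comp_def Sound_def by (meson add_leD1, meson add_leD2)
      then show ?thesis by blast
    qed simp
  qed
  from choice[OF this] obtain R where R: "\<And>q. q \<ge> 1 \<Longrightarrow> Comp q (R q)" "\<And>q. q \<ge> 1 \<Longrightarrow> Sound q (R q)" by blast
  obtain \<phi> where \<phi>: "\<And>r. \<phi> r = 0 \<or> R (\<phi> r) \<le> r" "\<And>r. \<phi> r \<le> r" "\<And>q. \<exists>r0. \<forall>r\<ge>r0. q \<le> \<phi> r"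
    using ex_slow_function[of R] by blast
  \<comment> \<open>The order of the sample determines q. Where \<phi> is 0 everything is accepted,
    which does not hurt soundness because \<phi> is eventually large.\<close>
  define T' where "T' = {F. is_graph F \<and> (\<phi> (card (verts F)) = 0 \<or> accepts k m T (\<phi> (card (verts F))) F)}"
  have T'_iff: "induced G S \<in> T' \<longleftrightarrow> \<phi> r = 0 \<or> accepts k m T (\<phi> r) (induced G S)" if "is_graph G" "S \<in> subs (verts G) r" for G S r
    using that is_graph_induced[of G S] by (auto simp: T'_def subs_def)
  show ?thesis
    unfolding testable_def
  proof (intro exI[of _ T'] conjI ballI allI impI)
    show "graph_property T'"
      unfolding graph_property_def
    proof (intro conjI ballI allI impI)
      fix F H assume FH: "F \<in> T' \<and> is_graph H \<and> graph_iso F H"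
      then have "card (verts H) = card (verts F)" unfolding graph_iso_def using bij_betw_same_card by metis
      then show "H \<in> T'" using FH accepts_iso[OF T, of m _ F H] by (auto simp: T'_def)
    qed (simp add: T'_def)
  next
    fix G r assume "G \<in> P" and r: "1 \<le> r \<and> r \<le> card (verts G)"
    then obtain L where L: "L \<in> Q" and G: "G = shadow m L" using QP by blast
    have cL: "is_cdigraph k L" using Q L by (simp add: cdigraph_property_def)
    have gG: "is_graph G" unfolding G by (rule is_graph_shadow[OF cL])
    have vG: "verts G = dverts L" by (simp add: G)
    have finL: "finite (dverts L)" using cL by (simp add: is_cdigraph_def)
    have C0: "real (card (verts G) choose r) > 0" using r by simp
    have "2/3 * real (card (verts G) choose r) \<le> real (card {S \<in> subs (verts G) r. induced G S \<in> T'})"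
    proof (cases "\<phi> r = 0")
      case True
      then have "{S \<in> subs (verts G) r. induced G S \<in> T'} = subs (verts G) r" using T'_iff[OF gG] by blast
      then show ?thesis using finL by (simp add: card_subs vG)
    next
      case False
      then have q: "\<phi> r \<ge> 1" by simp
      have Rr: "R (\<phi> r) \<le> r" using \<phi>(1)[of r] False by simp
      have "\<phi> r \<le> card (dverts L)" using \<phi>(2)[of r] r vG by simp
      then have "sample_prob dverts dinduced T L (\<phi> r) \<ge> 2/3" using comp[OF L q] by simp
      then have "2/3 * real (card (dverts L) choose r) \<le> real (card {S \<in> subs (dverts L) r. sample_prob dverts dinduced T (dinduced L S) (\<phi> r) \<ge> 1/2})"
        using R(1)[OF q, unfolded Comp_def, rule_format, of L r] Rr r vG finL by metis
      also have "\<dots> \<le> real (card {S \<in> subs (verts G) r. induced G S \<in> T'})"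
      proof (intro of_nat_mono card_mono subsetI)
        fix S assume S: "S \<in> {S \<in> subs (dverts L) r. sample_prob dverts dinduced T (dinduced L S) (\<phi> r) \<ge> 1/2}"
        then have SL: "S \<subseteq> dverts L" by (simp add: subs_def)
        have "accepts k m T (\<phi> r) (induced G S)"
          unfolding accepts_def G using S is_cdigraph_dinduced[OF cL SL] shadow_dinduced[OF cL SL, of m] by blast
        then show "S \<in> {S \<in> subs (verts G) r. induced G S \<in> T'}" using S T'_iff[OF gG, of S r] vG by simp
      qed (use finL vG in simp)
      finally show ?thesis unfolding vG .
    qed
    then show "2/3 \<le> sample_prob verts induced T' G r"
      unfolding sample_prob_subs using C0 by (subst pos_le_divide_eq) simp_all
  next
    fix \<epsilon> :: real assume \<epsilon>: "\<epsilon> > 0"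
    then obtain q1 :: nat where s: "\<And>L r. is_cdigraph k L \<Longrightarrow> enat_ge_real (cdigraph_edit_dist Q L) (\<epsilon> / 2 * real (card (dverts L))^2) \<Longrightarrow>
           q1 \<le> r \<Longrightarrow> r \<le> card (dverts L) \<Longrightarrow> sample_prob dverts dinduced T L r \<le> 1/3"
      using sound[of "\<epsilon> / 2"] by auto
    \<comment> \<open>\<phi> r beyond q1 brings soundness of \<open>T\<close> for \<epsilon>/2 into
      force; beyond 2/\<epsilon> it makes the shadow error n^2 / \<phi> r at most (\<epsilon>/2)
      n^2.\<close>
    obtain r0 where r0: "\<forall>r\<ge>r0. q1 + nat \<lceil>2 / \<epsilon>\<rceil> + 1 \<le> \<phi> r" using \<phi>(3) by blast
    show "\<exists>r0\<ge>1. \<forall>G. is_graph G \<and> enat_ge_real (graph_edit_dist P G) (\<epsilon> * (real (card (verts G)))\<^sup>2) \<longrightarrow>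
        (\<forall>r. r0 \<le> r \<and> r \<le> card (verts G) \<longrightarrow> sample_prob verts induced T' G r \<le> 1/3)"
    proof (intro exI[of _ "Suc r0"] conjI allI impI; (elim conjE)?)
      fix G r assume G: "is_graph G" and far: "enat_ge_real (graph_edit_dist P G) (\<epsilon> * (real (card (verts G)))\<^sup>2)"
        and r: "Suc r0 \<le> r" "r \<le> card (verts G)"
      let ?n2 = "(real (card (verts G)))\<^sup>2"
      have n2: "?n2 > 0" using r by simp
      have q: "q1 + nat \<lceil>2 / \<epsilon>\<rceil> + 1 \<le> \<phi> r" using r0 r by simp
      then have q1: "\<phi> r \<ge> 1" "\<phi> r \<noteq> 0" "q1 \<le> \<phi> r" by auto
      have C0: "real (card (verts G) choose r) > 0" using r by simp
      show "sample_prob verts induced T' G r \<le> 1/3"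
      proof (rule ccontr)
        assume "\<not> sample_prob verts induced T' G r \<le> 1/3"
        then have "real (card {S \<in> subs (verts G) r. induced G S \<in> T'}) > 1/3 * real (card (verts G) choose r)"
          unfolding sample_prob_subs not_le by (subst (asm) pos_less_divide_eq[OF C0])
        moreover have "{S \<in> subs (verts G) r. induced G S \<in> T'} = {S \<in> subs (verts G) r. accepts k m T (\<phi> r) (induced G S)}"
        proof (rule Collect_cong)
          fix S
          show "(S \<in> subs (verts G) r \<and> induced G S \<in> T') = (S \<in> subs (verts G) r \<and> accepts k m T (\<phi> r) (induced G S))"
            using T'_iff[OF G, of S r] q1(2) by blast
        qed
        moreover have "R (\<phi> r) \<le> r" using \<phi>(1)[of r] q1 by simp
        ultimately have "is_graph G \<and> R (\<phi> r) \<le> r \<and> r \<le> card (verts G) \<and>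
          real (card {S \<in> subs (verts G) r. accepts k m T (\<phi> r) (induced G S)}) > 1/3 * real (card (verts G) choose r)"
          using G r(2) by simp
        from R(2)[OF q1(1), unfolded Sound_def, rule_format, OF this]
        obtain L where L: "is_cdigraph k L" and dL: "dverts L = verts G" and sp: "sample_prob dverts dinduced T L (\<phi> r) > 1/3"
          and dist: "real (card (diff_edges (shadow m L) G)) \<le> ?n2 / real (\<phi> r)"
          by (elim exE conjE)
        have "\<phi> r \<le> card (dverts L)" using \<phi>(2)[of r] r dL by simp
        \<comment> \<open>Contrapositive of soundness of \<open>T\<close> for random subgraphs of
          \<open>L\<close> on \<phi> r nodes.\<close>
        then have "\<not> enat_ge_real (cdigraph_edit_dist Q L) (\<epsilon> / 2 * ?n2)"
          using s[OF L, of "\<phi> r"] q1 sp dL by auto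
        then obtain M where M: "M \<in> Q" "dverts M = dverts L" "real (card (diff_pairs L M)) < \<epsilon> / 2 * ?n2"
          unfolding cdigraph_far_iff by (auto simp: not_le)
        have cM: "is_cdigraph k M" using M Q by (simp add: cdigraph_property_def)
        have "shadow m M \<in> P" "verts (shadow m M) = verts G" using M QP dL by auto
        then have "\<epsilon> * ?n2 \<le> real (card (diff_edges G (shadow m M)))" using far unfolding graph_far_iff by blast
        also have "\<dots> \<le> real (card (diff_edges G (shadow m L))) + real (card (diff_edges (shadow m L) (shadow m M)))"
          using card_diff_edges_triangle[OF G is_graph_shadow[OF L, of m] is_graph_shadow[OF cM, of m]] by linarith
        also have "\<dots> < ?n2 / real (\<phi> r) + \<epsilon> / 2 * ?n2"
          using dist M(3) card_diff_shadow[OF L cM M(2), of m] by (simp add: diff_edges_commute[of G])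
        also have "?n2 / real (\<phi> r) \<le> \<epsilon> / 2 * ?n2"
        proof -
          have "2 / \<epsilon> \<le> real (\<phi> r)" using q by linarith
          then have "2 \<le> real (\<phi> r) * \<epsilon>" using \<epsilon> by (simp add: pos_divide_le_eq)
          then have "1 / real (\<phi> r) \<le> \<epsilon> / 2" using q1 by (simp add: pos_divide_le_eq mult.commute)
          then have "1 / real (\<phi> r) * ?n2 \<le> \<epsilon> / 2 * ?n2" by (rule mult_right_mono) simp
          then show ?thesis by simp
        qed
        finally show False by simp
      qed
    qed simp
  qed
qed

theorem theorem1:
  assumes "graph_property P"
  shows "nd_testable P \<longleftrightarrow> testable P"
  using testable_imp_nd_testable[OF assms] nd_testable_imp_testable by blast

end
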